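(* Let $(\sigma_n)_{n\ge1}$ be an exponentially concentrated random sofic approximation to the free group $\Gamma$, let $\mathtt A$ be a finite alphabet, and let $\mu\in\mathrm{Prob}^\Gamma(\mathtt{A}^\Gamma)$. If $\mu$ satisfies the second-moment condition, i.e. $\overline{\mathrm h}^{\mathrm{ann}}(\lambda)\le2\,\underline{\mathrm h}^{\mathrm{ann}}(\mu)$ for every self-joining $\lambda$ of $\mu$, then $h^\flat(\mu)=\underline{\mathrm h}^{\mathrm{ann}}(\mu)$ and $h^\sharp(\mu)=\overline{\mathrm h}^{\mathrm{ann}}(\mu)$.
   Context: $\Gamma$ is the free group of rank $r$ with free generators $s_1,\dots,s_r$ and identity $e$; $d(\gamma,e)$ is word length. For any finite alphabet $\mathtt A$, $\Gamma$ acts on $\mathtt{A}^\Gamma$ by $(g\cdot x)(h)=x(hg)$; $\mathrm{Prob}^\Gamma(\mathtt{A}^\Gamma)$ is the set of shift-invariant Borel probability measures. A self-joining of $\mu$ is a shift-invariant coupling of $\mu$ with itself, viewed as an element of $\mathrm{Prob}^\Gamma((\mathtt{A}\times\mathtt{A})^\Gamma)$; its annealed entropy is defined using the alphabet $\mathtt A\times\mathtt A$. For a finite set $V$, $\sigma\in\mathrm{Hom}(\Gamma,\mathrm{Sym}(V))$ and $x\in\mathtt{A}^V$, let $(\Pi_v^\sigma x)(h)=x(\sigma^h v)$ and $P_x^\sigma=\frac1{|V|}\sum_{v\in V}\delta_{\Pi_v^\sigma x}$. Give $\mathtt{A}^\Gamma$ the metric $d(x,y)=\sum_{\gamma}\mathbf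 1_{\{x(\gamma)\ne y(\gamma)\}}(5r^2)^{-d(\gamma,e)}$ and $\mathrm{Prob}^\Gamma(\mathtt{A}^\Gamma)$ the transportation metric $\overline d(\mu,\nu)=\sup\{|\int f\,d\mu-\int f\,d\nu| : f\text{ real-valued 1-Lipschitz}\}$. Let $\Omega(\sigma,\mu,\varepsilon)=\{x\in\mathtt{A}^V:\overline d(P_x^\sigma,\mu)<\varepsilon\}$. $\sigma$ is $(F,\delta)$-sofic ($F\subset\Gamma$ finite, $\delta>0$) if $\frac1{|V|}|\{v:\sigma(\gamma_1)v\ne\sigma(\gamma_2)v\text{ for all distinct }\gamma_1,\gamma_2\in F\}|>1-\delta$. A random sofic approximation is a sequence of random $\sigma_n\in\mathrm{Hom}(\Gamma,\mathrm{Sym}(V_n))$, $V_n$ finite, such that for every $(F,\delta)$, $\limsup_n\frac1{|V_n|}\log\mathbb{P}\{\sigma_n\text{ not }(F,\delta)\text{-sofic}\}=-\infty$. $\sigma_1,\sigma_2\in\mathrm{Hom}(\Gamma,\mathrm{Sym}(V))$ differ by a switching if for some $i,j\in V$, $k\in\{1,\dots,r\}$, $\sigma_1^{s_k}(i)=\sigma_2^{s_k}(j)$, $\sigma_1^{s_k}(j)=\sigma_2^{s_k}(i)$, and the generator permutations are otherwise identical; $d(\sigma_1,\sigma_2)=m/|V|$ with $m$ the minimal number of switchings from $\sigma_1$ to $\sigma_2$. The sequence is exponentially concentrated if for some $C>0$, for all $n$, all 1-Lipschitz $f\colon\mathrm{Hom}(\Gamma,\mathrm{Sym}(V_n))\to\mathbb{R}$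 and $t>0$, $\mathbb{P}\{|f(\sigma_n)-\mathbb{E}f(\sigma_n)|>t\}\le2e^{-C|V_n|t^2}$. Annealed entropies: $\overline{\mathrm h}^{\mathrm{ann}}(\mu)=\inf_{\varepsilon>0}\limsup_n\frac1{|V_n|}\log\mathbb{E}|\Omega(\sigma_n,\mu,\varepsilon)|$, $\underline{\mathrm h}^{\mathrm{ann}}(\mu)=\inf_{\varepsilon>0}\liminf_n\frac1{|V_n|}\log\mathbb{E}|\Omega(\sigma_n,\mu,\varepsilon)|$ (with $\log0=-\infty$). For $h\in[0,\log|\mathtt{A}|]$ let $\rho_\mu(\sigma,h)=\inf\{\varepsilon>0:\frac1{|V|}\log|\Omega(\sigma,\mu,\varepsilon)|\ge h\}$, $\overline\rho_\mu(h)=\limsup_n\mathbb{E}\rho_\mu(\sigma_n,h)$, $\underline\rho_\mu(h)=\liminf_n\mathbb{E}\rho_\mu(\sigma_n,h)$. Then $h^\flat(\mu)=\sup\{h\in[0,\log|\mathtt A|]:\overline\rho_\mu(h)=0\}$, $h^\sharp(\mu)=\sup\{h\in[0,\log|\mathtt A|]:\underline\rho_\mu(h)=0\}$, with $\sup\varnothing=-\infty$. *)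

theory Defs
  imports "HOL-Probability.Probability" "HOL-Algebra.Bij"
begin

section \<open>The free group on a finite set of generators\<close>

text \<open>The free group of rank \<open>r = CARD('k)\<close> is the set of reduced words over the letters
  \<open>(k, True)\<close>, standing for the generator \<open>s\<^sub>k\<close>, and \<open>(k, False)\<close>, standing for its inverse.\<close>

definition inv_letter :: "'k \<times> bool \<Rightarrow> 'k \<times> bool" where
  "inv_letter a = (fst a, \<not> snd a)"

definition reduced_word :: "('k \<times> bool) list \<Rightarrow> bool" where
  "reduced_word w \<longleftrightarrow> successively (\<lambda>a b. b \<noteq> inv_letter a) w"

fun cons_reduce :: "'k \<times> bool \<Rightarrow> ('k \<times> bool) list \<Rightarrow> ('k \<times> bool) list" where
  "cons_reduce a [] = [a]"
| "cons_reduce a (b # w) = (if b = inv_letter a then w else a # b # w)"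

lemma inv_letter_inv_letter [simp]: "inv_letter (inv_letter a) = a"
  by (simp add: inv_letter_def)

lemma reduced_Nil [simp]: "reduced_word []"
  by (simp add: reduced_word_def)

lemma reduced_ConsD: "reduced_word (a # w) \<Longrightarrow> reduced_word w"
  by (cases w) (auto simp: reduced_word_def)

lemma reduced_cons_reduce: "reduced_word w \<Longrightarrow> reduced_word (cons_reduce a w)"
  by (cases w) (auto simp: reduced_word_def dest: reduced_ConsD[unfolded reduced_word_def])

lemma reduced_foldr: "reduced_word v \<Longrightarrow> reduced_word (foldr cons_reduce u v)"
  by (induction u) (auto intro: reduced_cons_reduce)

lemma cons_reduce_reduced: "reduced_word (a # w) \<Longrightarrow> cons_reduce a w = a # w"
  by (cases w) (auto simp: reduced_word_def)

lemma cons_reduce_inv: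
  assumes "reduced_word w"
  shows "cons_reduce (inv_letter a) (cons_reduce a w) = w"
proof (cases w)
  case (Cons b v)
  show ?thesis
  proof (cases "b = inv_letter a")
    case True
    then show ?thesis
      using assms Cons by (simp add: cons_reduce_reduced)
  qed (use Cons in auto)
qed auto

lemma foldr_cons_reduce_reduced: "reduced_word u \<Longrightarrow> foldr cons_reduce u [] = u"
proof (induction u)
  case (Cons a u)
  then show ?case
    using reduced_ConsD[OF Cons.prems] by (simp add: cons_reduce_reduced del: split_paired_All)
qed simp

lemma foldr_cons_reduce:
  assumes "reduced_word v" "reduced_word w"
  shows "foldr cons_reduce (cons_reduce a v) w = cons_reduce a (foldr cons_reduce v w)"
proof (cases v)
  case (Cons b u)
  show ?thesis
  proof (cases "b = inv_letter a")
    case True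
    have "cons_reduce (inv_letter (inv_letter a))
            (cons_reduce (inv_letter a) (foldr cons_reduce u w)) = foldr cons_reduce u w"
      by (intro cons_reduce_inv reduced_foldr assms)
    then show ?thesis
      using Cons True by simp
  qed (use Cons in auto)
qed auto

lemma foldr_cons_reduce_assoc:
  assumes "reduced_word v" "reduced_word w"
  shows "foldr cons_reduce (foldr cons_reduce u v) w
    = foldr cons_reduce u (foldr cons_reduce v w)"
  by (induction u) (auto simp: foldr_cons_reduce reduced_foldr assms)

lemma foldr_cons_reduce_left_inv:
  assumes "reduced_word w"
  shows "foldr cons_reduce (rev (map inv_letter u)) (foldr cons_reduce u w) = w"
  using assms by (induction u arbitrary: w) (auto simp: cons_reduce_inv reduced_foldr)

lemma reduced_single [simp]: "reduced_word [a]"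
  by (simp add: reduced_word_def)

typedef 'k free_group = "{w :: ('k \<times> bool) list. reduced_word w}"
  by (rule exI[of _ "[]"]) simp

instance free_group :: (countable) countable
  by (rule countable_classI[of "to_nat \<circ> Rep_free_group"]) (simp add: Rep_free_group_inject)

setup_lifting type_definition_free_group

lift_definition fg_one :: "'k free_group" is "[]"
  by simp

lift_definition fg_mult :: "'k free_group \<Rightarrow> 'k free_group \<Rightarrow> 'k free_group"
  is "\<lambda>u v. foldr cons_reduce u v"
  by (rule reduced_foldr)

lift_definition fg_gen :: "'k \<Rightarrow> 'k free_group" is "\<lambda>k. [(k, True)]"
  by simp

lift_definition word_length :: "'k free_group \<Rightarrow> nat" is length .

definition free_group_monoid :: "'k free_group monoid" where
  "free_group_monoid = \<lparr>carrier = UNIV, mult = fg_mult, one = fg_one\<rparr>"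

lemma group_free_group_monoid: "group (free_group_monoid :: 'k free_group monoid)"
proof (rule groupI)
  fix x :: "'k free_group"
  define y where "y = foldr cons_reduce (rev (map inv_letter (Rep_free_group x))) []"
  have x: "reduced_word (Rep_free_group x)"
    using Rep_free_group by blast
  have y: "reduced_word y"
    unfolding y_def by (intro reduced_foldr) simp
  have "foldr cons_reduce y (Rep_free_group x) = []"
    using foldr_cons_reduce_left_inv[of "[]" "Rep_free_group x"] x
    by (simp add: y_def foldr_cons_reduce_assoc foldr_cons_reduce_reduced)
  then have "fg_mult (Abs_free_group y) x = fg_one"
    using y by (simp add: fg_mult_def fg_one_def Abs_free_group_inverse)
  then show "\<exists>y\<in>carrier free_group_monoid. y \<otimes>\<^bsub>free_group_monoid\<^esub> x = \<one>\<^bsub>free_group_monoid\<^esub>"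
    by (auto simp: free_group_monoid_def)
next
  fix x y z :: "'k free_group"
  have "fg_mult (fg_mult x y) z = fg_mult x (fg_mult y z)"
    by transfer (rule foldr_cons_reduce_assoc)
  then show "x \<otimes>\<^bsub>free_group_monoid\<^esub> y \<otimes>\<^bsub>free_group_monoid\<^esub> z
      = x \<otimes>\<^bsub>free_group_monoid\<^esub> (y \<otimes>\<^bsub>free_group_monoid\<^esub> z)"
    by (simp add: free_group_monoid_def)
next
  fix x :: "'k free_group"
  have "fg_mult fg_one x = x"
    by transfer simp
  then show "\<one>\<^bsub>free_group_monoid\<^esub> \<otimes>\<^bsub>free_group_monoid\<^esub> x = x"
    by (simp add: free_group_monoid_def)
qed (auto simp: free_group_monoid_def)


section \<open>Shift-invariant measures and the transportation metric\<close>

definition shift :: "'k free_group \<Rightarrow> ('k free_group \<Rightarrow> 'a) \<Rightarrow> 'k free_group \<Rightarrow> 'a" where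
  "shift g x = (\<lambda>h. x (fg_mult h g))"

definition config_space :: "('k free_group \<Rightarrow> 'a) measure" where
  "config_space = Pi\<^sub>M UNIV (\<lambda>_. count_space UNIV)"

text \<open>The product \<open>\<sigma>\<close>-algebra is the Borel \<open>\<sigma>\<close>-algebra of the product topology.\<close>

lemma sets_config_space_borel:
  "sets (config_space :: ('k::finite free_group \<Rightarrow> 'a::finite) measure)
    = sigma_sets UNIV {U. openin (product_topology (\<lambda>_. discrete_topology UNIV) UNIV) U}"
    (is "sets ?M = sigma_sets UNIV ?O")
proof (rule antisym)
  have sp: "space ?M = UNIV"
    by (simp add: config_space_def space_PiM)
  have "sets ?M = sigma_sets UNIV
      {{f. f i \<in> A} | i A. A \<in> sets (count_space (UNIV :: 'a set))}"
    unfolding config_space_def by (subst sets_PiM_single) auto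
  also have "\<dots> \<subseteq> sigma_sets UNIV ?O"
  proof (rule sigma_sets_mono', safe)
    fix i :: "'k free_group" and A :: "'a set"
    have "openin (product_topology (\<lambda>_. discrete_topology UNIV) UNIV)
        {x \<in> topspace (product_topology (\<lambda>_. discrete_topology UNIV) UNIV). x i \<in> A}"
      by (rule openin_continuous_map_preimage[OF continuous_map_product_projection]) auto
    then show "openin (product_topology (\<lambda>_. discrete_topology UNIV) UNIV)
        {f :: 'k free_group \<Rightarrow> 'a. f i \<in> A}"
      by simp
  qed
  finally show "sets ?M \<subseteq> sigma_sets UNIV ?O" .
  show "sigma_sets UNIV ?O \<subseteq> sets ?M"
  proof -
    define cyl :: "'k free_group list \<Rightarrow> 'a list \<Rightarrow> ('k free_group \<Rightarrow> 'a) set"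
      where "cyl = (\<lambda>F p. {x. map x F = p})"
    have cyl: "cyl F p \<in> sets ?M" for F p
    proof -
      have "cyl F p = (if length p = length F
          then {x \<in> space ?M. \<forall>j\<in>{..<length F}. x (F ! j) = p ! j} else {})"
        by (auto simp: cyl_def sp list_eq_iff_nth_eq)
      moreover have "{x \<in> space ?M. \<forall>j\<in>{..<length F}. x (F ! j) = p ! j} \<in> sets ?M"
      proof (intro sets.sets_Collect_finite_All)
        fix j
        have "(\<lambda>x. x (F ! j)) \<in> measurable ?M (count_space UNIV)"
          unfolding config_space_def by (rule measurable_component_singleton) simp
        from measurable_sets[OF this, of "{p ! j}"]
        show "{x \<in> space ?M. x (F ! j) = p ! j} \<in> sets ?M"
          by (simp add: vimage_def Int_def conj_commute)
      qed simp
      ultimately show ?thesis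
        by simp
    qed
    have "U \<in> sets ?M" if "U \<in> ?O" for U
    proof -
      have "\<exists>F. cyl F (map x F) \<subseteq> U" if "x \<in> U" for x
      proof -
        obtain W where W: "finite {i. W i \<noteq> (UNIV :: 'a set)}" "x \<in> Pi\<^sub>E UNIV W"
          "Pi\<^sub>E UNIV W \<subseteq> U"
          using \<open>U \<in> ?O\<close> \<open>x \<in> U\<close> by (auto simp: openin_product_topology_alt)
        obtain F where F: "set F = {i. W i \<noteq> UNIV}"
          using finite_list[OF W(1)] by blast
        have "y \<in> Pi\<^sub>E UNIV W" if "y \<in> cyl F (map x F)" for y
        proof -
          have "y i \<in> W i" for i
          proof (cases "i \<in> set F")
            case True
            then have "y i = x i"
              using that by (auto simp: cyl_def)
            then show ?thesis
              using W(2) by auto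
          qed (use F in auto)
          then show ?thesis
            by auto
        qed
        then show ?thesis
          using W(3) by blast
      qed
      then have "U = (\<Union>(F, p)\<in>{(F, p). cyl F p \<subseteq> U}. cyl F p)"
        by (fastforce simp: cyl_def)
      moreover have "(\<Union>(F, p)\<in>{(F, p). cyl F p \<subseteq> U}. cyl F p) \<in> sets ?M"
        by (intro sets.countable_UN') (auto simp: cyl)
      ultimately show ?thesis
        by simp
    qed
    then show ?thesis
      using sets.sigma_sets_subset[of ?O ?M] sp by auto
  qed
qed

definition shift_invariant_measures :: "('k free_group \<Rightarrow> 'a) measure set" where
  "shift_invariant_measures = {\<mu>. prob_space \<mu> \<and> sets \<mu> = sets config_space \<and>
     (\<forall>g. distr \<mu> config_space (shift g) = \<mu>)}"

definition self_joinings ::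
  "('k free_group \<Rightarrow> 'a) measure \<Rightarrow> ('k free_group \<Rightarrow> 'a \<times> 'a) measure set" where
  "self_joinings \<mu> = {\<nu> \<in> shift_invariant_measures.
     distr \<nu> config_space (\<lambda>z. fst \<circ> z) = \<mu> \<and> distr \<nu> config_space (\<lambda>z. snd \<circ> z) = \<mu>}"

definition config_dist ::
  "('k::finite free_group \<Rightarrow> 'a) \<Rightarrow> ('k free_group \<Rightarrow> 'a) \<Rightarrow> real" where
  "config_dist x y = (\<Sum>\<^sub>\<infinity>\<gamma>. (if x \<gamma> \<noteq> y \<gamma> then 1 else 0) *
     inverse (5 * real CARD('k) ^ 2) ^ word_length \<gamma>)"

definition transport_dist ::
  "('k::finite free_group \<Rightarrow> 'a) measure \<Rightarrow> ('k free_group \<Rightarrow> 'a) measure \<Rightarrow> real" where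
  "transport_dist \<mu> \<nu> = (SUP f\<in>{f. \<forall>x y. \<bar>f x - f y\<bar> \<le> config_dist x y}.
     \<bar>(LINT x|\<mu>. f x) - (LINT x|\<nu>. f x)\<bar>)"


section \<open>Actions on finite sets\<close>

abbreviation action_homs :: "'v set \<Rightarrow> ('k free_group \<Rightarrow> 'v \<Rightarrow> 'v) set" where
  "action_homs V \<equiv> hom free_group_monoid (BijGroup V)"

definition pullback_name ::
  "('k free_group \<Rightarrow> 'v \<Rightarrow> 'v) \<Rightarrow> ('v \<Rightarrow> 'a) \<Rightarrow> 'v \<Rightarrow> 'k free_group \<Rightarrow> 'a" where
  "pullback_name \<sigma> x v = (\<lambda>h. x (\<sigma> h v))"

text \<open>The image of the uniform measure on \<open>V\<close>, that is, the average of the Dirac measures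
  at the pullback names.\<close>

definition empirical_measure ::
  "'v set \<Rightarrow> ('k free_group \<Rightarrow> 'v \<Rightarrow> 'v) \<Rightarrow> ('v \<Rightarrow> 'a) \<Rightarrow> ('k free_group \<Rightarrow> 'a) measure" where
  "empirical_measure V \<sigma> x = distr (uniform_count_measure V) config_space (pullback_name \<sigma> x)"

definition good_models ::
  "'v set \<Rightarrow> ('k::finite free_group \<Rightarrow> 'v \<Rightarrow> 'v) \<Rightarrow> ('k free_group \<Rightarrow> 'a) measure \<Rightarrow> real
    \<Rightarrow> ('v \<Rightarrow> 'a) set" where
  "good_models V \<sigma> \<mu> \<epsilon> = {x \<in> V \<rightarrow>\<^sub>E UNIV. transport_dist (empirical_measure V \<sigma> x) \<mu> < \<epsilon>}"

definition sofic ::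
  "'v set \<Rightarrow> 'k free_group set \<Rightarrow> real \<Rightarrow> ('k free_group \<Rightarrow> 'v \<Rightarrow> 'v) \<Rightarrow> bool" where
  "sofic V F \<delta> \<sigma> \<longleftrightarrow>
     real (card {v \<in> V. \<forall>\<gamma>\<^sub>1\<in>F. \<forall>\<gamma>\<^sub>2\<in>F. \<gamma>\<^sub>1 \<noteq> \<gamma>\<^sub>2 \<longrightarrow> \<sigma> \<gamma>\<^sub>1 v \<noteq> \<sigma> \<gamma>\<^sub>2 v}) / real (card V) > 1 - \<delta>"

text \<open>Natural logarithm with \<open>log 0 = -\<infinity>\<close>; the real \<open>ln\<close> has \<open>ln 0 = 0\<close>.\<close>

definition elog :: "real \<Rightarrow> ereal" where
  "elog t = (if t \<le> 0 then -\<infinity> else ereal (ln t))"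

text \<open>\<open>S n\<close> is the law of the random homomorphism \<open>\<sigma>\<^sub>n\<close>.\<close>

definition random_sofic_approximation ::
  "(nat \<Rightarrow> 'v set) \<Rightarrow> (nat \<Rightarrow> ('k free_group \<Rightarrow> 'v \<Rightarrow> 'v) pmf) \<Rightarrow> bool" where
  "random_sofic_approximation V S \<longleftrightarrow>
     (\<forall>n. finite (V n) \<and> V n \<noteq> {} \<and> set_pmf (S n) \<subseteq> action_homs (V n)) \<and>
     (\<forall>F \<delta>. finite F \<and> \<delta> > 0 \<longrightarrow>
        limsup (\<lambda>n. ereal (1 / real (card (V n))) *
          elog (measure_pmf.prob (S n) {\<sigma>. \<not> sofic (V n) F \<delta> \<sigma>})) = -\<infinity>)"

definition switching ::
  "'v set \<Rightarrow> (('k free_group \<Rightarrow> 'v \<Rightarrow> 'v) \<times> ('k free_group \<Rightarrow> 'v \<Rightarrow> 'v)) set" where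
  "switching V = {(\<sigma>\<^sub>1, \<sigma>\<^sub>2). \<sigma>\<^sub>1 \<in> action_homs V \<and> \<sigma>\<^sub>2 \<in> action_homs V \<and>
     (\<exists>i\<in>V. \<exists>j\<in>V. \<exists>k. \<sigma>\<^sub>1 (fg_gen k) i = \<sigma>\<^sub>2 (fg_gen k) j \<and> \<sigma>\<^sub>1 (fg_gen k) j = \<sigma>\<^sub>2 (fg_gen k) i \<and>
        (\<forall>l. \<forall>v\<in>V. (l, v) \<notin> {(k, i), (k, j)} \<longrightarrow> \<sigma>\<^sub>1 (fg_gen l) v = \<sigma>\<^sub>2 (fg_gen l) v))}"

definition switching_dist ::
  "'v set \<Rightarrow> ('k free_group \<Rightarrow> 'v \<Rightarrow> 'v) \<Rightarrow> ('k free_group \<Rightarrow> 'v \<Rightarrow> 'v) \<Rightarrow> real" where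
  "switching_dist V \<sigma>\<^sub>1 \<sigma>\<^sub>2 = real (LEAST m. (\<sigma>\<^sub>1, \<sigma>\<^sub>2) \<in> switching V ^^ m) / real (card V)"

definition exponentially_concentrated ::
  "(nat \<Rightarrow> 'v set) \<Rightarrow> (nat \<Rightarrow> ('k free_group \<Rightarrow> 'v \<Rightarrow> 'v) pmf) \<Rightarrow> bool" where
  "exponentially_concentrated V S \<longleftrightarrow> (\<exists>C>0. \<forall>n f t.
     (\<forall>\<sigma>\<^sub>1\<in>action_homs (V n). \<forall>\<sigma>\<^sub>2\<in>action_homs (V n).
        \<bar>f \<sigma>\<^sub>1 - f \<sigma>\<^sub>2\<bar> \<le> switching_dist (V n) \<sigma>\<^sub>1 \<sigma>\<^sub>2) \<and> t > 0 \<longrightarrow>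
     measure_pmf.prob (S n) {\<sigma>. \<bar>f \<sigma> - measure_pmf.expectation (S n) f\<bar> > t}
       \<le> 2 * exp (- C * real (card (V n)) * t ^ 2))"


section \<open>Entropies\<close>

definition upper_annealed_entropy ::
  "(nat \<Rightarrow> 'v set) \<Rightarrow> (nat \<Rightarrow> ('k::finite free_group \<Rightarrow> 'v \<Rightarrow> 'v) pmf)
    \<Rightarrow> ('k free_group \<Rightarrow> 'a) measure \<Rightarrow> ereal" where
  "upper_annealed_entropy V S \<mu> = (INF \<epsilon>\<in>{0<..}. limsup (\<lambda>n. ereal (1 / real (card (V n))) *
     elog (measure_pmf.expectation (S n) (\<lambda>\<sigma>. real (card (good_models (V n) \<sigma> \<mu> \<epsilon>))))))"

definition lower_annealed_entropy ::
  "(nat \<Rightarrow> 'v set) \<Rightarrow> (nat \<Rightarrow> ('k::finite free_group \<Rightarrow> 'v \<Rightarrow> 'v) pmf)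
    \<Rightarrow> ('k free_group \<Rightarrow> 'a) measure \<Rightarrow> ereal" where
  "lower_annealed_entropy V S \<mu> = (INF \<epsilon>\<in>{0<..}. liminf (\<lambda>n. ereal (1 / real (card (V n))) *
     elog (measure_pmf.expectation (S n) (\<lambda>\<sigma>. real (card (good_models (V n) \<sigma> \<mu> \<epsilon>))))))"

definition model_radius ::
  "'v set \<Rightarrow> ('k::finite free_group \<Rightarrow> 'a) measure \<Rightarrow> ('k free_group \<Rightarrow> 'v \<Rightarrow> 'v) \<Rightarrow> real \<Rightarrow> real"
  where
  "model_radius V \<mu> \<sigma> h = Inf {\<epsilon>. \<epsilon> > 0 \<and>
     ereal (1 / real (card V)) * elog (real (card (good_models V \<sigma> \<mu> \<epsilon>))) \<ge> ereal h}"

definition upper_radius ::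
  "(nat \<Rightarrow> 'v set) \<Rightarrow> (nat \<Rightarrow> ('k::finite free_group \<Rightarrow> 'v \<Rightarrow> 'v) pmf)
    \<Rightarrow> ('k free_group \<Rightarrow> 'a) measure \<Rightarrow> real \<Rightarrow> ereal" where
  "upper_radius V S \<mu> h = limsup (\<lambda>n.
     ereal (measure_pmf.expectation (S n) (\<lambda>\<sigma>. model_radius (V n) \<mu> \<sigma> h)))"

definition lower_radius ::
  "(nat \<Rightarrow> 'v set) \<Rightarrow> (nat \<Rightarrow> ('k::finite free_group \<Rightarrow> 'v \<Rightarrow> 'v) pmf)
    \<Rightarrow> ('k free_group \<Rightarrow> 'a) measure \<Rightarrow> real \<Rightarrow> ereal" where
  "lower_radius V S \<mu> h = liminf (\<lambda>n.
     ereal (measure_pmf.expectation (S n) (\<lambda>\<sigma>. model_radius (V n) \<mu> \<sigma> h)))"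

text \<open>Suprema in \<open>ereal\<close>, so the supremum of the empty set is \<open>-\<infinity>\<close>.\<close>

definition h_flat ::
  "(nat \<Rightarrow> 'v set) \<Rightarrow> (nat \<Rightarrow> ('k::finite free_group \<Rightarrow> 'v \<Rightarrow> 'v) pmf)
    \<Rightarrow> ('k free_group \<Rightarrow> 'a::finite) measure \<Rightarrow> ereal" where
  "h_flat V S \<mu> = (SUP h\<in>{h \<in> {0..ln (real CARD('a))}. upper_radius V S \<mu> h = 0}. ereal h)"

definition h_sharp ::
  "(nat \<Rightarrow> 'v set) \<Rightarrow> (nat \<Rightarrow> ('k::finite free_group \<Rightarrow> 'v \<Rightarrow> 'v) pmf)
    \<Rightarrow> ('k free_group \<Rightarrow> 'a::finite) measure \<Rightarrow> ereal" where
  "h_sharp V S \<mu> = (SUP h\<in>{h \<in> {0..ln (real CARD('a))}. lower_radius V S \<mu> h = 0}. ereal h)"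

definition second_moment_condition ::
  "(nat \<Rightarrow> 'v set) \<Rightarrow> (nat \<Rightarrow> ('k::finite free_group \<Rightarrow> 'v \<Rightarrow> 'v) pmf)
    \<Rightarrow> ('k free_group \<Rightarrow> 'a) measure \<Rightarrow> bool" where
  "second_moment_condition V S \<mu> \<longleftrightarrow>
     (\<forall>\<nu>\<in>self_joinings \<mu>. upper_annealed_entropy V S \<nu> \<le> 2 * lower_annealed_entropy V S \<mu>)"

end

theory Submission
  imports Defs
begin

text \<open>
Write \<open>N\<close> for the number of points of \<open>V n\<close>, and \<open>L\<close> and \<open>U\<close> for the lower and upper annealed
entropies of \<open>\<mu>\<close>.

The inequalities \<open>h\<^sup>\<flat> \<le> L\<close> and \<open>h\<^sup>\<sharp> \<le> U\<close> are first-moment bounds (\<open>h_flat_le_lower\<close>,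
\<open>h_sharp_le_upper\<close>): if the mean model radius at \<open>h\<close> is small, then by Markov's inequality there are
at least \<open>e\<^bsup>h N\<^esup>\<close> good models with probability at least one half, so the mean number of good
models is at least \<open>e\<^bsup>h N\<^esup> / 2\<close>. Also \<open>h\<^sup>\<flat> \<le> h\<^sup>\<sharp>\<close>, so it remains to show \<open>U \<le> L \<le> h\<^sup>\<flat>\<close>.

A pair of good models for \<open>\<mu>\<close> is a model over the product alphabet whose empirical measure is
invariant and has both marginals close to \<open>\<mu>\<close>. By weak compactness it is close to one of finitely
many self-joinings of \<open>\<mu>\<close> (\<open>near_joinings_covered\<close>). The second-moment condition therefore bounds
the mean square of the number of good models by \<open>e\<^bsup>(2 L + \<eta>) N\<^esup>\<close> (\<open>second_moment_bound\<close>). Because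
the square of a mean is at most a constant times the mean square, \<open>U \<le> L\<close>. By the Paley-Zygmund
inequality (\<open>second_moment_method\<close>) the number of good models is also at least half of its mean with
probability at least \<open>e\<^bsup>-3 \<eta> N\<^esup>\<close>, up to a constant.

This probability is tiny, but concentration amplifies it. The model radius is Lipschitz in the
homomorphism, since one switching alters few of the short paths (\<open>card_switching_changed\<close>,
\<open>model_radius_lipschitz\<close>). An event of probability \<open>e\<^bsup>-3 \<eta> N\<^esup>\<close> with \<open>\<eta>\<close> arbitrarily small must
therefore contain homomorphisms whose radius is close to the mean radius, so the mean radius tends
to \<open>0\<close> for every \<open>h < L\<close> (\<open>upper_radius_eq_0\<close>). Finally, the diagonal self-joining shows that
\<open>L \<le> 2 L\<close>, so that \<open>L\<close> is \<open>-\<infinity>\<close> or nonnegative; if \<open>L = 0\<close>, the same argument applies to \<open>h = 0\<close>,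
where a single good model suffices.
\<close>

section \<open>Homomorphisms from the free group into a permutation group\<close>

lift_definition fg_letter :: "'k \<times> bool \<Rightarrow> 'k free_group" is "\<lambda>a. [a]"
  by simp

lemma fg_letter_True [simp]: "fg_letter (k, True) = fg_gen k"
  by transfer simp

lemma fg_letter_inverse: "fg_mult (fg_letter a) (fg_letter (inv_letter a)) = fg_one"
  by transfer simp

lemma word_length_letter_mult:
  assumes "reduced_word (a # Rep_free_group g)"
  shows "word_length (fg_mult (fg_letter a) g) = Suc (word_length g)"
  using assms by (simp add: word_length.rep_eq fg_mult.rep_eq fg_letter.rep_eq cons_reduce_reduced)

lemma word_length_one [simp]: "word_length fg_one = 0"
  by transfer simp

text \<open>Reduced words are built letter by letter on the left. The reducedness premise makes
  \<open>word_length_letter_mult\<close> applicable in the induction step.\<close>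

lemma fg_induct [case_names one mult]:
  assumes "P fg_one"
    and "\<And>a g. reduced_word (a # Rep_free_group g) \<Longrightarrow> P g \<Longrightarrow> P (fg_mult (fg_letter a) g)"
  shows "P g"
proof -
  have "P (Abs_free_group w)" if "reduced_word w" for w
    using that
  proof (induction w)
    case Nil
    then show ?case
      using assms(1) by (simp add: fg_one_def)
  next
    case (Cons a w)
    have w: "reduced_word w"
      using Cons.prems by (rule reduced_ConsD)
    have "Abs_free_group (a # w) = fg_mult (fg_letter a) (Abs_free_group w)"
      using w Cons.prems
      by (simp add: fg_mult_def fg_letter.rep_eq Abs_free_group_inverse cons_reduce_reduced)
    then show ?case
      using assms(2)[of a "Abs_free_group w"] Cons w by (simp add: Abs_free_group_inverse)
  qed
  then show ?thesis
    by (metis Rep_free_group Rep_free_group_inverse mem_Collect_eq)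
qed

lemma infinite_free_group: "infinite (UNIV :: 'k free_group set)"
proof -
  obtain k :: 'k where True by blast
  have red: "reduced_word (replicate n (k, True))" for n
    by (induction n) (auto simp: reduced_word_def inv_letter_def successively_Cons)
  have "inj (\<lambda>n. Abs_free_group (replicate n (k, True)))"
  proof (rule injI)
    fix m n
    assume "Abs_free_group (replicate m (k, True)) = Abs_free_group (replicate n (k, True))"
    then have "replicate m (k, True) = replicate n (k, True)"
      using red by (simp add: Abs_free_group_inject)
    then show "m = n"
      by (metis length_replicate)
  qed
  then show ?thesis
    using range_inj_infinite finite_subset[OF subset_UNIV] by metis
qed

lemma action_hom_Bij: "\<sigma> \<in> action_homs V \<Longrightarrow> \<sigma> g \<in> Bij V"
  by (auto simp: hom_def free_group_monoid_def BijGroup_def)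

lemma action_hom_in: "\<sigma> \<in> action_homs V \<Longrightarrow> v \<in> V \<Longrightarrow> \<sigma> g v \<in> V"
  using action_hom_Bij[of \<sigma> V g] by (auto simp: Bij_def bij_betw_def)

lemma action_hom_bij_betw: "\<sigma> \<in> action_homs V \<Longrightarrow> bij_betw (\<sigma> g) V V"
  using action_hom_Bij[of \<sigma> V g] by (auto simp: Bij_def)

lemma action_hom_mult:
  assumes "\<sigma> \<in> action_homs V"
  shows "\<sigma> (fg_mult g h) = compose V (\<sigma> g) (\<sigma> h)"
  using assms action_hom_Bij[OF assms, of g] action_hom_Bij[OF assms, of h]
  by (auto simp: hom_def free_group_monoid_def BijGroup_def)

lemma action_hom_mult_apply:
  "\<sigma> \<in> action_homs V \<Longrightarrow> v \<in> V \<Longrightarrow> \<sigma> (fg_mult g h) v = \<sigma> g (\<sigma> h v)"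
  by (simp add: action_hom_mult compose_def)

lemma action_hom_one:
  assumes "\<sigma> \<in> action_homs V"
  shows "\<sigma> fg_one = (\<lambda>v\<in>V. v)"
  using hom_one[OF assms group_free_group_monoid group_BijGroup]
  by (simp add: free_group_monoid_def BijGroup_def)

lemma action_hom_letter_inverse:
  assumes "\<sigma> \<in> action_homs V" "v \<in> V"
  shows "\<sigma> (fg_letter a) (\<sigma> (fg_letter (inv_letter a)) v) = v"
  using action_hom_mult_apply[OF assms, of "fg_letter a" "fg_letter (inv_letter a)"]
    action_hom_one[OF assms(1)] assms(2)
  by (simp add: fg_letter_inverse)

lemma action_hom_letter_inverse_left:
  assumes "\<sigma> \<in> action_homs V" "v \<in> V"
  shows "\<sigma> (fg_letter (inv_letter a)) (\<sigma> (fg_letter a) v) = v"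
  using action_hom_letter_inverse[OF assms, of "inv_letter a"] by simp

lemma action_hom_inj:
  "\<sigma> \<in> action_homs V \<Longrightarrow> u \<in> V \<Longrightarrow> v \<in> V \<Longrightarrow> \<sigma> g u = \<sigma> g v \<Longrightarrow> u = v"
  by (meson action_hom_bij_betw bij_betw_def inj_onD)

lemma action_hom_letter_eqI:
  assumes "\<sigma> \<in> action_homs V" "u \<in> V" "\<sigma> (fg_letter (inv_letter a)) u = v"
  shows "\<sigma> (fg_letter a) v = u"
  using action_hom_letter_inverse[OF assms(1,2), of a] assms(3) by simp

lemma action_hom_eqI:
  assumes \<sigma>: "\<sigma>\<^sub>1 \<in> action_homs V" "\<sigma>\<^sub>2 \<in> action_homs V"
    and eq: "\<And>k v. v \<in> V \<Longrightarrow> \<sigma>\<^sub>1 (fg_gen k) v = \<sigma>\<^sub>2 (fg_gen k) v"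
  shows "\<sigma>\<^sub>1 = \<sigma>\<^sub>2"
proof
  fix g
  have letter: "\<sigma>\<^sub>1 (fg_letter a) v = \<sigma>\<^sub>2 (fg_letter a) v" if v: "v \<in> V" for a v
  proof (cases a)
    case (Pair k b)
    show ?thesis
    proof (cases b)
      case True
      then show ?thesis
        using eq[OF v] Pair by simp
    next
      case False
      let ?u = "\<sigma>\<^sub>2 (fg_letter a) v"
      have u: "?u \<in> V"
        using \<sigma>(2) v by (rule action_hom_in)
      have inv: "inv_letter a = (k, True)"
        using Pair False by (simp add: inv_letter_def)
      have "\<sigma>\<^sub>2 (fg_gen k) ?u = v"
        using action_hom_letter_inverse_left[OF \<sigma>(2) v, of a] inv by simp
      then have "\<sigma>\<^sub>1 (fg_gen k) ?u = v"
        using eq[OF u] by simp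
      then show ?thesis
        using action_hom_letter_eqI[OF \<sigma>(1) u, of a] inv by simp
    qed
  qed
  show "\<sigma>\<^sub>1 g = \<sigma>\<^sub>2 g"
  proof (induction g rule: fg_induct)
    case one
    then show ?case
      using \<sigma> by (simp add: action_hom_one)
  next
    case (mult a g)
    show ?case
      unfolding action_hom_mult[OF \<sigma>(1)] action_hom_mult[OF \<sigma>(2)] mult
      unfolding compose_def by (rule restrict_ext) (simp add: letter action_hom_in[OF \<sigma>(2)])
  qed
qed

text \<open>The universal property of the free group, for permutation groups: letters act by the
  given permutations and their inverses, and a word acts by composition.\<close>

lemma action_hom_extend:
  assumes \<pi>: "\<And>k. \<pi> k \<in> Bij V"
  obtains \<sigma> where "\<sigma> \<in> action_homs V" "\<And>k. \<sigma> (fg_gen k) = \<pi> k"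
proof -
  define act where "act = (\<lambda>a. if snd a then \<pi> (fst a) else (\<lambda>v\<in>V. inv_into V (\<pi> (fst a)) v))"
  define ev where "ev = (\<lambda>w. foldr (\<lambda>a. compose V (act a)) w (\<lambda>v\<in>V. v))"
  have act: "act a \<in> Bij V" for a
    using \<pi> by (simp add: act_def restrict_inv_into_Bij)
  have ev: "ev w \<in> Bij V" for w
    by (induction w) (auto simp: ev_def act compose_Bij simp del: restrict_apply intro: id_Bij)
  have inv: "compose V (act a) (compose V (act (inv_letter a)) f) = f" if f: "f \<in> Bij V" for a f
  proof -
    have V: "act b v \<in> V" if "v \<in> V" for b v
      using act[of b] that by (auto simp: Bij_def bij_betw_def)
    have "act a (act (inv_letter a) v) = v" if "v \<in> V" for v
    proof (cases "snd a")
      case True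
      then show ?thesis
        using that \<pi>[of "fst a"] V[OF that, of "inv_letter a"]
        by (auto simp: act_def inv_letter_def Bij_def intro: bij_betw_inv_into_right)
    next
      case False
      then show ?thesis
        using that \<pi>[of "fst a"] V[OF that, of "inv_letter a"]
        by (auto simp: act_def inv_letter_def Bij_def intro: bij_betw_inv_into_left)
    qed
    moreover have "f v \<in> V" if "v \<in> V" for v
      using f that by (auto simp: Bij_def bij_betw_def)
    ultimately show ?thesis
      using Bij_imp_extensional[OF f] by (auto simp: compose_def fun_eq_iff extensional_def)
  qed
  have cons: "ev (cons_reduce a w) = compose V (act a) (ev w)" for a w
  proof (cases w)
    case (Cons b u)
    show ?thesis
    proof (cases "b = inv_letter a")
      case True
      then show ?thesis
        using Cons inv[OF ev[of u], of a] by (simp add: ev_def)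
    qed (use Cons in \<open>simp add: ev_def\<close>)
  qed (simp add: ev_def)
  have mult: "ev (foldr cons_reduce u w) = compose V (ev u) (ev w)" for u w
  proof (induction u)
    case Nil
    then show ?case
      using Id_compose[OF Bij_imp_funcset[OF ev[of w]] Bij_imp_extensional[OF ev[of w]]]
      by (simp add: ev_def del: restrict_apply)
  next
    case (Cons a u)
    have "compose V (act a) (compose V (ev u) (ev w)) = compose V (compose V (act a) (ev u)) (ev w)"
      by (rule compose_assoc[OF Bij_imp_funcset[OF ev[of w]]])
    then show ?case
      by (simp add: cons Cons.IH) (simp add: ev_def)
  qed
  let ?\<sigma> = "\<lambda>g. ev (Rep_free_group g)"
  have "?\<sigma> \<in> action_homs V"
    using ev mult by (auto simp: hom_def free_group_monoid_def BijGroup_def fg_mult.rep_eq)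
  moreover have "?\<sigma> (fg_gen k) = \<pi> k" for k
    using Bij_imp_extensional[OF \<pi>[of k]]
    by (simp add: fg_gen.rep_eq ev_def act_def compose_Id[OF Bij_imp_funcset[OF \<pi>]])
  ultimately show ?thesis
    using that by blast
qed

text \<open>The least number in the definition of \<^const>\<open>switching_dist\<close> is attained: a switching can
  always make one more value of one generator agree with the target without spoiling any other.\<close>

lemma switching_connected:
  fixes V :: "'v set" and \<sigma>\<^sub>1 \<sigma>\<^sub>2 :: "'k::finite free_group \<Rightarrow> 'v \<Rightarrow> 'v"
  assumes "finite V" "\<sigma>\<^sub>1 \<in> action_homs V" "\<sigma>\<^sub>2 \<in> action_homs V"
  shows "\<exists>m. (\<sigma>\<^sub>1, \<sigma>\<^sub>2) \<in> switching V ^^ m"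
  using assms(2)
proof (induction "card {(k, v). v \<in> V \<and> \<sigma>\<^sub>1 (fg_gen k) v \<noteq> \<sigma>\<^sub>2 (fg_gen k) v}" arbitrary: \<sigma>\<^sub>1
    rule: less_induct)
  case less
  let ?D = "\<lambda>\<sigma>. {(k, v). v \<in> V \<and> \<sigma> (fg_gen k) v \<noteq> \<sigma>\<^sub>2 (fg_gen k) v}"
  have fin: "finite (?D \<sigma>)" for \<sigma>
    by (rule finite_subset[of _ "UNIV \<times> V"]) (auto simp: assms(1))
  show ?case
  proof (cases "?D \<sigma>\<^sub>1 = {}")
    case True
    then have "\<sigma>\<^sub>1 = \<sigma>\<^sub>2"
      by (intro action_hom_eqI[OF less.prems assms(3)]) auto
    then show ?thesis
      by (intro exI[of _ 0]) simp
  next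
    case False
    then obtain k i where i: "i \<in> V" "\<sigma>\<^sub>1 (fg_gen k) i \<noteq> \<sigma>\<^sub>2 (fg_gen k) i"
      by auto
    have "\<sigma>\<^sub>2 (fg_gen k) i \<in> V"
      using assms(3) i(1) by (rule action_hom_in)
    then obtain j where j: "j \<in> V" "\<sigma>\<^sub>1 (fg_gen k) j = \<sigma>\<^sub>2 (fg_gen k) i"
      using action_hom_bij_betw[OF less.prems, of "fg_gen k"] by (metis bij_betw_iff_bijections)
    have ij: "i \<noteq> j"
      using i j by auto
    let ?\<tau> = "(\<lambda>v\<in>V. Transposition.transpose i j v)"
    define \<pi> where "\<pi> = (\<lambda>l. if l = k then compose V (\<sigma>\<^sub>1 (fg_gen k)) ?\<tau> else \<sigma>\<^sub>1 (fg_gen l))"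
    have "bij_betw (Transposition.transpose i j) V V"
      by (rule bij_betw_byWitness[where f' = "Transposition.transpose i j"])
        (use i j in \<open>auto simp: Transposition.transpose_def\<close>)
    then have "?\<tau> \<in> Bij V"
      by (auto simp: Bij_def)
    then have "\<pi> l \<in> Bij V" for l
      using action_hom_Bij[OF less.prems] by (simp add: \<pi>_def compose_Bij)
    then obtain \<sigma>' where \<sigma>': "\<sigma>' \<in> action_homs V" "\<And>k. \<sigma>' (fg_gen k) = \<pi> k"
      using action_hom_extend by blast
    have sw: "(\<sigma>\<^sub>1, \<sigma>') \<in> switching V"
    proof -
      have "\<sigma>\<^sub>1 (fg_gen k) i = \<sigma>' (fg_gen k) j" "\<sigma>\<^sub>1 (fg_gen k) j = \<sigma>' (fg_gen k) i"
        using i j by (simp_all add: \<sigma>'(2) \<pi>_def compose_def)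
      moreover have "\<sigma>\<^sub>1 (fg_gen l) v = \<sigma>' (fg_gen l) v" if "v \<in> V" "(l, v) \<notin> {(k, i), (k, j)}" for l v
        using that by (auto simp: \<sigma>'(2) \<pi>_def compose_def)
      ultimately show ?thesis
        unfolding switching_def using less.prems \<sigma>'(1) i(1) j(1)
        by (intro CollectI case_prodI conjI bexI[of _ i] bexI[of _ j] exI[of _ k]) auto
    qed
    have "?D \<sigma>' \<subset> ?D \<sigma>\<^sub>1"
    proof
      show "?D \<sigma>' \<subseteq> ?D \<sigma>\<^sub>1"
      proof clarify
        fix l v assume v: "v \<in> V" and d: "\<sigma>' (fg_gen l) v \<noteq> \<sigma>\<^sub>2 (fg_gen l) v"
          and eq: "\<sigma>\<^sub>1 (fg_gen l) v = \<sigma>\<^sub>2 (fg_gen l) v"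
        from d eq have l: "l = k"
          by (auto simp: \<sigma>'(2) \<pi>_def split: if_splits)
        have vi: "v \<noteq> i"
          using eq i l by auto
        show False
        proof (cases "v = j")
          case True
          then have "\<sigma>\<^sub>2 (fg_gen k) j = \<sigma>\<^sub>2 (fg_gen k) i"
            using eq j l by simp
          then show False
            using action_hom_inj[OF assms(3) j(1) i(1)] ij by metis
        next
          case False
          then have "\<sigma>' (fg_gen l) v = \<sigma>\<^sub>1 (fg_gen l) v"
            using vi v l by (simp add: \<sigma>'(2) \<pi>_def compose_def)
          then show False
            using d eq by simp
        qed
      qed
      have "(k, i) \<in> ?D \<sigma>\<^sub>1"
        using i by simp
      moreover have "(k, i) \<notin> ?D \<sigma>'"
        using i j by (simp add: \<sigma>'(2) \<pi>_def compose_def)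
      ultimately show "?D \<sigma>' \<noteq> ?D \<sigma>\<^sub>1"
        by blast
    qed
    then have "card (?D \<sigma>') < card (?D \<sigma>\<^sub>1)"
      using fin by (rule psubset_card_mono[rotated])
    then obtain m where "(\<sigma>', \<sigma>\<^sub>2) \<in> switching V ^^ m"
      using less.hyps \<sigma>'(1) by blast
    then have "(\<sigma>\<^sub>1, \<sigma>\<^sub>2) \<in> switching V ^^ Suc m"
      using sw by (rule relpow_Suc_I2[rotated])
    then show ?thesis
      by blast
  qed
qed

lemma switching_dist_attained:
  fixes \<sigma>\<^sub>1 \<sigma>\<^sub>2 :: "'k::finite free_group \<Rightarrow> 'v \<Rightarrow> 'v"
  assumes "finite V" "\<sigma>\<^sub>1 \<in> action_homs V" "\<sigma>\<^sub>2 \<in> action_homs V"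
  obtains m where "(\<sigma>\<^sub>1, \<sigma>\<^sub>2) \<in> switching V ^^ m"
    "switching_dist V \<sigma>\<^sub>1 \<sigma>\<^sub>2 = real m / real (card V)"
  using LeastI_ex[OF switching_connected[OF assms]] by (simp add: switching_dist_def)

lemma card_switching_letter:
  fixes V :: "'v set"
  assumes "(\<sigma>\<^sub>1, \<sigma>\<^sub>2) \<in> switching V" "finite V"
  shows "card {v \<in> V. \<sigma>\<^sub>1 (fg_letter a) v \<noteq> \<sigma>\<^sub>2 (fg_letter a) v} \<le> 2"
proof -
  from assms(1) obtain i j k where ij: "i \<in> V" "j \<in> V"
    and \<sigma>: "\<sigma>\<^sub>1 \<in> action_homs V" "\<sigma>\<^sub>2 \<in> action_homs V"
    and sw: "\<sigma>\<^sub>1 (fg_gen k) i = \<sigma>\<^sub>2 (fg_gen k) j" "\<sigma>\<^sub>1 (fg_gen k) j = \<sigma>\<^sub>2 (fg_gen k) i"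
    and eq: "\<And>l v. v \<in> V \<Longrightarrow> (l, v) \<notin> {(k, i), (k, j)} \<Longrightarrow> \<sigma>\<^sub>1 (fg_gen l) v = \<sigma>\<^sub>2 (fg_gen l) v"
    unfolding switching_def by auto
  have card2: "card {x, y :: 'v} \<le> 2" for x y
    by (simp add: card_insert_if)
  obtain l b where a: "a = (l, b)"
    by (cases a)
  show ?thesis
  proof (cases b)
    case True
    then have "{v \<in> V. \<sigma>\<^sub>1 (fg_letter a) v \<noteq> \<sigma>\<^sub>2 (fg_letter a) v} \<subseteq> {i, j}"
      using a eq by auto
    then show ?thesis
      using card_mono[of "{i, j}"] card2[of i j] by (meson finite.emptyI finite.insertI le_trans)
  next
    case False
    have inv: "inv_letter a = (l, True)"
      using a False by (simp add: inv_letter_def)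
    have "{v \<in> V. \<sigma>\<^sub>1 (fg_letter a) v \<noteq> \<sigma>\<^sub>2 (fg_letter a) v}
        \<subseteq> {\<sigma>\<^sub>2 (fg_gen k) i, \<sigma>\<^sub>2 (fg_gen k) j}"
    proof (rule subsetI, rule ccontr)
      fix v
      assume "v \<in> {v \<in> V. \<sigma>\<^sub>1 (fg_letter a) v \<noteq> \<sigma>\<^sub>2 (fg_letter a) v}"
        and "v \<notin> {\<sigma>\<^sub>2 (fg_gen k) i, \<sigma>\<^sub>2 (fg_gen k) j}"
      then have v: "v \<in> V" and d: "\<sigma>\<^sub>1 (fg_letter a) v \<noteq> \<sigma>\<^sub>2 (fg_letter a) v"
        and nj: "v \<noteq> \<sigma>\<^sub>2 (fg_gen k) j" and ni: "v \<noteq> \<sigma>\<^sub>2 (fg_gen k) i"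
        by auto
      let ?u = "\<sigma>\<^sub>2 (fg_letter a) v"
      have u: "?u \<in> V"
        using \<sigma>(2) v by (rule action_hom_in)
      have uv: "\<sigma>\<^sub>2 (fg_gen l) ?u = v"
        using action_hom_letter_inverse_left[OF \<sigma>(2) v, of a] inv by simp
      have "(l, ?u) \<notin> {(k, i), (k, j)}"
        using uv ni nj by auto
      then have "\<sigma>\<^sub>1 (fg_gen l) ?u = v"
        using eq[OF u, of l] uv by simp
      then have "\<sigma>\<^sub>1 (fg_letter a) v = ?u"
        using action_hom_letter_eqI[OF \<sigma>(1) u, of a] inv by simp
      then show False
        using d by simp
    qed
    then show ?thesis
      using card_mono[of "{\<sigma>\<^sub>2 (fg_gen k) i, \<sigma>\<^sub>2 (fg_gen k) j}"] card2
      by (meson finite.emptyI finite.insertI le_trans)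
  qed
qed

text \<open>A path of length \<open>n\<close> is affected by a switching only if one of its \<open>n\<close> steps uses one of the
  two switched edges.\<close>

lemma card_switching_changed:
  assumes "(\<sigma>\<^sub>1, \<sigma>\<^sub>2) \<in> switching V" "finite V"
  shows "card {v \<in> V. \<sigma>\<^sub>1 g v \<noteq> \<sigma>\<^sub>2 g v} \<le> 2 * word_length g"
proof (induction g rule: fg_induct)
  case one
  have "\<sigma>\<^sub>1 \<in> action_homs V" "\<sigma>\<^sub>2 \<in> action_homs V"
    using assms(1) by (auto simp: switching_def)
  then show ?case
    by (simp add: action_hom_one)
next
  case (mult a g)
  have \<sigma>: "\<sigma>\<^sub>1 \<in> action_homs V" "\<sigma>\<^sub>2 \<in> action_homs V"
    using assms(1) by (auto simp: switching_def)
  let ?A = "{v \<in> V. \<sigma>\<^sub>1 g v \<noteq> \<sigma>\<^sub>2 g v}"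
  let ?L = "{v \<in> V. \<sigma>\<^sub>1 (fg_letter a) v \<noteq> \<sigma>\<^sub>2 (fg_letter a) v}"
  let ?B = "{v \<in> V. \<sigma>\<^sub>1 g v \<in> ?L}"
  have "card ?B \<le> card ?L"
  proof (rule card_inj_on_le[where f = "\<sigma>\<^sub>1 g"])
    show "inj_on (\<sigma>\<^sub>1 g) ?B"
      using action_hom_inj[OF \<sigma>(1)] by (auto simp: inj_on_def)
  qed (use assms(2) in auto)
  also have "\<dots> \<le> 2"
    using assms by (rule card_switching_letter)
  finally have B: "card ?B \<le> 2" .
  have "{v \<in> V. \<sigma>\<^sub>1 (fg_mult (fg_letter a) g) v \<noteq> \<sigma>\<^sub>2 (fg_mult (fg_letter a) g) v} \<subseteq> ?A \<union> ?B"
    using \<sigma> by (auto simp: action_hom_mult_apply action_hom_in)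
  then have "card {v \<in> V. \<sigma>\<^sub>1 (fg_mult (fg_letter a) g) v \<noteq> \<sigma>\<^sub>2 (fg_mult (fg_letter a) g) v}
      \<le> card (?A \<union> ?B)"
    using assms(2) by (intro card_mono) auto
  also have "\<dots> \<le> card ?A + card ?B"
    by (rule card_Un_le)
  also have "\<dots> \<le> 2 * word_length (fg_mult (fg_letter a) g)"
    using mult B by (simp add: word_length_letter_mult)
  finally show ?case .
qed

text \<open>A set \<open>F\<close> of \<open>M + 1\<close> group elements cannot move a point to distinct places in a set of at
  most \<open>M\<close> points. On so small a set no homomorphism is \<open>(F, 1)\<close>-sofic: soficity fails with
  probability \<open>1\<close>, whose logarithm is \<open>0\<close> instead of very negative.\<close>

lemma random_sofic_approximation_card:
  fixes S :: "nat \<Rightarrow> ('k free_group \<Rightarrow> 'v \<Rightarrow> 'v) pmf"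
  assumes "random_sofic_approximation V S"
  shows "filterlim (\<lambda>n. real (card (V n))) at_top sequentially"
proof -
  have fin: "finite (V n)" and ne: "V n \<noteq> {}" and S: "set_pmf (S n) \<subseteq> action_homs (V n)" for n
    using assms by (auto simp: random_sofic_approximation_def)
  have "eventually (\<lambda>n. card (V n) > M) sequentially" for M
  proof -
    obtain F :: "'k free_group set" where F: "finite F" "card F = Suc M"
      using infinite_arbitrarily_large[OF infinite_free_group] by blast
    let ?t = "\<lambda>n. ereal (1 / real (card (V n))) *
          elog (measure_pmf.prob (S n) {\<sigma>. \<not> sofic (V n) F 1 \<sigma>})"
    have "limsup ?t = -\<infinity>"
      using assms F(1) by (auto simp: random_sofic_approximation_def)
    then have "limsup ?t < 0"
      by simp
    then have "eventually (\<lambda>n. ?t n < 0) sequentially"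
      by (simp add: Limsup_lessD)
    then show ?thesis
    proof eventually_elim
      case (elim n)
      show ?case
      proof (rule ccontr)
        assume le: "\<not> M < card (V n)"
        have "\<not> sofic (V n) F 1 \<sigma>" if "\<sigma> \<in> action_homs (V n)" for \<sigma>
        proof -
          have "\<not> (\<forall>\<gamma>\<^sub>1\<in>F. \<forall>\<gamma>\<^sub>2\<in>F. \<gamma>\<^sub>1 \<noteq> \<gamma>\<^sub>2 \<longrightarrow> \<sigma> \<gamma>\<^sub>1 v \<noteq> \<sigma> \<gamma>\<^sub>2 v)" if "v \<in> V n" for v
          proof
            assume "\<forall>\<gamma>\<^sub>1\<in>F. \<forall>\<gamma>\<^sub>2\<in>F. \<gamma>\<^sub>1 \<noteq> \<gamma>\<^sub>2 \<longrightarrow> \<sigma> \<gamma>\<^sub>1 v \<noteq> \<sigma> \<gamma>\<^sub>2 v"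
            then have "inj_on (\<lambda>\<gamma>. \<sigma> \<gamma> v) F"
              by (auto simp: inj_on_def)
            then have "card F \<le> card (V n)"
              using fin action_hom_in[OF \<open>\<sigma> \<in> action_homs (V n)\<close> \<open>v \<in> V n\<close>]
              by (intro card_inj_on_le) auto
            then show False
              using F(2) le by simp
          qed
          then have "{v \<in> V n. \<forall>\<gamma>\<^sub>1\<in>F. \<forall>\<gamma>\<^sub>2\<in>F. \<gamma>\<^sub>1 \<noteq> \<gamma>\<^sub>2 \<longrightarrow> \<sigma> \<gamma>\<^sub>1 v \<noteq> \<sigma> \<gamma>\<^sub>2 v} = {}"
            unfolding Collect_empty_eq by meson
          then show ?thesis
            unfolding sofic_def by (metis card.empty diff_self div_0 less_irrefl of_nat_0)
        qed
        then have "measure_pmf.prob (S n) {\<sigma>. \<not> sofic (V n) F 1 \<sigma>} = 1"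
          using S by (intro measure_pmf.prob_eq_1[THEN iffD2]) (auto simp: AE_measure_pmf_iff)
        then show False
          using elim by (simp add: elog_def)
      qed
    qed
  qed
  then have "filterlim (\<lambda>n. card (V n)) at_top sequentially"
    by (auto simp: filterlim_at_top intro: eventually_mono less_imp_le)
  then show ?thesis
    by (rule filterlim_compose[OF filterlim_real_sequentially])
qed

section \<open>The weighted metric on configurations\<close>

definition site_weight :: "'k::finite free_group \<Rightarrow> real" where
  "site_weight \<gamma> = inverse (5 * real CARD('k) ^ 2) ^ word_length \<gamma>"

lemma site_weight_pos [simp]: "site_weight \<gamma> > 0"
  by (simp add: site_weight_def)

text \<open>There are at most \<open>(2 r)\<^sup>n\<close> reduced words of length \<open>n\<close>, and \<open>2 r \<cdot> 2 / (5 r\<^sup>2) \<le> 4/5\<close>; the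
  factor \<open>2\<^sup>n\<close> to spare absorbs the word length in \<open>summable_length_weight\<close>.\<close>

lemma summable_doubled_weight:
  "(\<lambda>\<gamma> :: 'k::finite free_group. 2 ^ word_length \<gamma> * site_weight \<gamma>) summable_on UNIV"
proof (rule nonneg_bdd_above_summable_on)
  let ?r = "real CARD('k)"
  let ?c = "2 * inverse (5 * ?r ^ 2)"
  have r: "?r \<ge> 1"
    by (simp add: Suc_leI)
  have eq: "2 ^ word_length \<gamma> * site_weight \<gamma> = ?c ^ length (Rep_free_group \<gamma>)" for \<gamma> :: "'k free_group"
    by (simp only: site_weight_def power_mult_distrib word_length.rep_eq)
  show "bdd_above (sum (\<lambda>\<gamma> :: 'k free_group. 2 ^ word_length \<gamma> * site_weight \<gamma>) ` {F. F \<subseteq> UNIV \<and> finite F})"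
  proof (rule bdd_aboveI, clarify)
    fix F :: "'k free_group set" assume F: "finite F"
    define N where "N = Max (insert 0 (word_length ` F))"
    let ?L = "\<lambda>n. {w :: ('k \<times> bool) list. length w = n}"
    have fin: "finite (?L n)" and card: "card (?L n) = (2 * CARD('k)) ^ n" for n
      using finite_lists_length_eq[of "UNIV :: ('k \<times> bool) set" n]
        card_lists_length_eq[of "UNIV :: ('k \<times> bool) set" n]
      by (simp_all add: card_UNIV_bool mult.commute)
    have "(\<Sum>\<gamma>\<in>F. 2 ^ word_length \<gamma> * site_weight \<gamma>) = (\<Sum>w\<in>Rep_free_group ` F. ?c ^ length w)"
      by (subst sum.reindex) (auto simp: eq inj_on_def Rep_free_group_inject)
    also have "\<dots> \<le> (\<Sum>w\<in>(\<Union>n\<in>{..N}. ?L n). ?c ^ length w)"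
    proof (rule sum_mono2)
      show "finite (\<Union>n\<in>{..N}. ?L n)"
        using fin by blast
      show "Rep_free_group ` F \<subseteq> (\<Union>n\<in>{..N}. ?L n)"
        using F by (auto simp: N_def word_length.rep_eq intro!: Max_ge)
    qed simp
    also have "\<dots> = (\<Sum>n\<le>N. \<Sum>w\<in>?L n. ?c ^ length w)"
      by (rule sum.UNION_disjoint) (use fin in auto)
    also have "\<dots> = (\<Sum>n\<le>N. (4 / (5 * ?r)) ^ n)"
    proof (rule sum.cong)
      fix n
      have "(\<Sum>w\<in>?L n. ?c ^ length w) = real (card (?L n)) * ?c ^ n"
        by simp
      also have "\<dots> = (2 * ?r * ?c) ^ n"
        by (simp only: card power_mult_distrib of_nat_power of_nat_mult of_nat_numeral)
      also have "2 * ?r * ?c = 4 / (5 * ?r)"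
        using r by (simp add: field_simps power2_eq_square)
      finally show "(\<Sum>w\<in>?L n. ?c ^ length w) = (4 / (5 * ?r)) ^ n" .
    qed simp
    also have "\<dots> \<le> (\<Sum>n\<le>N. (4 / 5) ^ n)"
      using r by (intro sum_mono power_mono) (auto simp: field_simps)
    also have "\<dots> \<le> (\<Sum>n. (4 / 5) ^ n)"
      by (rule sum_le_suminf) auto
    also have "\<dots> = 5"
      by (subst suminf_geometric) auto
    finally show "(\<Sum>\<gamma>\<in>F. 2 ^ word_length \<gamma> * site_weight \<gamma>) \<le> 5" .
  qed
qed (simp add: less_imp_le)

lemma summable_site_weight: "site_weight summable_on A"
proof (rule summable_on_subset_banach[OF summable_on_comparison_test[OF summable_doubled_weight] subset_UNIV])
  fix \<gamma> :: "'a free_group"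
  have "1 * site_weight \<gamma> \<le> 2 ^ word_length \<gamma> * site_weight \<gamma>"
    by (rule mult_right_mono) (auto simp: less_imp_le)
  then show "site_weight \<gamma> \<le> 2 ^ word_length \<gamma> * site_weight \<gamma>"
    by simp
qed (simp add: less_imp_le)

lemma summable_length_weight:
  "(\<lambda>\<gamma>. real (word_length \<gamma>) * site_weight \<gamma>) summable_on UNIV"
proof (rule summable_on_comparison_test[OF summable_doubled_weight])
  fix \<gamma> :: "'a free_group"
  have "real (word_length \<gamma>) \<le> 2 ^ word_length \<gamma>"
    by (metis less_exp less_imp_le of_nat_le_iff of_nat_numeral of_nat_power)
  then show "real (word_length \<gamma>) * site_weight \<gamma> \<le> 2 ^ word_length \<gamma> * site_weight \<gamma>"
    by (rule mult_right_mono) (simp add: less_imp_le)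
qed (simp add: less_imp_le)

definition total_weight :: "'k::finite itself \<Rightarrow> real" where
  "total_weight _ = (\<Sum>\<^sub>\<infinity>\<gamma> :: 'k free_group. site_weight \<gamma>)"

lemma total_weight_nonneg: "total_weight TYPE('k::finite) \<ge> 0"
  unfolding total_weight_def by (rule infsum_nonneg) (simp add: less_imp_le)

lemma exists_small_tail:
  assumes "e > 0"
  obtains F :: "'k::finite free_group set" where "finite F" "infsum site_weight (- F) < e"
proof -
  let ?U = "UNIV :: 'k free_group set"
  have "(sum site_weight \<longlongrightarrow> infsum site_weight ?U) (finite_subsets_at_top ?U)"
    using infsum_tendsto[OF summable_site_weight] .
  then have "eventually (\<lambda>F. dist (sum site_weight F) (infsum site_weight ?U) < e)
      (finite_subsets_at_top ?U)"
    using assms by (simp add: tendsto_iff)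
  then obtain F :: "'k free_group set"
    where F: "finite F" "dist (sum site_weight F) (infsum site_weight ?U) < e"
    by (auto simp: eventually_finite_subsets_at_top)
  have "infsum site_weight (?U - F) = infsum site_weight ?U - infsum site_weight F"
    by (rule infsum_Diff) (auto simp: summable_site_weight)
  then have "infsum site_weight (- F) < e"
    using F by (simp add: dist_real_def Compl_eq_Diff_UNIV)
  then show ?thesis
    using F(1) that by blast
qed

lemma config_dist_alt:
  "config_dist x y = infsum site_weight {\<gamma>. x \<gamma> \<noteq> y \<gamma>}"
  unfolding config_dist_def
  by (rule infsum_cong_neutral) (auto simp: site_weight_def)

lemma config_dist_mono:
  "(\<And>\<gamma>. x \<gamma> \<noteq> y \<gamma> \<Longrightarrow> x' \<gamma> \<noteq> y' \<gamma>) \<Longrightarrow> config_dist x y \<le> config_dist x' y'"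
  unfolding config_dist_alt
  by (rule infsum_mono2) (auto simp: summable_site_weight less_imp_le)

lemma config_dist_nonneg: "config_dist x y \<ge> 0"
  unfolding config_dist_alt by (rule infsum_nonneg) (simp add: less_imp_le)

lemma config_dist_le_tail:
  "(\<And>\<gamma>. \<gamma> \<in> F \<Longrightarrow> x \<gamma> = y \<gamma>) \<Longrightarrow> config_dist x y \<le> infsum site_weight (- F)"
  unfolding config_dist_alt
  by (rule infsum_mono2) (auto simp: summable_site_weight less_imp_le)

lemma config_dist_le_total:
  "config_dist (x :: 'k::finite free_group \<Rightarrow> 'a) y \<le> total_weight TYPE('k)"
  using config_dist_le_tail[of "{}" x y] by (simp add: total_weight_def)

lemma config_dist_ge:
  assumes "x \<gamma> \<noteq> y \<gamma>"
  shows "site_weight \<gamma> \<le> config_dist x y"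
proof -
  have "infsum site_weight {\<gamma>} \<le> infsum site_weight {\<gamma>. x \<gamma> \<noteq> y \<gamma>}"
    using assms by (intro infsum_mono2) (auto simp: summable_site_weight less_imp_le)
  then show ?thesis
    by (simp add: config_dist_alt)
qed

section \<open>Events that depend on finitely many coordinates\<close>

definition finitely_determined :: "('i \<Rightarrow> 'a) set \<Rightarrow> bool" where
  "finitely_determined E \<longleftrightarrow>
     (\<exists>F. finite F \<and> (\<forall>x y. (\<forall>g\<in>F. x g = y g) \<longrightarrow> x \<in> E \<longrightarrow> y \<in> E))"

lemma finitely_determinedI:
  assumes "finite F" "\<And>x y. (\<And>g. g \<in> F \<Longrightarrow> x g = y g) \<Longrightarrow> x \<in> E \<Longrightarrow> y \<in> E"
  shows "finitely_determined E"
  unfolding finitely_determined_def using assms by blast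

lemma finitely_determined_UNIV [simp]: "finitely_determined UNIV"
  by (rule finitely_determinedI[of "{}"]) auto

lemma finitely_determined_empty [simp]: "finitely_determined {}"
  by (rule finitely_determinedI[of "{}"]) auto

lemma finitely_determined_Compl:
  assumes "finitely_determined E"
  shows "finitely_determined (- E)"
proof -
  obtain F where F: "finite F" "\<And>x y. (\<And>g. g \<in> F \<Longrightarrow> x g = y g) \<Longrightarrow> x \<in> E \<longleftrightarrow> y \<in> E"
    using assms unfolding finitely_determined_def by metis
  show ?thesis
    by (rule finitely_determinedI[OF F(1)]) (meson ComplD ComplI F(2))
qed

lemma finitely_determined_Un:
  assumes "finitely_determined E" "finitely_determined E'"
  shows "finitely_determined (E \<union> E')"
proof -
  obtain F where F: "finite F" "\<And>x y. (\<And>g. g \<in> F \<Longrightarrow> x g = y g) \<Longrightarrow> x \<in> E \<longleftrightarrow> y \<in> E"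
    using assms(1) unfolding finitely_determined_def by metis
  obtain G where G: "finite G" "\<And>x y. (\<And>g. g \<in> G \<Longrightarrow> x g = y g) \<Longrightarrow> x \<in> E' \<longleftrightarrow> y \<in> E'"
    using assms(2) unfolding finitely_determined_def by metis
  show ?thesis
  proof (rule finitely_determinedI[of "F \<union> G"])
    show "y \<in> E \<union> E'" if "\<And>g. g \<in> F \<union> G \<Longrightarrow> x g = y g" "x \<in> E \<union> E'" for x y
      using that F(2)[of x y] G(2)[of x y] by auto
  qed (use F G in auto)
qed

lemma finitely_determined_Int:
  assumes "finitely_determined E" "finitely_determined E'"
  shows "finitely_determined (E \<inter> E')"
  using finitely_determined_Compl[OF finitely_determined_Un[OF assms[THEN finitely_determined_Compl]]]
  by simp

lemma finitely_determined_Diff: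
  "finitely_determined E \<Longrightarrow> finitely_determined E' \<Longrightarrow> finitely_determined (E - E')"
  by (simp add: Diff_eq finitely_determined_Int finitely_determined_Compl)

text \<open>A sliding block code: every output coordinate reads finitely many input coordinates.\<close>

lemma finitely_determined_vimage:
  assumes E: "finitely_determined E"
    and \<Phi>: "\<And>g. finite (G g)" "\<And>g x y. (\<And>h. h \<in> G g \<Longrightarrow> x h = y h) \<Longrightarrow> \<Phi> x g = \<Phi> y g"
  shows "finitely_determined (\<Phi> -` E)"
proof -
  obtain F where F: "finite F" "\<And>x y. (\<And>g. g \<in> F \<Longrightarrow> x g = y g) \<Longrightarrow> x \<in> E \<longleftrightarrow> y \<in> E"
    using E unfolding finitely_determined_def by metis
  show ?thesis
  proof (rule finitely_determinedI[of "\<Union>g\<in>F. G g"])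
    show "y \<in> \<Phi> -` E" if "\<And>h. h \<in> (\<Union>g\<in>F. G g) \<Longrightarrow> x h = y h" "x \<in> \<Phi> -` E" for x y
    proof -
      have "\<Phi> x g = \<Phi> y g" if "g \<in> F" for g
        using \<Phi>(2)[of g x y] that \<open>\<And>h. h \<in> (\<Union>g\<in>F. G g) \<Longrightarrow> x h = y h\<close> by blast
      then show ?thesis
        using F(2)[of "\<Phi> x" "\<Phi> y"] that(2) by simp
    qed
  qed (use F \<Phi> in auto)
qed

lemma finitely_determined_shift: "finitely_determined E \<Longrightarrow> finitely_determined (shift g -` E)"
  by (rule finitely_determined_vimage[where G = "\<lambda>h. {fg_mult h g}"]) (auto simp: shift_def)

lemma finitely_determined_comp: "finitely_determined E \<Longrightarrow> finitely_determined ((\<lambda>z. f \<circ> z) -` E)"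
  by (rule finitely_determined_vimage[where G = "\<lambda>h. {h}"]) auto

text \<open>The pattern \<open>a\<close> is an extensional function on \<open>F\<close>, hence itself a configuration; this lets a
  function of configurations be evaluated at a pattern.\<close>

definition cylinder :: "'i set \<Rightarrow> ('i \<Rightarrow> 'a) \<Rightarrow> ('i \<Rightarrow> 'a) set" where
  "cylinder F a = {x. restrict x F = a}"

lemma finitely_determined_cylinder: "finite F \<Longrightarrow> finitely_determined (cylinder F a)"
  by (rule finitely_determinedI[of F]) (auto simp: cylinder_def restrict_def fun_eq_iff, metis+)

lemma space_config_space [simp]: "space config_space = UNIV"
  by (simp add: config_space_def space_PiM)

lemma sets_cylinder:
  assumes "finite F"
  shows "cylinder F a \<in> sets (config_space :: ('k free_group \<Rightarrow> 'a) measure)"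
proof (cases "a \<in> extensional F")
  case True
  have "cylinder F a = {x \<in> space config_space. \<forall>g\<in>F. x g = a g}"
    using True by (auto simp: cylinder_def restrict_def fun_eq_iff extensional_def)
  also have "\<dots> \<in> sets config_space"
  proof (intro sets.sets_Collect_finite_All)
    fix g
    have "(\<lambda>x. x g) \<in> measurable (config_space :: ('k free_group \<Rightarrow> 'a) measure) (count_space UNIV)"
      unfolding config_space_def by (rule measurable_component_singleton) simp
    from measurable_sets[OF this, of "{a g}"]
    show "{x \<in> space config_space. x g = a g} \<in> sets (config_space :: ('k free_group \<Rightarrow> 'a) measure)"
      by (simp add: vimage_def Int_def conj_commute)
  qed (use assms in auto)
  finally show ?thesis .
next
  case False
  then have "cylinder F a = {}"
    by (auto simp: cylinder_def)
  then show ?thesis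
    by simp
qed

lemma finite_patterns: "finite F \<Longrightarrow> finite (F \<rightarrow>\<^sub>E (UNIV :: 'a::finite set))"
  by (rule finite_PiE) auto

lemma sets_finitely_determined:
  fixes E :: "('k free_group \<Rightarrow> 'a::finite) set"
  assumes "finitely_determined E"
  shows "E \<in> sets config_space"
proof -
  obtain F where F: "finite F" "\<And>x y. (\<And>g. g \<in> F \<Longrightarrow> x g = y g) \<Longrightarrow> x \<in> E \<longleftrightarrow> y \<in> E"
    using assms unfolding finitely_determined_def by metis
  have "E = (\<Union>a\<in>{a \<in> F \<rightarrow>\<^sub>E UNIV. a \<in> E}. cylinder F a)"
  proof (rule Set.set_eqI)
    fix x
    have "x \<in> E \<longleftrightarrow> restrict x F \<in> E"
      by (rule F(2)) simp
    then show "x \<in> E \<longleftrightarrow> x \<in> (\<Union>a\<in>{a \<in> F \<rightarrow>\<^sub>E UNIV. a \<in> E}. cylinder F a)"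
      by (auto simp: cylinder_def)
  qed
  also have "\<dots> \<in> sets config_space"
    using finite_patterns[OF F(1)] sets_cylinder[OF F(1)] by (intro sets.finite_UN) auto
  finally show ?thesis .
qed

lemma sets_config_space:
  "sets (config_space :: ('k free_group \<Rightarrow> 'a::finite) measure)
    = sigma_sets UNIV {E. finitely_determined E}"
proof (rule antisym)
  have "sets (config_space :: ('k free_group \<Rightarrow> 'a) measure) = sigma_sets UNIV
      {{f. f i \<in> A} | i A. A \<in> sets (count_space (UNIV :: 'a set))}"
    unfolding config_space_def by (subst sets_PiM_single) auto
  also have "\<dots> \<subseteq> sigma_sets UNIV {E. finitely_determined E}"
  proof (rule sigma_sets_mono', safe)
    fix i :: "'k free_group" and A :: "'a set"
    show "finitely_determined {f. f i \<in> A}"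
      by (rule finitely_determinedI[of "{i}"]) auto
  qed
  finally show "sets (config_space :: ('k free_group \<Rightarrow> 'a) measure) \<subseteq> sigma_sets UNIV {E. finitely_determined E}" .
  show "sigma_sets UNIV {E. finitely_determined E} \<subseteq> sets (config_space :: ('k free_group \<Rightarrow> 'a) measure)"
    using sets.sigma_sets_subset[of "{E. finitely_determined E}" "config_space :: ('k free_group \<Rightarrow> 'a) measure"]
      sets_finitely_determined by auto
qed

lemma measurable_one_site_code:
  assumes "\<And>g. \<exists>h. \<forall>x. \<Phi> x g = f (x h)"
  shows "\<Phi> \<in> measurable (config_space :: ('k free_group \<Rightarrow> 'a) measure) config_space"
proof -
  have "(\<lambda>x. \<Phi> x g) \<in> measurable (config_space :: ('k free_group \<Rightarrow> 'a) measure) (count_space UNIV)" for g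
  proof -
    obtain h where "\<forall>x. \<Phi> x g = f (x h)"
      using assms by blast
    moreover have "(\<lambda>x. f (x h)) \<in> measurable (config_space :: ('k free_group \<Rightarrow> 'a) measure) (count_space UNIV)"
      unfolding config_space_def
      by (rule measurable_compose[OF measurable_component_singleton]) auto
    ultimately show ?thesis
      by (simp cong: measurable_cong)
  qed
  then have "\<Phi> \<in> measurable (config_space :: ('k free_group \<Rightarrow> 'a) measure)
      (Pi\<^sub>M UNIV (\<lambda>_. count_space UNIV))"
    by (intro measurable_PiM_single') auto
  then show ?thesis
    by (simp add: config_space_def)
qed

lemma measurable_shift: "shift g \<in> measurable config_space config_space"
  by (rule measurable_one_site_code[where f = "\<lambda>a. a"]) (auto simp: shift_def)

lemma measurable_comp_config: "(\<lambda>z. f \<circ> z) \<in> measurable config_space config_space"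
  by (rule measurable_one_site_code[where f = f]) auto

definition config_probs :: "('k free_group \<Rightarrow> 'a) measure set" where
  "config_probs = {\<nu>. prob_space \<nu> \<and> sets \<nu> = sets config_space}"

lemma config_probs_space: "\<nu> \<in> config_probs \<Longrightarrow> space \<nu> = UNIV"
  by (auto simp: config_probs_def dest: sets_eq_imp_space_eq)

lemma config_probs_sets: "\<nu> \<in> config_probs \<Longrightarrow> sets \<nu> = sets config_space"
  by (auto simp: config_probs_def)

lemma config_probs_prob: "\<nu> \<in> config_probs \<Longrightarrow> prob_space \<nu>"
  by (auto simp: config_probs_def)

lemma shift_invariant_config_probs: "\<nu> \<in> shift_invariant_measures \<Longrightarrow> \<nu> \<in> config_probs"
  by (auto simp: config_probs_def shift_invariant_measures_def)

lemma distr_config_probs: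
  assumes "\<nu> \<in> config_probs" "\<Phi> \<in> measurable config_space config_space"
  shows "distr \<nu> config_space \<Phi> \<in> config_probs"
    and "E \<in> sets config_space \<Longrightarrow> measure (distr \<nu> config_space \<Phi>) E = measure \<nu> (\<Phi> -` E)"
proof -
  have \<Phi>: "\<Phi> \<in> measurable \<nu> config_space"
    using assms by (simp add: config_probs_sets cong: measurable_cong_sets)
  then show "distr \<nu> config_space \<Phi> \<in> config_probs"
    using prob_space.prob_space_distr[OF config_probs_prob[OF assms(1)] \<Phi>]
    by (simp add: config_probs_def)
  show "measure (distr \<nu> config_space \<Phi>) E = measure \<nu> (\<Phi> -` E)" if "E \<in> sets config_space"
    using measure_distr[OF \<Phi> that] by (simp add: config_probs_space[OF assms(1)])
qed

lemma config_probs_eqI: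
  fixes \<nu>\<^sub>1 \<nu>\<^sub>2 :: "('k free_group \<Rightarrow> 'a::finite) measure"
  assumes \<nu>: "\<nu>\<^sub>1 \<in> config_probs" "\<nu>\<^sub>2 \<in> config_probs"
    and eq: "\<And>E. finitely_determined E \<Longrightarrow> measure \<nu>\<^sub>1 E = measure \<nu>\<^sub>2 E"
  shows "\<nu>\<^sub>1 = \<nu>\<^sub>2"
proof -
  interpret p1: prob_space \<nu>\<^sub>1
    using \<nu>(1) by (rule config_probs_prob)
  interpret p2: prob_space \<nu>\<^sub>2
    using \<nu>(2) by (rule config_probs_prob)
  show ?thesis
  proof (rule measure_eqI_generator_eq[where E = "{E. finitely_determined E}" and \<Omega> = UNIV and A = "\<lambda>_. UNIV"])
    show "Int_stable {E :: ('k free_group \<Rightarrow> 'a) set. finitely_determined E}"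
      by (auto simp: Int_stable_def finitely_determined_Int)
    show "sets \<nu>\<^sub>1 = sigma_sets UNIV {E. finitely_determined E}"
      "sets \<nu>\<^sub>2 = sigma_sets UNIV {E. finitely_determined E}"
      using \<nu> by (simp_all add: config_probs_sets sets_config_space)
  qed (auto simp: eq p1.emeasure_eq_measure p2.emeasure_eq_measure)
qed

section \<open>The transportation metric\<close>

definition lipschitz_functions :: "(('k::finite free_group \<Rightarrow> 'a) \<Rightarrow> real) set" where
  "lipschitz_functions = {f. \<forall>x y. \<bar>f x - f y\<bar> \<le> config_dist x y}"

lemma lipschitzD: "f \<in> lipschitz_functions \<Longrightarrow> \<bar>f x - f y\<bar> \<le> config_dist x y"
  by (simp add: lipschitz_functions_def)

lemma lipschitz_zero: "(\<lambda>_. 0) \<in> lipschitz_functions"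
  by (simp add: lipschitz_functions_def config_dist_nonneg)

lemma lipschitz_restrict:
  assumes "f \<in> lipschitz_functions"
  shows "\<bar>f x - f (restrict x F)\<bar> \<le> infsum site_weight (- F)"
  using lipschitzD[OF assms, of x "restrict x F"] config_dist_le_tail[of F x "restrict x F"] by simp

lemma cylinder_expansion:
  fixes f :: "('i \<Rightarrow> 'a::finite) \<Rightarrow> real"
  assumes "finite F"
  shows "f (restrict x F) = (\<Sum>a\<in>F \<rightarrow>\<^sub>E UNIV. f a * indicator (cylinder F a) x)"
proof -
  have "(\<Sum>a\<in>F \<rightarrow>\<^sub>E UNIV. f a * indicator (cylinder F a) x)
      = (\<Sum>a\<in>F \<rightarrow>\<^sub>E UNIV. if a = restrict x F then f a else 0)"
    by (rule sum.cong) (auto simp: cylinder_def)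
  also have "\<dots> = f (restrict x F)"
    using finite_patterns[OF assms] by (subst sum.delta) auto
  finally show ?thesis
    by simp
qed

text \<open>A Lipschitz function is a uniform limit of functions of finitely many coordinates.\<close>

lemma lipschitz_measurable:
  fixes f :: "('k::finite free_group \<Rightarrow> 'a::finite) \<Rightarrow> real"
  assumes "f \<in> lipschitz_functions"
  shows "f \<in> borel_measurable config_space"
proof -
  have "\<exists>F :: 'k free_group set. finite F \<and> infsum site_weight (- F) < inverse (real (Suc n))" for n
    using exists_small_tail[of "inverse (real (Suc n))"]
    by (metis inverse_positive_iff_positive of_nat_0_less_iff zero_less_Suc)
  then obtain F :: "nat \<Rightarrow> 'k free_group set"
    where F: "\<And>n. finite (F n)" "\<And>n. infsum site_weight (- F n) < inverse (real (Suc n))"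
    by metis
  show ?thesis
  proof (rule borel_measurable_LIMSEQ_real)
    show "(\<lambda>n. f (restrict x (F n))) \<longlonglongrightarrow> f x" for x
    proof (rule LIMSEQ_I)
      fix e :: real assume "e > 0"
      then obtain N where N: "inverse (real (Suc N)) < e"
        using reals_Archimedean by blast
      have "norm (f (restrict x (F n)) - f x) < e" if "n \<ge> N" for n
      proof -
        have "inverse (real (Suc n)) \<le> inverse (real (Suc N))"
          using that by (simp add: field_simps)
        then show ?thesis
          using lipschitz_restrict[OF assms, of x "F n"] F(2)[of n] N
          unfolding real_norm_def by linarith
      qed
      then show "\<exists>N. \<forall>n\<ge>N. norm (f (restrict x (F n)) - f x) < e"
        by blast
    qed
    show "(\<lambda>x. f (restrict x (F n))) \<in> borel_measurable config_space" for n
      unfolding cylinder_expansion[OF F(1)]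
      by (intro borel_measurable_sum borel_measurable_times borel_measurable_const
          borel_measurable_indicator sets_cylinder F(1))
  qed
qed

lemma lipschitz_integrable:
  fixes f :: "('k::finite free_group \<Rightarrow> 'a::finite) \<Rightarrow> real"
  assumes "f \<in> lipschitz_functions" "\<nu> \<in> config_probs"
  shows "integrable \<nu> f"
proof -
  interpret prob_space \<nu>
    using assms(2) by (rule config_probs_prob)
  have "\<bar>f x\<bar> \<le> \<bar>f undefined\<bar> + total_weight TYPE('k)" for x
    using lipschitzD[OF assms(1), of x undefined] config_dist_le_total[of x undefined] by linarith
  then show ?thesis
    using lipschitz_measurable[OF assms(1)] config_probs_sets[OF assms(2)]
    by (intro integrable_const_bound[where B = "\<bar>f undefined\<bar> + total_weight TYPE('k)"])
      (auto cong: measurable_cong_sets)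
qed

lemma transport_dist_alt:
  "transport_dist \<mu> \<nu> = (SUP f\<in>lipschitz_functions. \<bar>(LINT x|\<mu>. f x) - (LINT x|\<nu>. f x)\<bar>)"
  by (simp add: transport_dist_def lipschitz_functions_def)

lemma transport_dist_leI:
  assumes "\<And>f. f \<in> lipschitz_functions \<Longrightarrow> \<bar>(LINT x|\<mu>. f x) - (LINT x|\<nu>. f x)\<bar> \<le> B"
  shows "transport_dist \<mu> \<nu> \<le> B"
  unfolding transport_dist_alt using assms lipschitz_zero by (intro cSUP_least) auto

lemma lipschitz_integral_bound:
  fixes f :: "('k::finite free_group \<Rightarrow> 'a::finite) \<Rightarrow> real"
  assumes "f \<in> lipschitz_functions" "\<mu> \<in> config_probs"
  shows "\<bar>(LINT x|\<mu>. f x) - f y\<bar> \<le> total_weight TYPE('k)"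
proof -
  interpret prob_space \<mu>
    using assms(2) by (rule config_probs_prob)
  have "(LINT x|\<mu>. f x) - f y = (LINT x|\<mu>. f x - f y)"
    using lipschitz_integrable[OF assms] by (simp add: prob_space)
  also have "\<bar>\<dots>\<bar> \<le> (LINT x|\<mu>. \<bar>f x - f y\<bar>)"
    by (rule integral_abs_bound)
  also have "\<dots> \<le> (LINT x|\<mu>. total_weight TYPE('k))"
    using lipschitz_integrable[OF assms] lipschitzD[OF assms(1)] config_dist_le_total order_trans
    by (intro integral_mono integrable_abs Bochner_Integration.integrable_diff) (auto, blast)
  finally show ?thesis
    by (simp add: prob_space)
qed

lemma lipschitz_integral_diff_bound:
  fixes f :: "('k::finite free_group \<Rightarrow> 'a::finite) \<Rightarrow> real"
  assumes "f \<in> lipschitz_functions" "\<mu> \<in> config_probs" "\<nu> \<in> config_probs"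
  shows "\<bar>(LINT x|\<mu>. f x) - (LINT x|\<nu>. f x)\<bar> \<le> 2 * total_weight TYPE('k)"
  using lipschitz_integral_bound[OF assms(1,2), of undefined]
    lipschitz_integral_bound[OF assms(1,3), of undefined] by linarith

lemma transport_dist_ge:
  fixes \<mu> \<nu> :: "('k::finite free_group \<Rightarrow> 'a::finite) measure"
  assumes "\<mu> \<in> config_probs" "\<nu> \<in> config_probs" "f \<in> lipschitz_functions"
  shows "\<bar>(LINT x|\<mu>. f x) - (LINT x|\<nu>. f x)\<bar> \<le> transport_dist \<mu> \<nu>"
  unfolding transport_dist_alt
  by (rule cSUP_upper[OF assms(3)])
    (use lipschitz_integral_diff_bound assms in \<open>auto intro!: bdd_aboveI2\<close>)

lemma transport_dist_le_total:
  fixes \<mu> \<nu> :: "('k::finite free_group \<Rightarrow> 'a::finite) measure"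
  assumes "\<mu> \<in> config_probs" "\<nu> \<in> config_probs"
  shows "transport_dist \<mu> \<nu> \<le> 2 * total_weight TYPE('k)"
  using assms by (intro transport_dist_leI lipschitz_integral_diff_bound)

lemma transport_dist_commute: "transport_dist \<mu> \<nu> = transport_dist \<nu> \<mu>"
  by (simp add: transport_dist_alt abs_minus_commute)

lemma transport_dist_triangle:
  fixes \<mu> \<nu> \<kappa> :: "('k::finite free_group \<Rightarrow> 'a::finite) measure"
  assumes "\<mu> \<in> config_probs" "\<nu> \<in> config_probs" "\<kappa> \<in> config_probs"
  shows "transport_dist \<mu> \<kappa> \<le> transport_dist \<mu> \<nu> + transport_dist \<nu> \<kappa>"
proof (rule transport_dist_leI)
  fix f :: "('k free_group \<Rightarrow> 'a) \<Rightarrow> real" assume f: "f \<in> lipschitz_functions"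
  show "\<bar>(LINT x|\<mu>. f x) - (LINT x|\<kappa>. f x)\<bar> \<le> transport_dist \<mu> \<nu> + transport_dist \<nu> \<kappa>"
    using transport_dist_ge[OF assms(1,2) f] transport_dist_ge[OF assms(2,3) f] by linarith
qed

text \<open>A finitely determined event separates configurations by a definite distance, so a multiple of
  its indicator function is Lipschitz.\<close>

lemma finitely_determined_transport:
  fixes E :: "('k::finite free_group \<Rightarrow> 'a::finite) set"
  assumes "finitely_determined E"
  obtains m where "m > 0" "\<And>\<mu> \<nu>. \<mu> \<in> config_probs \<Longrightarrow> \<nu> \<in> config_probs \<Longrightarrow>
    m * \<bar>measure \<mu> E - measure \<nu> E\<bar> \<le> transport_dist \<mu> \<nu>"
proof -
  obtain F where F: "finite F" "\<And>x y. (\<And>g. g \<in> F \<Longrightarrow> x g = y g) \<Longrightarrow> x \<in> E \<longleftrightarrow> y \<in> E"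
    using assms unfolding finitely_determined_def by metis
  define m where "m = Min (insert 1 (site_weight ` F))"
  have m: "m > 0"
    using F(1) by (auto simp: m_def)
  have mF: "m \<le> site_weight g" if "g \<in> F" for g
    unfolding m_def using F(1) that by (intro Min_le) auto
  have lip: "(\<lambda>x. m * indicator E x) \<in> lipschitz_functions"
    unfolding lipschitz_functions_def
  proof (intro CollectI allI)
    fix x y :: "'k free_group \<Rightarrow> 'a"
    show "\<bar>m * indicator E x - m * indicator E y\<bar> \<le> config_dist x y"
    proof (cases "x \<in> E \<longleftrightarrow> y \<in> E")
      case True
      then show ?thesis
        by (auto simp: indicator_def config_dist_nonneg)
    next
      case False
      then obtain g where g: "g \<in> F" "x g \<noteq> y g"
        using F(2) by blast
      have "\<bar>m * indicator E x - m * indicator E y\<bar> \<le> m"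
        using m by (auto simp: indicator_def)
      also have "\<dots> \<le> config_dist x y"
        using mF[OF g(1)] config_dist_ge[of x g y, OF g(2)] by linarith
      finally show ?thesis .
    qed
  qed
  have "m * \<bar>measure \<mu> E - measure \<nu> E\<bar> \<le> transport_dist \<mu> \<nu>"
    if p: "\<mu> \<in> config_probs" "\<nu> \<in> config_probs" for \<mu> \<nu>
  proof -
    have int: "(LINT x|\<kappa>. m * indicator E x) = m * measure \<kappa> E" if "\<kappa> \<in> config_probs" for \<kappa>
      by (simp add: config_probs_space[OF that])
    have "\<bar>m * measure \<mu> E - m * measure \<nu> E\<bar> \<le> transport_dist \<mu> \<nu>"
      using transport_dist_ge[OF p lip] p by (simp only: int)
    moreover have "\<bar>m * measure \<mu> E - m * measure \<nu> E\<bar> = m * \<bar>measure \<mu> E - measure \<nu> E\<bar>"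
      using m by (simp only: right_diff_distrib[symmetric] abs_mult abs_of_pos)
    ultimately show ?thesis
      by simp
  qed
  then show ?thesis
    using that m by blast
qed

text \<open>Conversely, the finitely many cylinders over a window that carries most of the weight control
  the integrals of all Lipschitz functions at once.\<close>

lemma transport_dist_less_if_cylinders_close:
  fixes e :: real
  assumes "e > 0"
  shows "\<exists>(\<E> :: ('k::finite free_group \<Rightarrow> 'a::finite) set set) \<delta>.
    finite \<E> \<and> (\<forall>E\<in>\<E>. finitely_determined E) \<and> \<delta> > 0 \<and>
    (\<forall>\<mu>\<in>config_probs. \<forall>\<nu>\<in>config_probs.
      (\<forall>E\<in>\<E>. \<bar>measure \<mu> E - measure \<nu> E\<bar> < \<delta>) \<longrightarrow> transport_dist \<mu> \<nu> < e)"
proof -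
  obtain F :: "'k free_group set" where F: "finite F" "infsum site_weight (- F) < e / 8"
    using exists_small_tail[of "e / 8"] assms by auto
  let ?P = "F \<rightarrow>\<^sub>E (UNIV :: 'a set)" and ?D = "total_weight TYPE('k)"
  define \<delta> where "\<delta> = e / (4 * (real (card ?P) + 1) * (?D + 1))"
  have D: "?D \<ge> 0"
    by (rule total_weight_nonneg)
  have \<delta>: "\<delta> > 0"
    using assms D by (simp add: \<delta>_def)
  have "transport_dist \<mu> \<nu> < e"
    if p: "\<mu> \<in> config_probs" "\<nu> \<in> config_probs"
      and close: "\<And>E. E \<in> cylinder F ` ?P \<Longrightarrow> \<bar>measure \<mu> E - measure \<nu> E\<bar> < \<delta>" for \<mu> \<nu>
  proof -
    have "\<bar>(LINT x|\<mu>. f x) - (LINT x|\<nu>. f x)\<bar> \<le> e / 2" if f: "f \<in> lipschitz_functions" for f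
    proof -
      \<comment> \<open>Only oscillations of \<open>f\<close> are bounded, so \<open>f\<close> is normalised by its value at an arbitrary
        configuration.\<close>
      define c where "c = f undefined"
      have approx: "\<bar>(LINT x|\<kappa>. f x) - (c + (\<Sum>a\<in>?P. (f a - c) * measure \<kappa> (cylinder F a)))\<bar> \<le> e / 8"
        if \<kappa>: "\<kappa> \<in> config_probs" for \<kappa>
      proof -
        interpret prob_space \<kappa>
          using \<kappa> by (rule config_probs_prob)
        have cyl: "cylinder F a \<in> sets \<kappa>" for a
          using sets_cylinder[OF F(1)] config_probs_sets[OF \<kappa>] by auto
        have eq: "f (restrict x F) = c + (\<Sum>a\<in>?P. (f a - c) * indicator (cylinder F a) x)" for x
          using cylinder_expansion[OF F(1), of "\<lambda>a. f a - c" x] by simp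
        have int: "integrable \<kappa> (\<lambda>x. c + (\<Sum>a\<in>?P. (f a - c) * indicator (cylinder F a) x))"
          using cyl by (intro Bochner_Integration.integrable_add integrable_const
              Bochner_Integration.integrable_sum integrable_mult_right
              integrable_real_indicator) (auto simp: emeasure_eq_measure)
        have "(LINT x|\<kappa>. c + (\<Sum>a\<in>?P. (f a - c) * indicator (cylinder F a) x))
            = c + (\<Sum>a\<in>?P. (f a - c) * measure \<kappa> (cylinder F a))"
          using cyl
          by (subst Bochner_Integration.integral_add Bochner_Integration.integral_sum;
              (intro Bochner_Integration.integrable_add integrable_const
              Bochner_Integration.integrable_sum integrable_mult_right
              integrable_real_indicator)?)
            (use prob_space in \<open>auto simp: emeasure_eq_measure config_probs_space[OF \<kappa>]\<close>)
        then have "(LINT x|\<kappa>. f x) - (c + (\<Sum>a\<in>?P. (f a - c) * measure \<kappa> (cylinder F a)))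
            = (LINT x|\<kappa>. f x - f (restrict x F))"
          using int lipschitz_integrable[OF f \<kappa>] by (simp add: eq)
        also have "\<bar>\<dots>\<bar> \<le> (LINT x|\<kappa>. \<bar>f x - f (restrict x F)\<bar>)"
          by (rule integral_abs_bound)
        also have "\<dots> \<le> (LINT x|\<kappa>. e / 8)"
        proof (rule integral_mono)
          show "integrable \<kappa> (\<lambda>x. \<bar>f x - f (restrict x F)\<bar>)"
            using int lipschitz_integrable[OF f \<kappa>] by (simp add: eq)
          show "\<bar>f x - f (restrict x F)\<bar> \<le> e / 8" for x
            using lipschitz_restrict[OF f, of x F] F(2) by linarith
        qed simp
        finally show ?thesis
          by (simp add: prob_space)
      qed
      have "\<bar>(\<Sum>a\<in>?P. (f a - c) * measure \<mu> (cylinder F a)) - (\<Sum>a\<in>?P. (f a - c) * measure \<nu> (cylinder F a))\<bar>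
          = \<bar>\<Sum>a\<in>?P. (f a - c) * (measure \<mu> (cylinder F a) - measure \<nu> (cylinder F a))\<bar>"
        by (simp add: sum_subtractf[symmetric] algebra_simps)
      also have "\<dots> \<le> (\<Sum>a\<in>?P. \<bar>(f a - c) * (measure \<mu> (cylinder F a) - measure \<nu> (cylinder F a))\<bar>)"
        by (rule sum_abs)
      also have "\<dots> \<le> (\<Sum>a\<in>?P. ?D * \<delta>)"
      proof (rule sum_mono)
        fix a assume "a \<in> ?P"
        then have "\<bar>measure \<mu> (cylinder F a) - measure \<nu> (cylinder F a)\<bar> \<le> \<delta>"
          using close[of "cylinder F a"] by simp
        moreover have "\<bar>f a - c\<bar> \<le> ?D"
          using lipschitzD[OF f, of a undefined] config_dist_le_total[of a undefined]
          by (simp add: c_def)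
        ultimately show "\<bar>(f a - c) * (measure \<mu> (cylinder F a) - measure \<nu> (cylinder F a))\<bar> \<le> ?D * \<delta>"
          unfolding abs_mult using D by (intro mult_mono) auto
      qed
      also have "\<dots> = real (card ?P) * ?D * \<delta>"
        by simp
      also have "\<dots> \<le> (real (card ?P) + 1) * (?D + 1) * \<delta>"
        using D \<delta> by (intro mult_right_mono mult_mono) auto
      also have "\<dots> = e / 4"
      proof -
        have "real (card ?P) + 1 \<noteq> 0" "?D + 1 \<noteq> 0"
          using D by linarith+
        moreover have "a * b * (e / (4 * a * b)) = e / 4" if "a \<noteq> 0" "b \<noteq> 0" for a b :: real
          using that by simp
        ultimately show ?thesis
          unfolding \<delta>_def by blast
      qed
      finally show ?thesis
        using approx[OF p(1)] approx[OF p(2)] by linarith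
    qed
    then have "transport_dist \<mu> \<nu> \<le> e / 2"
      by (rule transport_dist_leI)
    then show ?thesis
      using assms by simp
  qed
  then show ?thesis
    using finite_patterns[OF F(1)] finitely_determined_cylinder[OF F(1)] \<delta>
    by (intro exI[of _ "cylinder F ` ?P"] exI[of _ \<delta>] conjI ballI impI) blast+
qed

section \<open>Weak compactness of the shift-invariant measures\<close>

lemma finitely_determined_closedin:
  fixes E :: "('i \<Rightarrow> 'a) set"
  assumes "finitely_determined E"
  shows "closedin (product_topology (\<lambda>_. discrete_topology UNIV) UNIV) E"
proof -
  let ?X = "product_topology (\<lambda>_ :: 'i. discrete_topology (UNIV :: 'a set)) UNIV"
  have "openin ?X E" if "finitely_determined E" for E :: "('i \<Rightarrow> 'a) set"
  proof -
    obtain F where F: "finite F" "\<And>x y. (\<And>g. g \<in> F \<Longrightarrow> x g = y g) \<Longrightarrow> x \<in> E \<longleftrightarrow> y \<in> E"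
      using \<open>finitely_determined E\<close> unfolding finitely_determined_def by metis
    have "\<exists>U. finite {i. U i \<noteq> UNIV} \<and> x \<in> Pi\<^sub>E UNIV U \<and> Pi\<^sub>E UNIV U \<subseteq> E"
      if "x \<in> E" for x
    proof (intro exI conjI)
      let ?U = "\<lambda>i. if i \<in> F then {x i} else UNIV"
      show "finite {i. ?U i \<noteq> UNIV}"
        by (rule finite_subset[OF _ F(1)]) auto
      show "x \<in> Pi\<^sub>E UNIV ?U"
        by auto
      show "Pi\<^sub>E UNIV ?U \<subseteq> E"
      proof
        fix y assume "y \<in> Pi\<^sub>E UNIV ?U"
        then have "y i \<in> ?U i" for i
          by (rule PiE_mem) simp
        then have "x i = y i" if "i \<in> F" for i
          using that by (metis singletonD)
        then show "y \<in> E"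
          using F(2)[of x y] \<open>x \<in> E\<close> by simp
      qed
    qed
    then show ?thesis
      by (simp add: openin_product_topology_alt)
  qed
  then show ?thesis
    using assms finitely_determined_Compl[OF assms] by (simp add: closedin_def Compl_eq_Diff_UNIV)
qed

lemma finitely_determined_nest:
  fixes A :: "nat \<Rightarrow> ('i \<Rightarrow> 'a::finite) set"
  assumes "\<And>n. finitely_determined (A n)" "decseq A" "(\<Inter>n. A n) = {}"
  obtains n where "A n = {}"
proof -
  have "compact_space (product_topology (\<lambda>_::'i. discrete_topology (UNIV :: 'a set)) UNIV)"
    by (simp add: compact_space_product_topology compact_space_discrete_topology)
  then show ?thesis
    using compact_space_imp_nest[OF _ finitely_determined_closedin[OF assms(1)] _ assms(2)] assms(3) that
    by blast
qed

text \<open>Kolmogorov's extension theorem. The finitely determined events are clopen in a compact space,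
  so a decreasing sequence of them with empty intersection is eventually empty. Finite additivity
  therefore already gives the continuity at \<open>\<emptyset>\<close> that Caratheodory's theorem asks for.\<close>

lemma finitely_additive_extension:
  fixes p :: "('k free_group \<Rightarrow> 'a::finite) set \<Rightarrow> real"
  assumes nonneg: "\<And>E. finitely_determined E \<Longrightarrow> p E \<ge> 0"
    and one: "p UNIV = 1"
    and add: "\<And>E E'. finitely_determined E \<Longrightarrow> finitely_determined E' \<Longrightarrow> E \<inter> E' = {} \<Longrightarrow>
      p (E \<union> E') = p E + p E'"
  obtains \<nu> where "\<nu> \<in> config_probs" "\<And>E. finitely_determined E \<Longrightarrow> measure \<nu> E = p E"
proof -
  let ?M = "{E :: ('k free_group \<Rightarrow> 'a) set. finitely_determined E}"
  interpret algebra UNIV ?M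
    by (auto simp: algebra_iff_Un finitely_determined_Un finitely_determined_Diff)
  have p0: "p {} = 0"
    using add[of "{}" "{}"] by simp
  have "\<exists>m. (\<forall>s\<in>?M. m s = ennreal (p s)) \<and> measure_space UNIV (sigma_sets UNIV ?M) m"
  proof (rule caratheodory_empty_continuous)
    show "positive ?M (\<lambda>E. ennreal (p E))"
      by (simp add: positive_def p0)
    show "additive ?M (\<lambda>E. ennreal (p E))"
      by (auto simp: additive_def add nonneg ennreal_plus)
    fix A :: "nat \<Rightarrow> ('k free_group \<Rightarrow> 'a) set"
    assume A: "range A \<subseteq> ?M" "decseq A" "(\<Inter>i. A i) = {}"
    then obtain n where n: "A n = {}"
      using finitely_determined_nest[of A] by blast
    have "ennreal (p (A i)) = 0" if "i \<ge> n" for i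
      using decseqD[OF A(2) that] n p0 by simp
    then show "(\<lambda>i. ennreal (p (A i))) \<longlonglongrightarrow> 0"
      by (intro tendsto_eventually eventually_sequentiallyI)
  qed simp
  then obtain m where m: "\<And>E. finitely_determined E \<Longrightarrow> m E = ennreal (p E)"
    "measure_space UNIV (sigma_sets UNIV ?M) m"
    by auto
  define \<nu> where "\<nu> = measure_of UNIV ?M m"
  have sets: "sets \<nu> = sigma_sets UNIV ?M"
    by (simp add: \<nu>_def)
  have em: "emeasure \<nu> E = m E" if "E \<in> sigma_sets UNIV ?M" for E
    using m(2) that sets unfolding \<nu>_def
    by (intro emeasure_measure_of[OF refl]) (auto simp: measure_space_def)
  have "emeasure \<nu> (space \<nu>) = 1"
    using em[of UNIV] m(1)[of UNIV] one by (simp add: \<nu>_def sigma_sets.Basic space_measure_of_conv)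
  then have "\<nu> \<in> config_probs"
    using sets by (auto simp: config_probs_def sets_config_space intro: prob_spaceI)
  moreover have "measure \<nu> E = p E" if "finitely_determined E" for E
    using em[of E] m(1)[OF that] that nonneg[OF that] by (simp add: measure_def sigma_sets.Basic)
  ultimately show ?thesis
    using that by blast
qed

text \<open>A measure is represented by the function that assigns to each set of configurations its
  measure. Its properties are imposed on finitely determined events only: each then constrains
  finitely many coordinates of a point in the product space \<open>[0, 1]\<close> to the power of all sets of
  configurations, hence is closed, and Tychonoff's theorem applies.\<close>

definition invariant_charges :: "(('k free_group \<Rightarrow> 'a) set \<Rightarrow> real) set" where
  "invariant_charges = {p. (\<forall>E. p E \<in> {0..1}) \<and> p UNIV = 1 \<and>
     (\<forall>E E'. finitely_determined E \<longrightarrow> finitely_determined E' \<longrightarrow> E \<inter> E' = {} \<longrightarrow>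
        p (E \<union> E') = p E + p E') \<and>
     (\<forall>g E. finitely_determined E \<longrightarrow> p (shift g -` E) = p E)}"

lemma compact_invariant_charges:
  "compact (invariant_charges :: (('k free_group \<Rightarrow> 'a) set \<Rightarrow> real) set)"
proof -
  let ?C = "Pi\<^sub>E UNIV (\<lambda>_. {0..1}) :: (('k free_group \<Rightarrow> 'a) set \<Rightarrow> real) set"
  have "compactin (product_topology (\<lambda>_. euclidean) UNIV) ?C"
    by (subst compactin_PiE) simp
  then have compact: "compact ?C"
    by (simp add: euclidean_product_topology)
  have closed: "closed {p :: ('k free_group \<Rightarrow> 'a) set \<Rightarrow> real. p UNIV = 1 \<and>
     (\<forall>E E'. finitely_determined E \<longrightarrow> finitely_determined E' \<longrightarrow> E \<inter> E' = {} \<longrightarrow>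
        p (E \<union> E') = p E + p E') \<and>
     (\<forall>g E. finitely_determined E \<longrightarrow> p (shift g -` E) = p E)}"
    by (intro closed_Collect_conj closed_Collect_all closed_Collect_imp open_Collect_const
        closed_Collect_eq continuous_on_add continuous_on_const continuous_on_product_coordinates)
  have "invariant_charges = ?C \<inter> {p :: ('k free_group \<Rightarrow> 'a) set \<Rightarrow> real. p UNIV = 1 \<and>
     (\<forall>E E'. finitely_determined E \<longrightarrow> finitely_determined E' \<longrightarrow> E \<inter> E' = {} \<longrightarrow>
        p (E \<union> E') = p E + p E') \<and>
     (\<forall>g E. finitely_determined E \<longrightarrow> p (shift g -` E) = p E)}"
    unfolding invariant_charges_def by (auto simp: PiE_def Pi_def)
  then show ?thesis
    using compact_Int_closed[OF compact closed] by simp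
qed

lemma measure_invariant_charge:
  fixes \<nu> :: "('k free_group \<Rightarrow> 'a::finite) measure"
  assumes "\<nu> \<in> shift_invariant_measures"
  shows "measure \<nu> \<in> invariant_charges"
proof -
  have p: "\<nu> \<in> config_probs"
    using assms by (rule shift_invariant_config_probs)
  interpret prob_space \<nu>
    using p by (rule config_probs_prob)
  have ev: "E \<in> events" if "finitely_determined E" for E
    using sets_finitely_determined[OF that] config_probs_sets[OF p] by simp
  have "measure \<nu> (shift g -` E) = measure \<nu> E" if "finitely_determined E" for g E
    using distr_config_probs(2)[OF p measurable_shift sets_finitely_determined[OF that], of g] assms
    by (simp add: shift_invariant_measures_def)
  then show ?thesis
    using ev prob_space by (auto simp: invariant_charges_def config_probs_space[OF p] finite_measure_Union)
qed

lemma invariant_charge_measure: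
  fixes p :: "('k free_group \<Rightarrow> 'a::finite) set \<Rightarrow> real"
  assumes "p \<in> invariant_charges"
  obtains \<nu> where "\<nu> \<in> shift_invariant_measures"
    "\<And>E. finitely_determined E \<Longrightarrow> measure \<nu> E = p E"
proof -
  have inv: "p (shift g -` E) = p E" if "finitely_determined E" for g E
    using assms that by (simp add: invariant_charges_def)
  obtain \<nu> where \<nu>: "\<nu> \<in> config_probs" "\<And>E. finitely_determined E \<Longrightarrow> measure \<nu> E = p E"
    by (rule finitely_additive_extension[of p]) (use assms in \<open>auto simp: invariant_charges_def\<close>)
  have "distr \<nu> config_space (shift g) = \<nu>" for g
  proof (rule config_probs_eqI)
    fix E :: "('k free_group \<Rightarrow> 'a) set" assume E: "finitely_determined E"
    show "measure (distr \<nu> config_space (shift g)) E = measure \<nu> E"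
      using distr_config_probs(2)[OF \<nu>(1) measurable_shift sets_finitely_determined[OF E], of g]
      by (simp add: \<nu>(2) E finitely_determined_shift inv)
  qed (use \<nu>(1) distr_config_probs(1)[OF \<nu>(1) measurable_shift] in auto)
  then have "\<nu> \<in> shift_invariant_measures"
    using \<nu>(1) by (simp add: shift_invariant_measures_def config_probs_def)
  then show ?thesis
    using that \<nu>(2) by blast
qed

text \<open>The compact space of invariant charges is covered by neighbourhoods \<open>U \<nu>\<close> of the self-joinings
  \<open>\<nu>\<close> and by the open conditions \<open>W (E, d, b)\<close> that a marginal gives the event \<open>E\<close> a probability that
  differs from that under \<open>\<mu>\<close> by more than \<open>d\<close>. A finite subcover involves finitely many such
  conditions, and these fail if the marginals are close enough to \<open>\<mu>\<close>; what remains is then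
  covered by finitely many of the sets \<open>U \<nu>\<close>.\<close>

lemma near_joinings_covered:
  fixes \<mu> :: "('k::finite free_group \<Rightarrow> 'a::finite) measure"
    and e :: "('k free_group \<Rightarrow> 'a \<times> 'a) measure \<Rightarrow> real"
  assumes \<mu>: "\<mu> \<in> config_probs"
    and e: "\<And>\<nu>. \<nu> \<in> self_joinings \<mu> \<Longrightarrow> e \<nu> > 0"
  obtains \<Lambda> \<epsilon> where "finite \<Lambda>" "\<Lambda> \<subseteq> self_joinings \<mu>" "\<epsilon> > 0"
    "\<And>\<nu>. \<nu> \<in> shift_invariant_measures \<Longrightarrow>
      transport_dist (distr \<nu> config_space (\<lambda>z. fst \<circ> z)) \<mu> < \<epsilon> \<Longrightarrow>
      transport_dist (distr \<nu> config_space (\<lambda>z. snd \<circ> z)) \<mu> < \<epsilon> \<Longrightarrow>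
      \<exists>\<nu>'\<in>\<Lambda>. transport_dist \<nu> \<nu>' < e \<nu>'"
proof -
  define pr where "pr = (\<lambda>b. if b then fst else snd :: 'a \<times> 'a \<Rightarrow> 'a)"
  let ?J = "self_joinings \<mu>"
  let ?m = "\<lambda>\<nu> b. distr \<nu> config_space (\<lambda>z. pr b \<circ> z)"
  have marg: "?m \<nu> b \<in> config_probs"
    "finitely_determined E \<Longrightarrow> measure (?m \<nu> b) E = measure \<nu> ((\<lambda>z. pr b \<circ> z) -` E)"
    if "\<nu> \<in> shift_invariant_measures" for \<nu> b E
    using distr_config_probs[OF shift_invariant_config_probs[OF that] measurable_comp_config]
      sets_finitely_determined by blast+
  have "\<exists>\<E> \<delta>. finite \<E> \<and> (\<forall>E\<in>\<E>. finitely_determined E) \<and> \<delta> > 0 \<and>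
      (\<forall>\<kappa>\<in>config_probs. (\<forall>E\<in>\<E>. \<bar>measure \<kappa> E - measure \<nu> E\<bar> < \<delta>) \<longrightarrow> transport_dist \<kappa> \<nu> < e \<nu>)"
    if "\<nu> \<in> ?J" for \<nu>
  proof -
    have "\<nu> \<in> config_probs"
      using that by (auto simp: self_joinings_def shift_invariant_config_probs)
    then show ?thesis
      using transport_dist_less_if_cylinders_close[OF e[OF that]] by meson
  qed
  then obtain \<E> \<delta> where *: "\<And>\<nu>. \<nu> \<in> ?J \<Longrightarrow> finite (\<E> \<nu>) \<and> (\<forall>E\<in>\<E> \<nu>. finitely_determined E) \<and> \<delta> \<nu> > 0 \<and>
      (\<forall>\<kappa>\<in>config_probs. (\<forall>E\<in>\<E> \<nu>. \<bar>measure \<kappa> E - measure \<nu> E\<bar> < \<delta> \<nu>) \<longrightarrow> transport_dist \<kappa> \<nu> < e \<nu>)"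
    by metis
  define U where "U = (\<lambda>\<nu>. {p. \<forall>E\<in>\<E> \<nu>. \<bar>p E - measure \<nu> E\<bar> < \<delta> \<nu>})"
  define W where "W = (\<lambda>(E, d, b). {p. d < \<bar>p ((\<lambda>z. pr b \<circ> z) -` E) - measure \<mu> E\<bar>})"
  define I where "I = {(E :: ('k free_group \<Rightarrow> 'a) set, d :: real, b :: bool). finitely_determined E \<and> d > 0}"
  let ?f = "case_sum U W"
  have "open (?f i)" if "i \<in> Inl ` ?J \<union> Inr ` I" for i
  proof (cases i)
    case (Inl \<nu>)
    then have "finite (\<E> \<nu>)"
      using that * by auto
    moreover have "U \<nu> = (\<Inter>E\<in>\<E> \<nu>. {p. \<bar>p E - measure \<nu> E\<bar> < \<delta> \<nu>})"
      by (auto simp: U_def)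
    moreover have "open {p :: ('k free_group \<Rightarrow> 'a \<times> 'a) set \<Rightarrow> real. \<bar>p E - measure \<nu> E\<bar> < \<delta> \<nu>}" for E
      by (intro open_Collect_less continuous_intros continuous_on_product_coordinates)
    ultimately show ?thesis
      using Inl by (auto intro: open_INT)
  next
    case (Inr t)
    obtain E d b where t: "t = (E, d, b)"
      by (cases t) auto
    have "open {p :: ('k free_group \<Rightarrow> 'a \<times> 'a) set \<Rightarrow> real. d < \<bar>p ((\<lambda>z. pr b \<circ> z) -` E) - measure \<mu> E\<bar>}"
      by (intro open_Collect_less continuous_intros continuous_on_product_coordinates)
    then show ?thesis
      using Inr t by (simp add: W_def)
  qed
  moreover have "invariant_charges \<subseteq> (\<Union>i\<in>Inl ` ?J \<union> Inr ` I. ?f i)"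
  proof
    fix p :: "('k free_group \<Rightarrow> 'a \<times> 'a) set \<Rightarrow> real" assume "p \<in> invariant_charges"
    then obtain \<nu> where \<nu>: "\<nu> \<in> shift_invariant_measures"
      "\<And>E. finitely_determined E \<Longrightarrow> measure \<nu> E = p E"
      using invariant_charge_measure by blast
    show "p \<in> (\<Union>i\<in>Inl ` ?J \<union> Inr ` I. ?f i)"
    proof (cases "\<nu> \<in> ?J")
      case True
      then have "p \<in> U \<nu>"
        using *[OF True] \<nu>(2) by (auto simp: U_def)
      then show ?thesis
        using True by force
    next
      case False
      then have "?m \<nu> True \<noteq> \<mu> \<or> ?m \<nu> False \<noteq> \<mu>"
        using \<nu>(1) by (auto simp: self_joinings_def pr_def)
      then obtain b where "?m \<nu> b \<noteq> \<mu>"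
        by blast
      then obtain E where E: "finitely_determined E" "measure (?m \<nu> b) E \<noteq> measure \<mu> E"
        using config_probs_eqI[OF marg(1)[OF \<nu>(1)] \<mu>] by blast
      define d where "d = \<bar>measure (?m \<nu> b) E - measure \<mu> E\<bar> / 2"
      have "d > 0"
        using E(2) by (simp add: d_def)
      moreover have "p \<in> W (E, d, b)"
        using E \<open>d > 0\<close> marg(2)[OF \<nu>(1) E(1), of b] \<nu>(2)[OF finitely_determined_comp[OF E(1)], of "pr b"]
        by (simp add: W_def d_def)
      ultimately show ?thesis
        using E(1) by (force simp: I_def)
    qed
  qed
  ultimately obtain C where C: "C \<subseteq> Inl ` ?J \<union> Inr ` I" "finite C"
    "invariant_charges \<subseteq> (\<Union>i\<in>C. ?f i)"
    using compactE_image[OF compact_invariant_charges] by metis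
  define \<Lambda> where "\<Lambda> = Inl -` C"
  define I' where "I' = Inr -` C"
  have \<Lambda>: "finite \<Lambda>" "\<Lambda> \<subseteq> ?J" and I': "finite I'" "I' \<subseteq> I"
    using C(1,2) by (auto simp: \<Lambda>_def I'_def intro!: finite_vimageI)
  have "\<forall>E :: ('k free_group \<Rightarrow> 'a) set. \<exists>m. finitely_determined E \<longrightarrow> m > 0 \<and>
      (\<forall>\<mu>\<in>config_probs. \<forall>\<nu>\<in>config_probs. m * \<bar>measure \<mu> E - measure \<nu> E\<bar> \<le> transport_dist \<mu> \<nu>)"
    using finitely_determined_transport by metis
  then obtain m where m: "\<And>E :: ('k free_group \<Rightarrow> 'a) set. finitely_determined E \<Longrightarrow> m E > 0 \<and>
      (\<forall>\<mu>\<in>config_probs. \<forall>\<nu>\<in>config_probs. m E * \<bar>measure \<mu> E - measure \<nu> E\<bar> \<le> transport_dist \<mu> \<nu>)"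
    by metis
  define \<epsilon> where "\<epsilon> = Min (insert 1 ((\<lambda>(E, d, b). m E * d) ` I'))"
  have "\<epsilon> > 0"
    using I' m by (auto simp: \<epsilon>_def I_def)
  moreover have "\<exists>\<nu>'\<in>\<Lambda>. transport_dist \<nu> \<nu>' < e \<nu>'"
    if \<nu>: "\<nu> \<in> shift_invariant_measures"
      and close: "transport_dist (distr \<nu> config_space (\<lambda>z. fst \<circ> z)) \<mu> < \<epsilon>"
        "transport_dist (distr \<nu> config_space (\<lambda>z. snd \<circ> z)) \<mu> < \<epsilon>" for \<nu>
  proof -
    have notW: "measure \<nu> \<notin> W (E, d, b)" if "(E, d, b) \<in> I'" for E d b
    proof -
      have E: "finitely_determined E" "d > 0"
        using that I'(2) by (auto simp: I_def)
      have "m E * \<bar>measure (?m \<nu> b) E - measure \<mu> E\<bar> \<le> transport_dist (?m \<nu> b) \<mu>"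
        using m[OF E(1)] marg(1)[OF \<nu>] \<mu> by blast
      also have "\<dots> < \<epsilon>"
        using close by (cases b) (simp_all add: pr_def)
      also have "\<epsilon> \<le> m E * d"
        unfolding \<epsilon>_def using I'(1) that by (intro Min_le) force+
      finally show ?thesis
        using m[OF E(1)] marg(2)[OF \<nu> E(1), of b] by (simp add: W_def)
    qed
    obtain i where i: "i \<in> C" "measure \<nu> \<in> ?f i"
      using C(3) measure_invariant_charge[OF \<nu>] by blast
    then obtain \<nu>' where \<nu>': "i = Inl \<nu>'"
      using notW by (cases i) (auto simp: I'_def)
    then have "\<nu>' \<in> \<Lambda>" "measure \<nu> \<in> U \<nu>'"
      using i by (auto simp: \<Lambda>_def)
    then show ?thesis
      using *[of \<nu>'] \<Lambda>(2) shift_invariant_config_probs[OF \<nu>] unfolding U_def by blast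
  qed
  ultimately show ?thesis
    using that \<Lambda> by blast
qed

section \<open>Empirical measures\<close>

lemma measurable_pullback_name:
  "pullback_name \<sigma> x \<in> measurable (uniform_count_measure V) config_space"
  by (simp add: measurable_def sets_uniform_count_measure space_uniform_count_measure)

lemma integral_empirical_measure:
  assumes "finite V" "f \<in> borel_measurable config_space"
  shows "(LINT y|empirical_measure V \<sigma> x. f y) = (\<Sum>v\<in>V. f (pullback_name \<sigma> x v)) / real (card V)"
  unfolding empirical_measure_def
  by (subst integral_distr[OF measurable_pullback_name assms(2)])
    (rule integral_uniform_count_measure[OF assms(1)])

lemma empirical_measure_config_probs:
  assumes "finite V" "V \<noteq> {}"
  shows "empirical_measure V \<sigma> x \<in> config_probs"
  unfolding empirical_measure_def config_probs_def
  using prob_space.prob_space_distr[OF prob_space_uniform_count_measure[OF assms] measurable_pullback_name]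
  by simp

lemma measure_empirical_measure:
  assumes "finite V" "V \<noteq> {}" "E \<in> sets config_space"
  shows "measure (empirical_measure V \<sigma> x) E
    = (\<Sum>v\<in>V. indicator E (pullback_name \<sigma> x v)) / real (card V)"
proof -
  have "measure (empirical_measure V \<sigma> x) E = (LINT y|empirical_measure V \<sigma> x. indicator E y)"
    using config_probs_space[OF empirical_measure_config_probs[OF assms(1,2), of \<sigma> x]] by simp
  then show ?thesis
    using integral_empirical_measure[OF assms(1), of "indicator E"] assms(3) by simp
qed

lemma shift_pullback_name:
  assumes "\<sigma> \<in> action_homs V" "v \<in> V"
  shows "shift g (pullback_name \<sigma> x v) = pullback_name \<sigma> x (\<sigma> g v)"
  using assms by (simp add: shift_def pullback_name_def action_hom_mult_apply)

text \<open>The empirical measure of any homomorphism is exactly invariant, because \<open>\<sigma> g\<close> permutes the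
  points over which it averages.\<close>

lemma empirical_measure_invariant:
  fixes x :: "'v \<Rightarrow> 'a::finite" and \<sigma> :: "'k free_group \<Rightarrow> 'v \<Rightarrow> 'v"
  assumes "\<sigma> \<in> action_homs V" "finite V" "V \<noteq> {}"
  shows "empirical_measure V \<sigma> x \<in> shift_invariant_measures"
proof -
  let ?P = "empirical_measure V \<sigma> x"
  have p: "?P \<in> config_probs"
    using assms(2,3) by (rule empirical_measure_config_probs)
  have "distr ?P config_space (shift g) = ?P" for g
  proof (rule config_probs_eqI)
    fix E :: "('k free_group \<Rightarrow> 'a) set" assume E: "finitely_determined E"
    have "measure (distr ?P config_space (shift g)) E = measure ?P (shift g -` E)"
      using distr_config_probs(2)[OF p measurable_shift sets_finitely_determined[OF E]] .
    also have "\<dots> = (\<Sum>v\<in>V. indicator (shift g -` E) (pullback_name \<sigma> x v)) / real (card V)"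
      by (rule measure_empirical_measure[OF assms(2,3) sets_finitely_determined[OF finitely_determined_shift[OF E]]])
    also have "(\<Sum>v\<in>V. indicator (shift g -` E) (pullback_name \<sigma> x v))
        = (\<Sum>v\<in>V. indicator E (pullback_name \<sigma> x (\<sigma> g v)) :: real)"
      by (rule sum.cong) (simp_all add: indicator_def shift_pullback_name[OF assms(1)])
    also have "\<dots> = (\<Sum>v\<in>V. indicator E (pullback_name \<sigma> x v))"
      by (rule sum.reindex_bij_betw[OF action_hom_bij_betw[OF assms(1)]])
    also have "\<dots> / real (card V) = measure ?P E"
      by (rule measure_empirical_measure[OF assms(2,3) sets_finitely_determined[OF E], symmetric])
    finally show "measure (distr ?P config_space (shift g)) E = measure ?P E" .
  qed (use p distr_config_probs(1)[OF p measurable_shift] in auto)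
  then show ?thesis
    using p by (simp add: shift_invariant_measures_def config_probs_def)
qed

lemma distr_empirical_measure:
  assumes "\<sigma> \<in> action_homs V" "\<And>v. v \<in> V \<Longrightarrow> f (z v) = x v"
  shows "distr (empirical_measure V \<sigma> z) config_space (\<lambda>w. f \<circ> w) = empirical_measure V \<sigma> x"
proof -
  have "distr (empirical_measure V \<sigma> z) config_space (\<lambda>w. f \<circ> w)
      = distr (uniform_count_measure V) config_space ((\<lambda>w. f \<circ> w) \<circ> pullback_name \<sigma> z)"
    unfolding empirical_measure_def by (rule distr_distr[OF measurable_comp_config measurable_pullback_name])
  also have "\<dots> = empirical_measure V \<sigma> x"
    unfolding empirical_measure_def
    using assms action_hom_in[OF assms(1)]
    by (intro distr_cong) (auto simp: pullback_name_def space_uniform_count_measure fun_eq_iff)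
  finally show ?thesis .
qed

section \<open>Dependence of the empirical measure on the homomorphism\<close>

lemma infsum_finite_sum:
  fixes f :: "'i \<Rightarrow> 'b \<Rightarrow> real"
  assumes "finite I" "\<And>i. i \<in> I \<Longrightarrow> f i summable_on A"
  shows "(\<lambda>x. \<Sum>i\<in>I. f i x) summable_on A \<and> infsum (\<lambda>x. \<Sum>i\<in>I. f i x) A = (\<Sum>i\<in>I. infsum (f i) A)"
  using assms by (induction I) (auto simp: infsum_add summable_on_add)

text \<open>A Lipschitz constant of \<open>\<sigma> \<mapsto> empirical_measure V \<sigma> x\<close> for the switching metric: one switching
  changes the name of at most \<open>2 d(\<gamma>, e)\<close> points at the site \<open>\<gamma>\<close>.\<close>

definition switching_const :: "'k::finite itself \<Rightarrow> real" where
  "switching_const _ = (\<Sum>\<^sub>\<infinity>\<gamma> :: 'k free_group. 2 * (real (word_length \<gamma>) * site_weight \<gamma>))"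

lemma switching_const_nonneg: "switching_const TYPE('k::finite) \<ge> 0"
  unfolding switching_const_def by (rule infsum_nonneg) (simp add: less_imp_le)

lemma transport_dist_switching:
  fixes \<sigma>\<^sub>1 \<sigma>\<^sub>2 :: "'k::finite free_group \<Rightarrow> 'v \<Rightarrow> 'v" and x :: "'v \<Rightarrow> 'a::finite"
  assumes "(\<sigma>\<^sub>1, \<sigma>\<^sub>2) \<in> switching V" "finite V"
  shows "transport_dist (empirical_measure V \<sigma>\<^sub>1 x) (empirical_measure V \<sigma>\<^sub>2 x)
    \<le> switching_const TYPE('k) / real (card V)"
proof (rule transport_dist_leI)
  fix f :: "('k free_group \<Rightarrow> 'a) \<Rightarrow> real" assume f: "f \<in> lipschitz_functions"
  let ?p = "\<lambda>v. pullback_name \<sigma>\<^sub>1 x v" and ?q = "\<lambda>v. pullback_name \<sigma>\<^sub>2 x v"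
  let ?w = "\<lambda>v \<gamma>. if \<sigma>\<^sub>1 \<gamma> v \<noteq> \<sigma>\<^sub>2 \<gamma> v then site_weight \<gamma> else 0"
  have summable: "?w v summable_on UNIV" for v
    by (rule summable_on_comparison_test[OF summable_site_weight]) (auto simp: less_imp_le)
  have dist: "config_dist (?p v) (?q v) \<le> infsum (?w v) UNIV" for v
    unfolding config_dist_alt
    by (rule infsum_mono_neutral[OF summable_site_weight summable])
      (auto simp: pullback_name_def less_imp_le)
  have "\<bar>\<Sum>v\<in>V. f (?p v) - f (?q v)\<bar> \<le> (\<Sum>v\<in>V. \<bar>f (?p v) - f (?q v)\<bar>)"
    by (rule sum_abs)
  also have "\<dots> \<le> (\<Sum>v\<in>V. infsum (?w v) UNIV)"
    using lipschitzD[OF f] dist by (intro sum_mono) (rule order_trans)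
  also have "\<dots> = infsum (\<lambda>\<gamma>. \<Sum>v\<in>V. ?w v \<gamma>) UNIV"
    using infsum_finite_sum[OF assms(2), of ?w UNIV] summable by simp
  also have "\<dots> \<le> switching_const TYPE('k)"
    unfolding switching_const_def
  proof (rule infsum_mono)
    show "(\<lambda>\<gamma>. \<Sum>v\<in>V. ?w v \<gamma>) summable_on UNIV"
      using infsum_finite_sum[OF assms(2), of ?w UNIV] summable by simp
    show "(\<lambda>\<gamma>. 2 * (real (word_length \<gamma>) * site_weight \<gamma>)) summable_on (UNIV :: 'k free_group set)"
      by (rule summable_on_cmult_right[OF summable_length_weight])
    fix \<gamma> :: "'k free_group"
    have "(\<Sum>v\<in>V. ?w v \<gamma>) = real (card {v \<in> V. \<sigma>\<^sub>1 \<gamma> v \<noteq> \<sigma>\<^sub>2 \<gamma> v}) * site_weight \<gamma>"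
      using assms(2) by (simp add: sum.inter_filter[symmetric])
    also have "\<dots> \<le> real (2 * word_length \<gamma>) * site_weight \<gamma>"
      using card_switching_changed[OF assms, of \<gamma>]
      by (intro mult_right_mono) (simp_all add: less_imp_le del: of_nat_mult)
    finally show "(\<Sum>v\<in>V. ?w v \<gamma>) \<le> 2 * (real (word_length \<gamma>) * site_weight \<gamma>)"
      by simp
  qed
  finally have "\<bar>\<Sum>v\<in>V. f (?p v) - f (?q v)\<bar> / real (card V) \<le> switching_const TYPE('k) / real (card V)"
    by (rule divide_right_mono) simp
  then show "\<bar>(LINT y|empirical_measure V \<sigma>\<^sub>1 x. f y) - (LINT y|empirical_measure V \<sigma>\<^sub>2 x. f y)\<bar>
      \<le> switching_const TYPE('k) / real (card V)"
    using integral_empirical_measure[OF assms(2) lipschitz_measurable[OF f]]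
    by (simp add: sum_subtractf diff_divide_distrib[symmetric])
qed

lemma transport_dist_switching_dist:
  fixes \<sigma>\<^sub>1 \<sigma>\<^sub>2 :: "'k::finite free_group \<Rightarrow> 'v \<Rightarrow> 'v" and x :: "'v \<Rightarrow> 'a::finite"
  assumes V: "finite V" "V \<noteq> {}" and \<sigma>: "\<sigma>\<^sub>1 \<in> action_homs V" "\<sigma>\<^sub>2 \<in> action_homs V"
  shows "transport_dist (empirical_measure V \<sigma>\<^sub>1 x) (empirical_measure V \<sigma>\<^sub>2 x)
    \<le> switching_const TYPE('k) * switching_dist V \<sigma>\<^sub>1 \<sigma>\<^sub>2"
proof -
  let ?P = "\<lambda>\<sigma>. empirical_measure V \<sigma> x" and ?c = "switching_const TYPE('k) / real (card V)"
  have P: "?P \<sigma> \<in> config_probs" for \<sigma> :: "'k free_group \<Rightarrow> 'v \<Rightarrow> 'v"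
    using V by (rule empirical_measure_config_probs)
  have "transport_dist (?P \<sigma>\<^sub>1) (?P \<sigma>) \<le> real m * ?c" if "(\<sigma>\<^sub>1, \<sigma>) \<in> switching V ^^ m" for m \<sigma>
    using that
  proof (induction m arbitrary: \<sigma>)
    case 0
    then show ?case
      by (intro transport_dist_leI) simp
  next
    case (Suc m)
    then obtain \<tau> where \<tau>: "(\<sigma>\<^sub>1, \<tau>) \<in> switching V ^^ m" "(\<tau>, \<sigma>) \<in> switching V"
      by (auto elim: relpow_Suc_E)
    have "transport_dist (?P \<sigma>\<^sub>1) (?P \<sigma>) \<le> transport_dist (?P \<sigma>\<^sub>1) (?P \<tau>) + transport_dist (?P \<tau>) (?P \<sigma>)"
      by (rule transport_dist_triangle[OF P P P])
    also have "\<dots> \<le> real m * ?c + ?c"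
      using Suc.IH[OF \<tau>(1)] transport_dist_switching[OF \<tau>(2) V(1), of x] by linarith
    finally show ?case
      by (simp add: algebra_simps add_divide_distrib)
  qed
  moreover obtain m where "(\<sigma>\<^sub>1, \<sigma>\<^sub>2) \<in> switching V ^^ m"
    "switching_dist V \<sigma>\<^sub>1 \<sigma>\<^sub>2 = real m / real (card V)"
    using switching_dist_attained[OF V(1) \<sigma>] by blast
  ultimately show ?thesis
    by (metis mult.commute times_divide_eq_right)
qed

section \<open>Counting good models\<close>

lemma good_models_subset: "good_models V \<sigma> \<mu> \<epsilon> \<subseteq> V \<rightarrow>\<^sub>E UNIV"
  by (auto simp: good_models_def)

lemma finite_good_models: "finite V \<Longrightarrow> finite (good_models V \<sigma> (\<mu> :: (_ \<Rightarrow> 'a::finite) measure) \<epsilon>)"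
  using finite_subset[OF good_models_subset finite_patterns] .

lemma card_patterns: "finite V \<Longrightarrow> card (V \<rightarrow>\<^sub>E (UNIV :: 'a::finite set)) = CARD('a) ^ card V"
  by (simp add: card_PiE)

lemma card_good_models_le:
  fixes \<mu> :: "('k::finite free_group \<Rightarrow> 'a::finite) measure"
  assumes "finite V"
  shows "card (good_models V \<sigma> \<mu> \<epsilon>) \<le> CARD('a) ^ card V"
  using card_mono[OF finite_patterns[OF assms] good_models_subset] card_patterns[OF assms] by metis

lemma card_good_models_mono:
  fixes \<mu> :: "('k::finite free_group \<Rightarrow> 'a::finite) measure"
  assumes "finite V" "\<epsilon> \<le> \<epsilon>'"
  shows "card (good_models V \<sigma> \<mu> \<epsilon>) \<le> card (good_models V \<sigma> \<mu> \<epsilon>')"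
  using assms by (intro card_mono finite_good_models) (auto simp: good_models_def)

lemma card_good_models_large:
  fixes \<mu> :: "('k::finite free_group \<Rightarrow> 'a::finite) measure"
  assumes "finite V" "V \<noteq> {}" "\<mu> \<in> config_probs" "2 * total_weight TYPE('k) < \<epsilon>"
  shows "card (good_models V \<sigma> \<mu> \<epsilon>) = CARD('a) ^ card V"
proof -
  have "good_models V \<sigma> \<mu> \<epsilon> = V \<rightarrow>\<^sub>E UNIV"
    using transport_dist_le_total[OF empirical_measure_config_probs[OF assms(1,2)] assms(3)] assms(4)
    by (auto simp: good_models_def intro: le_less_trans)
  then show ?thesis
    using card_patterns[OF assms(1)] by simp
qed

text \<open>A pair of good models for \<open>\<mu>\<close> is a model on the product alphabet, with empirical measure
  close to some self-joining.\<close>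

lemma card_good_models_square_le:
  fixes \<mu> :: "('k::finite free_group \<Rightarrow> 'a::finite) measure"
  assumes V: "finite V" "V \<noteq> {}" and \<sigma>: "\<sigma> \<in> action_homs V" and fin: "finite \<Lambda>"
    and cover: "\<And>\<nu>. \<nu> \<in> shift_invariant_measures \<Longrightarrow>
      transport_dist (distr \<nu> config_space (\<lambda>z. fst \<circ> z)) \<mu> < \<epsilon> \<Longrightarrow>
      transport_dist (distr \<nu> config_space (\<lambda>z. snd \<circ> z)) \<mu> < \<epsilon> \<Longrightarrow>
      \<exists>\<nu>'\<in>\<Lambda>. transport_dist \<nu> \<nu>' < e \<nu>'"
  shows "card (good_models V \<sigma> \<mu> \<epsilon>) ^ 2 \<le> (\<Sum>\<nu>\<in>\<Lambda>. card (good_models V \<sigma> \<nu> (e \<nu>)))"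
proof -
  let ?G = "good_models V \<sigma> \<mu> \<epsilon>"
  let ?pair = "\<lambda>(x, y). \<lambda>v\<in>V. (x v, y v)"
  have "card ?G ^ 2 = card (?G \<times> ?G)"
    by (simp add: card_cartesian_product power2_eq_square)
  also have "\<dots> \<le> card (\<Union>\<nu>\<in>\<Lambda>. good_models V \<sigma> \<nu> (e \<nu>))"
  proof (rule card_inj_on_le[where f = ?pair])
    show "inj_on ?pair (?G \<times> ?G)"
    proof (rule inj_onI, clarify)
      fix x y x' y' assume *: "x \<in> ?G" "y \<in> ?G" "x' \<in> ?G" "y' \<in> ?G"
        and eq: "(\<lambda>v\<in>V. (x v, y v)) = (\<lambda>v\<in>V. (x' v, y' v))"
      have "x v = x' v \<and> y v = y' v" if "v \<in> V" for v
        using fun_cong[OF eq, of v] that by simp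
      moreover have "x \<in> V \<rightarrow>\<^sub>E UNIV" "y \<in> V \<rightarrow>\<^sub>E UNIV" "x' \<in> V \<rightarrow>\<^sub>E UNIV" "y' \<in> V \<rightarrow>\<^sub>E UNIV"
        using * good_models_subset by blast+
      ultimately show "x = x' \<and> y = y'"
        by (blast intro: PiE_ext)
    qed
    show "?pair ` (?G \<times> ?G) \<subseteq> (\<Union>\<nu>\<in>\<Lambda>. good_models V \<sigma> \<nu> (e \<nu>))"
    proof clarify
      fix x y assume xy: "x \<in> ?G" "y \<in> ?G"
      let ?z = "\<lambda>v\<in>V. (x v, y v)"
      have "distr (empirical_measure V \<sigma> ?z) config_space (\<lambda>w. fst \<circ> w) = empirical_measure V \<sigma> x"
        "distr (empirical_measure V \<sigma> ?z) config_space (\<lambda>w. snd \<circ> w) = empirical_measure V \<sigma> y"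
        by (rule distr_empirical_measure[OF \<sigma>], simp)+
      then obtain \<nu>' where "\<nu>' \<in> \<Lambda>" "transport_dist (empirical_measure V \<sigma> ?z) \<nu>' < e \<nu>'"
        using cover[OF empirical_measure_invariant[OF \<sigma> V, of ?z]] xy by (auto simp: good_models_def)
      then show "?z \<in> (\<Union>\<nu>\<in>\<Lambda>. good_models V \<sigma> \<nu> (e \<nu>))"
        by (auto simp: good_models_def)
    qed
    show "finite (\<Union>\<nu>\<in>\<Lambda>. good_models V \<sigma> \<nu> (e \<nu>))"
      using fin finite_good_models[OF V(1)] by blast
  qed
  also have "\<dots> \<le> (\<Sum>\<nu>\<in>\<Lambda>. card (good_models V \<sigma> \<nu> (e \<nu>)))"
    by (rule card_UN_le[OF fin])
  finally show ?thesis .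
qed

section \<open>The diagonal self-joining\<close>

definition diagonal_joining :: "('k free_group \<Rightarrow> 'a) measure \<Rightarrow> ('k free_group \<Rightarrow> 'a \<times> 'a) measure" where
  "diagonal_joining \<mu> = distr \<mu> config_space (\<lambda>x. (\<lambda>a. (a, a)) \<circ> x)"

lemma diagonal_joining_in_self_joinings:
  fixes \<mu> :: "('k free_group \<Rightarrow> 'a::finite) measure"
  assumes "\<mu> \<in> shift_invariant_measures"
  shows "diagonal_joining \<mu> \<in> self_joinings \<mu>"
proof -
  let ?d = "\<lambda>x. (\<lambda>a. (a, a)) \<circ> x :: 'k free_group \<Rightarrow> 'a \<times> 'a"
  have p: "\<mu> \<in> config_probs"
    using assms by (rule shift_invariant_config_probs)
  have sets: "sets \<mu> = sets config_space"
    using p by (rule config_probs_sets)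
  have d: "?d \<in> measurable \<mu> config_space" and sh: "shift g \<in> measurable \<mu> config_space" for g
    using measurable_comp_config measurable_shift sets by (auto cong: measurable_cong_sets)
  have id: "distr \<mu> config_space (\<lambda>x. x) = \<mu>"
    using distr_id2[of config_space \<mu>] sets by simp
  have marg: "distr (diagonal_joining \<mu>) config_space (\<lambda>z. f \<circ> z) = \<mu>" if "\<And>a. f (a, a) = a" for f
    unfolding diagonal_joining_def
    using that id by (subst distr_distr[OF measurable_comp_config d]) (simp add: comp_def)
  have "distr (diagonal_joining \<mu>) config_space (shift g) = diagonal_joining \<mu>" for g
  proof -
    have "distr (diagonal_joining \<mu>) config_space (shift g) = distr \<mu> config_space (shift g \<circ> ?d)"
      unfolding diagonal_joining_def by (rule distr_distr[OF measurable_shift d])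
    also have "shift g \<circ> ?d = ?d \<circ> shift g"
      by (auto simp: shift_def fun_eq_iff)
    also have "distr \<mu> config_space (?d \<circ> shift g) = distr (distr \<mu> config_space (shift g)) config_space ?d"
      by (rule distr_distr[OF measurable_comp_config sh, symmetric])
    also have "\<dots> = diagonal_joining \<mu>"
      using assms by (simp add: shift_invariant_measures_def diagonal_joining_def)
    finally show ?thesis .
  qed
  moreover have "diagonal_joining \<mu> \<in> config_probs"
    unfolding diagonal_joining_def by (rule distr_config_probs(1)[OF p measurable_comp_config])
  ultimately show ?thesis
    using marg[of fst] marg[of snd]
    by (simp add: self_joinings_def shift_invariant_measures_def config_probs_def)
qed

lemma transport_dist_diagonal_le:
  fixes \<mu> \<nu> :: "('k::finite free_group \<Rightarrow> 'a::finite) measure"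
  assumes "\<mu> \<in> config_probs" "\<nu> \<in> config_probs"
  shows "transport_dist (diagonal_joining \<mu>) (diagonal_joining \<nu>) \<le> transport_dist \<mu> \<nu>"
proof (rule transport_dist_leI)
  fix f :: "('k free_group \<Rightarrow> 'a \<times> 'a) \<Rightarrow> real" assume f: "f \<in> lipschitz_functions"
  let ?d = "\<lambda>x. (\<lambda>a. (a, a)) \<circ> x :: 'k free_group \<Rightarrow> 'a \<times> 'a"
  have "(\<lambda>x. f (?d x)) \<in> lipschitz_functions"
    unfolding lipschitz_functions_def
  proof (intro CollectI allI)
    fix x y
    have "config_dist (?d x) (?d y) \<le> config_dist x y"
      by (rule config_dist_mono) auto
    then show "\<bar>f (?d x) - f (?d y)\<bar> \<le> config_dist x y"
      using lipschitzD[OF f, of "?d x" "?d y"] by linarith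
  qed
  moreover have "(LINT x|diagonal_joining \<kappa>. f x) = (LINT x|\<kappa>. f (?d x))" if "\<kappa> \<in> config_probs" for \<kappa>
    unfolding diagonal_joining_def
    using measurable_comp_config config_probs_sets[OF that]
    by (intro integral_distr[OF _ lipschitz_measurable[OF f]]) (auto cong: measurable_cong_sets)
  ultimately show "\<bar>(LINT x|diagonal_joining \<mu>. f x) - (LINT x|diagonal_joining \<nu>. f x)\<bar> \<le> transport_dist \<mu> \<nu>"
    using transport_dist_ge[OF assms, of "\<lambda>x. f (?d x)"] assms by simp
qed

lemma card_good_models_diagonal:
  fixes \<mu> :: "('k::finite free_group \<Rightarrow> 'a::finite) measure"
  assumes V: "finite V" "V \<noteq> {}" and \<sigma>: "\<sigma> \<in> action_homs V" and \<mu>: "\<mu> \<in> config_probs"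
  shows "card (good_models V \<sigma> \<mu> \<epsilon>) \<le> card (good_models V \<sigma> (diagonal_joining \<mu>) \<epsilon>)"
proof (rule card_inj_on_le[where f = "\<lambda>x. \<lambda>v\<in>V. (x v, x v)"])
  let ?G = "good_models V \<sigma> \<mu> \<epsilon>"
  show "inj_on (\<lambda>x. \<lambda>v\<in>V. (x v, x v)) ?G"
  proof (rule inj_onI)
    fix x y assume *: "x \<in> ?G" "y \<in> ?G" and eq: "(\<lambda>v\<in>V. (x v, x v)) = (\<lambda>v\<in>V. (y v, y v))"
    have "x v = y v" if "v \<in> V" for v
      using fun_cong[OF eq, of v] that by simp
    moreover have "x \<in> V \<rightarrow>\<^sub>E UNIV" "y \<in> V \<rightarrow>\<^sub>E UNIV"
      using * good_models_subset by blast+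
    ultimately show "x = y"
      by (blast intro: PiE_ext)
  qed
  show "(\<lambda>x. \<lambda>v\<in>V. (x v, x v)) ` ?G \<subseteq> good_models V \<sigma> (diagonal_joining \<mu>) \<epsilon>"
  proof clarify
    fix x assume x: "x \<in> ?G"
    let ?z = "\<lambda>v\<in>V. (x v, x v)"
    have "empirical_measure V \<sigma> ?z = diagonal_joining (empirical_measure V \<sigma> x)"
      unfolding diagonal_joining_def by (rule distr_empirical_measure[OF \<sigma>, symmetric]) simp
    then have "transport_dist (empirical_measure V \<sigma> ?z) (diagonal_joining \<mu>)
        \<le> transport_dist (empirical_measure V \<sigma> x) \<mu>"
      using transport_dist_diagonal_le[OF empirical_measure_config_probs[OF V] \<mu>] by simp
    then show "?z \<in> good_models V \<sigma> (diagonal_joining \<mu>) \<epsilon>"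
      using x by (auto simp: good_models_def)
  qed
qed (rule finite_good_models[OF V(1)])

section \<open>Exponential growth rates and the second-moment method\<close>

lemma rate_le_iff:
  assumes "N > 0" "a \<ge> 0"
  shows "ereal (1 / N) * elog a \<le> ereal c \<longleftrightarrow> a \<le> exp (c * N)"
proof (cases "a = 0")
  case True
  then show ?thesis
    using assms by (simp add: elog_def)
next
  case False
  then have a: "a > 0"
    using assms(2) by simp
  have "ereal (1 / N) * elog a \<le> ereal c \<longleftrightarrow> ln a \<le> c * N"
    using a assms(1) by (simp add: elog_def field_simps)
  also have "\<dots> \<longleftrightarrow> a \<le> exp (c * N)"
    using a by (metis exp_gt_zero exp_le_cancel_iff exp_ln)
  finally show ?thesis .
qed

lemma rate_ge_iff:
  assumes "N > 0" "a \<ge> 0"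
  shows "ereal c \<le> ereal (1 / N) * elog a \<longleftrightarrow> exp (c * N) \<le> a"
proof (cases "a = 0")
  case True
  then show ?thesis
    using assms by (simp add: elog_def not_le)
next
  case False
  then have a: "a > 0"
    using assms(2) by simp
  have "ereal c \<le> ereal (1 / N) * elog a \<longleftrightarrow> c * N \<le> ln a"
    using a assms(1) by (simp add: elog_def field_simps)
  also have "\<dots> \<longleftrightarrow> exp (c * N) \<le> a"
    using a by (metis exp_gt_zero exp_le_cancel_iff exp_ln)
  finally show ?thesis .
qed

lemma integrable_bounded_pmf:
  fixes f :: "'s \<Rightarrow> real"
  assumes "\<And>x. \<bar>f x\<bar> \<le> B"
  shows "integrable (measure_pmf p) f"
  using assms by (intro measure_pmf.integrable_const_bound[where B = B]) auto

text \<open>The Paley-Zygmund inequality. It follows by integrating the pointwise bound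
  \<open>f \<le> E f / 2 + T \<cdot> 1\<^sub>A + f\<^sup>2 / T\<close>, where \<open>A\<close> is the event \<open>f \<ge> E f / 2\<close> and \<open>T = 4 M / E f\<close>.\<close>

lemma second_moment_method:
  fixes f :: "'s \<Rightarrow> real"
  assumes f: "\<And>x. 0 \<le> f x" "\<And>x. f x \<le> B"
    and M: "measure_pmf.expectation p (\<lambda>x. f x ^ 2) \<le> M" "M > 0"
  shows "measure_pmf.expectation p f ^ 2
    \<le> 16 * M * measure_pmf.prob p {x. measure_pmf.expectation p f / 2 \<le> f x \<and> 0 < f x}"
proof (cases "measure_pmf.expectation p f = 0")
  case True
  then show ?thesis
    using M(2) by simp
next
  case False
  define m where "m = measure_pmf.expectation p f"
  have m: "m > 0"
    using False f(1) unfolding m_def by (simp add: order.not_eq_order_implies_strict)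
  define A where "A = {x. m / 2 \<le> f x \<and> 0 < f x}"
  define T where "T = 4 * M / m"
  have T: "T > 0"
    using m M(2) by (simp add: T_def)
  have int: "integrable (measure_pmf p) f"
    using f by (intro integrable_bounded_pmf[where B = B]) auto
  have int2: "integrable (measure_pmf p) (\<lambda>x. f x ^ 2)"
    using f by (intro integrable_bounded_pmf[where B = "B ^ 2"]) (auto intro: power_mono)
  have intA: "integrable (measure_pmf p) (indicator A :: 's \<Rightarrow> real)"
    by (intro integrable_bounded_pmf[where B = 1]) (auto simp: indicator_def)
  have pt: "f x \<le> m / 2 + T * indicator A x + f x ^ 2 / T" for x
  proof (cases "x \<in> A")
    case True
    have "f x \<le> T + f x ^ 2 / T"
    proof (cases "f x \<le> T")
      case False
      then have "f x * T \<le> f x * f x"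
        using f(1)[of x] by (intro mult_left_mono) auto
      then have "f x \<le> f x ^ 2 / T"
        using T by (simp add: field_simps power2_eq_square)
      then show ?thesis
        using T by linarith
    next
      case True
      then show ?thesis
        using T by (simp add: add_increasing2)
    qed
    then show ?thesis
      using True m by simp
  next
    case False
    then have "f x \<le> m / 2"
      using f(1)[of x] m by (auto simp: A_def)
    then show ?thesis
      using False T by (simp add: add_increasing2)
  qed
  have "m \<le> measure_pmf.expectation p (\<lambda>x. m / 2 + T * indicator A x + f x ^ 2 / T)"
    unfolding m_def[symmetric]
    by (subst m_def, rule integral_mono[OF int _ pt])
      (intro Bochner_Integration.integrable_add integrable_mult_right integrable_divide
        intA int2 measure_pmf.integrable_const)
  also have "\<dots> = m / 2 + T * measure_pmf.prob p A + measure_pmf.expectation p (\<lambda>x. f x ^ 2) / T"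
    using intA int2 by (simp add: integrable_mult_right)
  also have "\<dots> \<le> m / 2 + T * measure_pmf.prob p A + M / T"
    using M(1) T by (simp add: divide_right_mono)
  also have "M / T = m / 4"
    using m M(2) by (simp add: T_def)
  finally have "m / 4 \<le> T * measure_pmf.prob p A"
    by simp
  then have "m * (m / 4) \<le> m * (T * measure_pmf.prob p A)"
    using m by (intro mult_left_mono) auto
  then show ?thesis
    using m by (simp add: T_def m_def[symmetric] A_def power2_eq_square)
qed

section \<open>The model radius\<close>

lemma model_radius_alt:
  assumes "finite V" "V \<noteq> {}"
  shows "model_radius V \<mu> \<sigma> h
    = Inf {\<epsilon>. \<epsilon> > 0 \<and> exp (h * real (card V)) \<le> real (card (good_models V \<sigma> \<mu> \<epsilon>))}"
  unfolding model_radius_def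
  using assms by (subst rate_ge_iff) (auto simp: card_gt_0_iff)

lemma model_radius_le:
  assumes "finite V" "V \<noteq> {}" "\<epsilon> > 0" "exp (h * real (card V)) \<le> real (card (good_models V \<sigma> \<mu> \<epsilon>))"
  shows "model_radius V \<mu> \<sigma> h \<le> \<epsilon>"
  unfolding model_radius_alt[OF assms(1,2)]
  using assms(3,4) by (intro cInf_lower) (auto intro!: bdd_belowI[of _ 0])

lemma exp_le_card_good_models_large:
  fixes \<mu> :: "('k::finite free_group \<Rightarrow> 'a::finite) measure"
  assumes "finite V" "V \<noteq> {}" "\<mu> \<in> config_probs" "h \<le> ln (real CARD('a))"
  shows "exp (h * real (card V)) \<le> real (card (good_models V \<sigma> \<mu> (2 * total_weight TYPE('k) + 1)))"
proof -
  have "exp (h * real (card V)) \<le> exp (real (card V) * ln (real CARD('a)))"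
    using mult_left_mono[OF assms(4), of "real (card V)"] by (simp add: mult.commute)
  also have "\<dots> = real CARD('a) ^ card V"
    by (simp add: exp_of_nat_mult)
  finally show ?thesis
    using card_good_models_large[OF assms(1,2,3), of "2 * total_weight TYPE('k) + 1" \<sigma>] by simp
qed

lemma model_radius_nonempty:
  fixes \<mu> :: "('k::finite free_group \<Rightarrow> 'a::finite) measure"
  assumes "finite V" "V \<noteq> {}" "\<mu> \<in> config_probs" "h \<le> ln (real CARD('a))"
  shows "{\<epsilon>. \<epsilon> > 0 \<and> exp (h * real (card V)) \<le> real (card (good_models V \<sigma> \<mu> \<epsilon>))} \<noteq> {}"
  using exp_le_card_good_models_large[OF assms, of \<sigma>] total_weight_nonneg[where 'k = 'k]
  by (auto intro!: exI[of _ "2 * total_weight TYPE('k) + 1"])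

lemma model_radius_bounds:
  fixes \<mu> :: "('k::finite free_group \<Rightarrow> 'a::finite) measure"
  assumes "finite V" "V \<noteq> {}" "\<mu> \<in> config_probs" "h \<le> ln (real CARD('a))"
  shows "0 \<le> model_radius V \<mu> \<sigma> h" "model_radius V \<mu> \<sigma> h \<le> 2 * total_weight TYPE('k) + 1"
proof -
  show "0 \<le> model_radius V \<mu> \<sigma> h"
    unfolding model_radius_alt[OF assms(1,2)]
    by (rule cInf_greatest[OF model_radius_nonempty[OF assms]]) simp
  show "model_radius V \<mu> \<sigma> h \<le> 2 * total_weight TYPE('k) + 1"
    using exp_le_card_good_models_large[OF assms] total_weight_nonneg[where 'k = 'k]
    by (intro model_radius_le[OF assms(1,2)]) auto
qed

lemma model_radius_lessD:
  fixes \<mu> :: "('k::finite free_group \<Rightarrow> 'a::finite) measure"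
  assumes "finite V" "V \<noteq> {}" "\<mu> \<in> config_probs" "h \<le> ln (real CARD('a))"
    and "model_radius V \<mu> \<sigma> h < \<epsilon>"
  shows "exp (h * real (card V)) \<le> real (card (good_models V \<sigma> \<mu> \<epsilon>))"
proof -
  obtain \<epsilon>' where "\<epsilon>' < \<epsilon>" "exp (h * real (card V)) \<le> real (card (good_models V \<sigma> \<mu> \<epsilon>'))"
    using cInf_lessD[OF model_radius_nonempty[OF assms(1-4)]] assms(5)
    unfolding model_radius_alt[OF assms(1,2)] by blast
  moreover have "real (card (good_models V \<sigma> \<mu> \<epsilon>')) \<le> real (card (good_models V \<sigma> \<mu> \<epsilon>))"
    using card_good_models_mono[OF assms(1), of \<epsilon>' \<epsilon> \<sigma> \<mu>] \<open>\<epsilon>' < \<epsilon>\<close> by simp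
  ultimately show ?thesis
    by linarith
qed

text \<open>Replacing \<open>\<sigma>\<^sub>1\<close> by \<open>\<sigma>\<^sub>2\<close> moves all empirical measures by at most a constant times the switching
  distance, so the good models of one homomorphism remain good models of the other once the
  radius is enlarged by that amount.\<close>

lemma model_radius_lipschitz:
  fixes \<mu> :: "('k::finite free_group \<Rightarrow> 'a::finite) measure" and V :: "'v set"
  assumes V: "finite V" "V \<noteq> {}" and \<mu>: "\<mu> \<in> config_probs" and h: "h \<le> ln (real CARD('a))"
    and \<sigma>: "\<sigma>\<^sub>1 \<in> action_homs V" "\<sigma>\<^sub>2 \<in> action_homs V"
  shows "\<bar>model_radius V \<mu> \<sigma>\<^sub>1 h - model_radius V \<mu> \<sigma>\<^sub>2 h\<bar>
    \<le> switching_const TYPE('k) * switching_dist V \<sigma>\<^sub>1 \<sigma>\<^sub>2"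
proof -
  let ?K = "switching_const TYPE('k) * switching_dist V \<sigma>\<^sub>1 \<sigma>\<^sub>2"
  let ?P = "\<lambda>\<sigma> x. empirical_measure V \<sigma> x"
  have K: "?K \<ge> 0"
    using switching_const_nonneg[where 'k = 'k] by (simp add: switching_dist_def)
  have le: "model_radius V \<mu> \<sigma>' h - ?K \<le> model_radius V \<mu> \<sigma> h"
    if close: "\<And>x :: 'v \<Rightarrow> 'a. transport_dist (?P \<sigma>' x) (?P \<sigma> x) \<le> ?K" for \<sigma> \<sigma>'
  proof -
    have "model_radius V \<mu> \<sigma>' h - ?K \<le> \<epsilon>"
      if \<epsilon>: "\<epsilon> > 0" "exp (h * real (card V)) \<le> real (card (good_models V \<sigma> \<mu> \<epsilon>))" for \<epsilon>
    proof -
      have "good_models V \<sigma> \<mu> \<epsilon> \<subseteq> good_models V \<sigma>' \<mu> (\<epsilon> + ?K)"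
      proof
        fix x assume x: "x \<in> good_models V \<sigma> \<mu> \<epsilon>"
        have "transport_dist (?P \<sigma>' x) \<mu> \<le> transport_dist (?P \<sigma>' x) (?P \<sigma> x) + transport_dist (?P \<sigma> x) \<mu>"
          by (intro transport_dist_triangle empirical_measure_config_probs V \<mu>)
        then show "x \<in> good_models V \<sigma>' \<mu> (\<epsilon> + ?K)"
          using x close[of x] by (simp add: good_models_def)
      qed
      then have "card (good_models V \<sigma> \<mu> \<epsilon>) \<le> card (good_models V \<sigma>' \<mu> (\<epsilon> + ?K))"
        by (intro card_mono finite_good_models V)
      then have "exp (h * real (card V)) \<le> real (card (good_models V \<sigma>' \<mu> (\<epsilon> + ?K)))"
        using \<epsilon>(2) by linarith
      then show ?thesis
        using model_radius_le[OF V, of "\<epsilon> + ?K" h \<sigma>' \<mu>] \<epsilon>(1) K by simp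
    qed
    then show ?thesis
      unfolding model_radius_alt[OF V, of \<mu> \<sigma>]
      by (intro cInf_greatest[OF model_radius_nonempty[OF V \<mu> h]]) auto
  qed
  have "transport_dist (?P \<sigma>\<^sub>1 x) (?P \<sigma>\<^sub>2 x) \<le> ?K" for x :: "'v \<Rightarrow> 'a"
    by (rule transport_dist_switching_dist[OF V \<sigma>])
  moreover from this have "transport_dist (?P \<sigma>\<^sub>2 x) (?P \<sigma>\<^sub>1 x) \<le> ?K" for x :: "'v \<Rightarrow> 'a"
    by (simp add: transport_dist_commute)
  ultimately show ?thesis
    using le[of \<sigma>\<^sub>1 \<sigma>\<^sub>2] le[of \<sigma>\<^sub>2 \<sigma>\<^sub>1] by (simp add: abs_le_iff)
qed

section \<open>Comparison of the entropies\<close>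

definition mean_models ::
  "'v set \<Rightarrow> ('k::finite free_group \<Rightarrow> 'v \<Rightarrow> 'v) pmf \<Rightarrow> ('k free_group \<Rightarrow> 'a) measure \<Rightarrow> real \<Rightarrow> real"
  where "mean_models V p \<mu> \<epsilon> = measure_pmf.expectation p (\<lambda>\<sigma>. real (card (good_models V \<sigma> \<mu> \<epsilon>)))"

lemma mean_models_nonneg: "mean_models V p \<mu> \<epsilon> \<ge> 0"
  unfolding mean_models_def by (rule Bochner_Integration.integral_nonneg) simp

lemma integrable_card_good_models:
  fixes \<mu> :: "('k::finite free_group \<Rightarrow> 'a::finite) measure"
  assumes "finite V"
  shows "integrable (measure_pmf p) (\<lambda>\<sigma>. real (card (good_models V \<sigma> \<mu> \<epsilon>)))"
    and "integrable (measure_pmf p) (\<lambda>\<sigma>. real (card (good_models V \<sigma> \<mu> \<epsilon>)) ^ 2)"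
proof -
  have le: "real (card (good_models V \<sigma> \<mu> \<epsilon>)) \<le> real (CARD('a) ^ card V)" for \<sigma>
    using card_good_models_le[OF assms, of \<sigma> \<mu> \<epsilon>] of_nat_le_iff by blast
  show "integrable (measure_pmf p) (\<lambda>\<sigma>. real (card (good_models V \<sigma> \<mu> \<epsilon>)))"
    using le by (intro integrable_bounded_pmf[where B = "real (CARD('a) ^ card V)"]) simp
  show "integrable (measure_pmf p) (\<lambda>\<sigma>. real (card (good_models V \<sigma> \<mu> \<epsilon>)) ^ 2)"
    using le by (intro integrable_bounded_pmf[where B = "real (CARD('a) ^ card V) ^ 2"])
      (simp add: power_mono del: of_nat_power)
qed

locale random_sofic_action =
  fixes V :: "nat \<Rightarrow> 'v set"
    and S :: "nat \<Rightarrow> ('k::finite free_group \<Rightarrow> 'v \<Rightarrow> 'v) pmf"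
    and \<mu> :: "('k free_group \<Rightarrow> 'a::finite) measure"
  assumes sofic_approximation: "random_sofic_approximation V S"
    and invariant: "\<mu> \<in> shift_invariant_measures"
begin

lemma finite_V: "finite (V n)" and nonempty_V: "V n \<noteq> {}" and homs: "set_pmf (S n) \<subseteq> action_homs (V n)"
  using sofic_approximation by (auto simp: random_sofic_approximation_def)

lemma config_prob: "\<mu> \<in> config_probs"
  using invariant by (rule shift_invariant_config_probs)

abbreviation N :: "nat \<Rightarrow> real" where
  "N n \<equiv> real (card (V n))"

lemma N_pos: "N n > 0"
  using finite_V nonempty_V by (simp add: card_gt_0_iff)

lemma eventually_le_exp:
  assumes "\<delta> > 0"
  shows "eventually (\<lambda>n. c \<le> exp (\<delta> * N n)) sequentially"
proof -
  have "eventually (\<lambda>n. c / \<delta> \<le> N n) sequentially"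
    using random_sofic_approximation_card[OF sofic_approximation] by (simp add: filterlim_at_top)
  then show ?thesis
  proof eventually_elim
    case (elim n)
    then have "c \<le> \<delta> * N n"
      using assms by (simp add: field_simps)
    also have "\<dots> \<le> exp (\<delta> * N n)"
      using exp_ge_add_one_self[of "\<delta> * N n"] by linarith
    finally show ?case .
  qed
qed

lemma upper_annealed_entropy_alt:
  "upper_annealed_entropy V S \<nu>
    = (INF \<epsilon>\<in>{0<..}. limsup (\<lambda>n. ereal (1 / N n) * elog (mean_models (V n) (S n) \<nu> \<epsilon>)))"
  by (simp add: upper_annealed_entropy_def mean_models_def)

lemma lower_annealed_entropy_alt:
  "lower_annealed_entropy V S \<nu>
    = (INF \<epsilon>\<in>{0<..}. liminf (\<lambda>n. ereal (1 / N n) * elog (mean_models (V n) (S n) \<nu> \<epsilon>)))"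
  by (simp add: lower_annealed_entropy_def mean_models_def)

lemmas mean_le_iff = rate_le_iff[OF N_pos mean_models_nonneg]
lemmas mean_ge_iff = rate_ge_iff[OF N_pos mean_models_nonneg]

lemma lower_le_upper_annealed: "lower_annealed_entropy V S \<nu> \<le> upper_annealed_entropy V S \<nu>"
  unfolding upper_annealed_entropy_alt lower_annealed_entropy_alt
proof (rule INF_mono)
  fix \<epsilon> :: real assume "\<epsilon> \<in> {0<..}"
  then show "\<exists>\<epsilon>'\<in>{0<..}. liminf (\<lambda>n. ereal (1 / N n) * elog (mean_models (V n) (S n) \<nu> \<epsilon>'))
      \<le> limsup (\<lambda>n. ereal (1 / N n) * elog (mean_models (V n) (S n) \<nu> \<epsilon>))"
    by (intro bexI[of _ \<epsilon>] Liminf_le_Limsup) simp_all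
qed

lemma upper_annealed_entropy_leI:
  assumes "\<epsilon> > 0" "eventually (\<lambda>n. mean_models (V n) (S n) \<nu> \<epsilon> \<le> exp (c * N n)) sequentially"
  shows "upper_annealed_entropy V S \<nu> \<le> ereal c"
  unfolding upper_annealed_entropy_alt
proof (rule INF_lower2)
  show "limsup (\<lambda>n. ereal (1 / N n) * elog (mean_models (V n) (S n) \<nu> \<epsilon>)) \<le> ereal c"
    by (rule Limsup_bounded) (use assms(2) in \<open>simp only: mean_le_iff\<close>)
qed (use assms(1) in simp)

lemma upper_annealed_entropy_le_log:
  "upper_annealed_entropy V S \<mu> \<le> ereal (ln (real CARD('a)))"
proof (rule upper_annealed_entropy_leI[of 1])
  have "mean_models (V n) (S n) \<mu> 1 \<le> exp (ln (real CARD('a)) * N n)" for n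
  proof -
    have "real (card (good_models (V n) \<sigma> \<mu> 1)) \<le> real CARD('a) ^ card (V n)" for \<sigma>
      using card_good_models_le[OF finite_V, of n \<sigma> \<mu> 1] by (metis of_nat_le_iff of_nat_power)
    then have "mean_models (V n) (S n) \<mu> 1 \<le> real CARD('a) ^ card (V n)"
      unfolding mean_models_def
      by (intro measure_pmf.integral_le_const integrable_card_good_models[OF finite_V]) simp
    also have "\<dots> = exp (N n * ln (real CARD('a)))"
      by (simp add: exp_of_nat_mult)
    finally show ?thesis
      by (simp add: mult.commute)
  qed
  then show "eventually (\<lambda>n. mean_models (V n) (S n) \<mu> 1 \<le> exp (ln (real CARD('a)) * N n)) sequentially"
    by simp
qed simp

lemma upper_annealed_entropy_diagonal:
  "upper_annealed_entropy V S \<mu> \<le> upper_annealed_entropy V S (diagonal_joining \<mu>)"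
  unfolding upper_annealed_entropy_alt
proof (rule INF_mono)
  fix \<epsilon> :: real assume \<epsilon>: "\<epsilon> \<in> {0<..}"
  have le: "mean_models (V n) (S n) \<mu> \<epsilon> \<le> mean_models (V n) (S n) (diagonal_joining \<mu>) \<epsilon>" for n
    unfolding mean_models_def
  proof (rule integral_mono_AE)
    show "AE \<sigma> in measure_pmf (S n). real (card (good_models (V n) \<sigma> \<mu> \<epsilon>))
        \<le> real (card (good_models (V n) \<sigma> (diagonal_joining \<mu>) \<epsilon>))"
      using card_good_models_diagonal[OF finite_V nonempty_V _ config_prob, of _ n] homs[of n]
      by (auto simp: AE_measure_pmf_iff)
  qed (intro integrable_card_good_models finite_V)+
  have "limsup (\<lambda>n. ereal (1 / N n) * elog (mean_models (V n) (S n) \<mu> \<epsilon>))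
      \<le> limsup (\<lambda>n. ereal (1 / N n) * elog (mean_models (V n) (S n) (diagonal_joining \<mu>) \<epsilon>))"
  proof (rule Limsup_mono, rule always_eventually, rule allI)
    fix n
    have "elog (mean_models (V n) (S n) \<mu> \<epsilon>) \<le> elog (mean_models (V n) (S n) (diagonal_joining \<mu>) \<epsilon>)"
      using le[of n] by (auto simp: elog_def)
    then show "ereal (1 / N n) * elog (mean_models (V n) (S n) \<mu> \<epsilon>)
        \<le> ereal (1 / N n) * elog (mean_models (V n) (S n) (diagonal_joining \<mu>) \<epsilon>)"
      by (rule ereal_mult_left_mono) simp
  qed
  then show "\<exists>\<epsilon>'\<in>{0<..}. limsup (\<lambda>n. ereal (1 / N n) * elog (mean_models (V n) (S n) \<mu> \<epsilon>'))
      \<le> limsup (\<lambda>n. ereal (1 / N n) * elog (mean_models (V n) (S n) (diagonal_joining \<mu>) \<epsilon>))"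
    using \<epsilon> by blast
qed

abbreviation mean_radius :: "real \<Rightarrow> nat \<Rightarrow> real" where
  "mean_radius h n \<equiv> measure_pmf.expectation (S n) (\<lambda>\<sigma>. model_radius (V n) \<mu> \<sigma> h)"

lemma model_radius_V_bounds:
  assumes "h \<le> ln (real CARD('a))"
  shows "0 \<le> model_radius (V n) \<mu> \<sigma> h" "model_radius (V n) \<mu> \<sigma> h \<le> 2 * total_weight TYPE('k) + 1"
  using model_radius_bounds[OF finite_V nonempty_V config_prob assms] by auto

lemma integrable_model_radius:
  assumes "h \<le> ln (real CARD('a))"
  shows "integrable (measure_pmf (S n)) (\<lambda>\<sigma>. model_radius (V n) \<mu> \<sigma> h)"
  using model_radius_V_bounds[OF assms]
  by (intro integrable_bounded_pmf[where B = "2 * total_weight TYPE('k) + 1"]) (simp add: abs_le_iff)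

lemma mean_radius_nonneg:
  "h \<le> ln (real CARD('a)) \<Longrightarrow> mean_radius h n \<ge> 0"
  using model_radius_V_bounds by (intro Bochner_Integration.integral_nonneg) auto

lemma radius_nonneg:
  assumes "h \<le> ln (real CARD('a))"
  shows "0 \<le> lower_radius V S \<mu> h" "lower_radius V S \<mu> h \<le> upper_radius V S \<mu> h"
  unfolding lower_radius_def upper_radius_def
  using mean_radius_nonneg[OF assms]
  by (auto intro!: Liminf_bounded Liminf_le_Limsup)

text \<open>The first-moment bound: \<open>|\<Omega>(\<sigma>, \<mu>, \<epsilon>)| \<ge> e\<^bsup>h N\<^esup>\<close> as soon as the radius is below \<open>\<epsilon>\<close>, whence
  \<open>|\<Omega>(\<sigma>, \<mu>, \<epsilon>)| \<ge> e\<^bsup>h N\<^esup> (1 - \<rho> / \<epsilon>)\<close> in all cases.\<close>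

lemma mean_models_ge_if_small_radius:
  assumes "h \<le> ln (real CARD('a))" "\<epsilon> > 0" "mean_radius h n < \<epsilon> / 2"
  shows "exp (h * N n) / 2 \<le> mean_models (V n) (S n) \<mu> \<epsilon>"
proof -
  let ?\<rho> = "\<lambda>\<sigma>. model_radius (V n) \<mu> \<sigma> h"
  have "exp (h * N n) / 2 \<le> exp (h * N n) * (1 - mean_radius h n / \<epsilon>)"
    using assms(2,3) by (simp add: field_simps)
  also have "\<dots> = measure_pmf.expectation (S n) (\<lambda>\<sigma>. exp (h * N n) * (1 - ?\<rho> \<sigma> / \<epsilon>))"
    using integrable_model_radius[OF assms(1)] by simp
  also have "\<dots> \<le> mean_models (V n) (S n) \<mu> \<epsilon>"
    unfolding mean_models_def
  proof (rule integral_mono)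
    show "integrable (measure_pmf (S n)) (\<lambda>\<sigma>. exp (h * N n) * (1 - ?\<rho> \<sigma> / \<epsilon>))"
      using integrable_model_radius[OF assms(1)] by simp
    fix \<sigma>
    show "exp (h * N n) * (1 - ?\<rho> \<sigma> / \<epsilon>) \<le> real (card (good_models (V n) \<sigma> \<mu> \<epsilon>))"
    proof (cases "?\<rho> \<sigma> < \<epsilon>")
      case True
      have "exp (h * N n) * (1 - ?\<rho> \<sigma> / \<epsilon>) \<le> exp (h * N n) * 1"
        using model_radius_V_bounds(1)[OF assms(1)] assms(2) by (intro mult_left_mono) auto
      then show ?thesis
        using model_radius_lessD[OF finite_V nonempty_V config_prob assms(1) True] by linarith
    next
      case False
      then have "exp (h * N n) * (1 - ?\<rho> \<sigma> / \<epsilon>) \<le> 0"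
        using assms(2) by (simp add: mult_le_0_iff)
      then show ?thesis
        using order_trans by fastforce
    qed
  qed (rule integrable_card_good_models[OF finite_V])
  finally show ?thesis .
qed

lemma eventually_mean_models_ge:
  assumes "h \<le> ln (real CARD('a))" "\<epsilon> > 0" "c < h"
  shows "eventually (\<lambda>n. mean_radius h n < \<epsilon> / 2 \<longrightarrow>
    ereal c \<le> ereal (1 / N n) * elog (mean_models (V n) (S n) \<mu> \<epsilon>)) sequentially"
proof -
  have "eventually (\<lambda>n. 2 \<le> exp ((h - c) * N n)) sequentially"
    using assms(3) by (intro eventually_le_exp) simp
  then show ?thesis
  proof eventually_elim
    case (elim n)
    have "exp (c * N n) * 2 \<le> exp (c * N n) * exp ((h - c) * N n)"
      using elim by (intro mult_left_mono) auto
    also have "\<dots> = exp (h * N n)"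
      by (simp add: exp_add[symmetric] algebra_simps)
    finally have "exp (c * N n) \<le> exp (h * N n) / 2"
      by simp
    then show ?case
      using mean_models_ge_if_small_radius[OF assms(1,2), of n] unfolding mean_ge_iff by linarith
  qed
qed

lemma h_flat_le_lower: "h_flat V S \<mu> \<le> lower_annealed_entropy V S \<mu>"
  unfolding h_flat_def lower_annealed_entropy_alt
proof (intro SUP_least INF_greatest)
  fix h \<epsilon> :: real
  assume "h \<in> {h \<in> {0..ln (real CARD('a))}. upper_radius V S \<mu> h = 0}" and "\<epsilon> \<in> {0<..}"
  then have h: "h \<le> ln (real CARD('a))" and r: "upper_radius V S \<mu> h = 0" and \<epsilon>: "\<epsilon> > 0"
    by auto
  show "ereal h \<le> liminf (\<lambda>n. ereal (1 / N n) * elog (mean_models (V n) (S n) \<mu> \<epsilon>))"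
    unfolding le_Liminf_iff
  proof (intro allI impI)
    fix y assume "y < ereal h"
    then obtain c where c: "y < ereal c" "c < h"
      using ereal_dense2[of y "ereal h"] by auto
    have "limsup (\<lambda>n. ereal (mean_radius h n)) < ereal (\<epsilon> / 2)"
      using r \<epsilon> by (simp add: upper_radius_def)
    then have "eventually (\<lambda>n. ereal (mean_radius h n) < ereal (\<epsilon> / 2)) sequentially"
      by (rule Limsup_lessD)
    then show "eventually (\<lambda>n. y < ereal (1 / N n) * elog (mean_models (V n) (S n) \<mu> \<epsilon>)) sequentially"
      using eventually_mean_models_ge[OF h \<epsilon> c(2)]
    proof eventually_elim
      case (elim n)
      then show ?case
        using c(1) by (auto intro: less_le_trans)
    qed
  qed
qed

lemma h_sharp_le_upper: "h_sharp V S \<mu> \<le> upper_annealed_entropy V S \<mu>"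
  unfolding h_sharp_def upper_annealed_entropy_alt
proof (intro SUP_least INF_greatest)
  fix h \<epsilon> :: real
  assume "h \<in> {h \<in> {0..ln (real CARD('a))}. lower_radius V S \<mu> h = 0}" and "\<epsilon> \<in> {0<..}"
  then have h: "h \<le> ln (real CARD('a))" and r: "lower_radius V S \<mu> h = 0" and \<epsilon>: "\<epsilon> > 0"
    by auto
  let ?r = "\<lambda>n. ereal (1 / N n) * elog (mean_models (V n) (S n) \<mu> \<epsilon>)"
  show "ereal h \<le> limsup ?r"
  proof (rule ccontr)
    assume "\<not> ereal h \<le> limsup ?r"
    then obtain c where c: "limsup ?r < ereal c" "c < h"
      using ereal_dense2[of "limsup ?r" "ereal h"] by (auto simp: not_le)
    have "eventually (\<lambda>n. ?r n < ereal c) sequentially"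
      using c(1) by (rule Limsup_lessD)
    then have "eventually (\<lambda>n. ereal (\<epsilon> / 2) \<le> ereal (mean_radius h n)) sequentially"
      using eventually_mean_models_ge[OF h \<epsilon> c(2)]
      by eventually_elim (auto simp: not_le[symmetric])
    then have "ereal (\<epsilon> / 2) \<le> lower_radius V S \<mu> h"
      unfolding lower_radius_def by (rule Liminf_bounded)
    then show False
      using r \<epsilon> by simp
  qed
qed

lemma h_flat_le_h_sharp: "h_flat V S \<mu> \<le> h_sharp V S \<mu>"
  unfolding h_flat_def h_sharp_def
proof (rule SUP_subset_mono)
  show "{h \<in> {0..ln (real CARD('a))}. upper_radius V S \<mu> h = 0}
      \<subseteq> {h \<in> {0..ln (real CARD('a))}. lower_radius V S \<mu> h = 0}"
    using radius_nonneg by (auto intro: antisym) (metis antisym)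
qed simp

section \<open>Consequences of the second-moment condition\<close>

text \<open>The second moment counts pairs of good models. Each pair is a good model for one of finitely
  many self-joinings, and each of these contributes at most \<open>e\<^bsup>(2 l + \<eta> / 2) N\<^esup>\<close> on average.\<close>

lemma second_moment_bound:
  assumes smc: "second_moment_condition V S \<mu>" and l: "lower_annealed_entropy V S \<mu> = ereal l"
    and \<eta>: "\<eta> > 0"
  obtains \<epsilon> where "\<epsilon> > 0" "eventually (\<lambda>n. measure_pmf.expectation (S n)
      (\<lambda>\<sigma>. real (card (good_models (V n) \<sigma> \<mu> \<epsilon>)) ^ 2) \<le> exp ((2 * l + \<eta>) * N n)) sequentially"
proof -
  let ?c = "2 * l + \<eta> / 2"
  have "\<exists>e>0. eventually (\<lambda>n. mean_models (V n) (S n) \<nu> e \<le> exp (?c * N n)) sequentially"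
    if \<nu>: "\<nu> \<in> self_joinings \<mu>" for \<nu>
  proof -
    have "upper_annealed_entropy V S \<nu> \<le> 2 * ereal l"
      using smc \<nu> l by (auto simp: second_moment_condition_def)
    also have "2 * ereal l < ereal ?c"
      using \<eta> by simp
    finally obtain e where e: "e > 0"
      "limsup (\<lambda>n. ereal (1 / N n) * elog (mean_models (V n) (S n) \<nu> e)) < ereal ?c"
      unfolding upper_annealed_entropy_alt by (auto simp: INF_less_iff)
    have "eventually (\<lambda>n. mean_models (V n) (S n) \<nu> e \<le> exp (?c * N n)) sequentially"
      using Limsup_lessD[OF e(2)]
      by (rule eventually_mono) (simp only: mean_le_iff[symmetric] less_imp_le)
    then show ?thesis
      using e(1) by blast
  qed
  then have "\<forall>\<nu>\<in>self_joinings \<mu>. \<exists>e. e > 0 \<and>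
      eventually (\<lambda>n. mean_models (V n) (S n) \<nu> e \<le> exp (?c * N n)) sequentially"
    by blast
  then obtain e where e: "\<And>\<nu>. \<nu> \<in> self_joinings \<mu> \<Longrightarrow> e \<nu> > 0"
    "\<And>\<nu>. \<nu> \<in> self_joinings \<mu> \<Longrightarrow>
      eventually (\<lambda>n. mean_models (V n) (S n) \<nu> (e \<nu>) \<le> exp (?c * N n)) sequentially"
    by (auto dest!: bchoice)
  obtain \<Lambda> \<epsilon> where \<Lambda>: "finite \<Lambda>" "\<Lambda> \<subseteq> self_joinings \<mu>" and \<epsilon>: "\<epsilon> > 0"
    and cover: "\<And>\<nu>. \<nu> \<in> shift_invariant_measures \<Longrightarrow>
      transport_dist (distr \<nu> config_space (\<lambda>z. fst \<circ> z)) \<mu> < \<epsilon> \<Longrightarrow>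
      transport_dist (distr \<nu> config_space (\<lambda>z. snd \<circ> z)) \<mu> < \<epsilon> \<Longrightarrow>
      \<exists>\<nu>'\<in>\<Lambda>. transport_dist \<nu> \<nu>' < e \<nu>'"
    using near_joinings_covered[OF config_prob, of e] e(1) by blast
  have "eventually (\<lambda>n. \<forall>\<nu>\<in>\<Lambda>. mean_models (V n) (S n) \<nu> (e \<nu>) \<le> exp (?c * N n)) sequentially"
    using e(2) \<Lambda> by (intro eventually_ball_finite) auto
  moreover have "eventually (\<lambda>n. real (card \<Lambda>) \<le> exp (\<eta> / 2 * N n)) sequentially"
    using \<eta> by (intro eventually_le_exp) simp
  ultimately have "eventually (\<lambda>n. measure_pmf.expectation (S n)
      (\<lambda>\<sigma>. real (card (good_models (V n) \<sigma> \<mu> \<epsilon>)) ^ 2) \<le> exp ((2 * l + \<eta>) * N n)) sequentially"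
  proof eventually_elim
    case (elim n)
    have "measure_pmf.expectation (S n) (\<lambda>\<sigma>. real (card (good_models (V n) \<sigma> \<mu> \<epsilon>)) ^ 2)
        \<le> measure_pmf.expectation (S n) (\<lambda>\<sigma>. \<Sum>\<nu>\<in>\<Lambda>. real (card (good_models (V n) \<sigma> \<nu> (e \<nu>))))"
    proof (rule integral_mono_AE)
      show "AE \<sigma> in measure_pmf (S n). real (card (good_models (V n) \<sigma> \<mu> \<epsilon>)) ^ 2
          \<le> (\<Sum>\<nu>\<in>\<Lambda>. real (card (good_models (V n) \<sigma> \<nu> (e \<nu>))))"
      proof (unfold AE_measure_pmf_iff, rule ballI)
        fix \<sigma> assume "\<sigma> \<in> set_pmf (S n)"
        then have "\<sigma> \<in> action_homs (V n)"
          using homs by blast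
        then have "real (card (good_models (V n) \<sigma> \<mu> \<epsilon>) ^ 2)
            \<le> real (\<Sum>\<nu>\<in>\<Lambda>. card (good_models (V n) \<sigma> \<nu> (e \<nu>)))"
          unfolding of_nat_le_iff
          by (rule card_good_models_square_le[OF finite_V nonempty_V _ \<Lambda>(1) cover])
        then show "real (card (good_models (V n) \<sigma> \<mu> \<epsilon>)) ^ 2
            \<le> (\<Sum>\<nu>\<in>\<Lambda>. real (card (good_models (V n) \<sigma> \<nu> (e \<nu>))))"
          by simp
      qed
    qed (intro Bochner_Integration.integrable_sum integrable_card_good_models finite_V)+
    also have "\<dots> = (\<Sum>\<nu>\<in>\<Lambda>. mean_models (V n) (S n) \<nu> (e \<nu>))"
      unfolding mean_models_def
      by (intro Bochner_Integration.integral_sum integrable_card_good_models finite_V)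
    also have "\<dots> \<le> real (card \<Lambda>) * exp (?c * N n)"
      using elim(1) sum_bounded_above[of \<Lambda> "\<lambda>\<nu>. mean_models (V n) (S n) \<nu> (e \<nu>)" "exp (?c * N n)"]
      by simp
    also have "\<dots> \<le> exp (\<eta> / 2 * N n) * exp (?c * N n)"
      using elim(2) by (rule mult_right_mono) simp
    also have "\<dots> = exp ((2 * l + \<eta>) * N n)"
      by (simp add: exp_add[symmetric] algebra_simps)
    finally show ?case .
  qed
  then show ?thesis
    using that \<epsilon> by blast
qed

lemma Paley_Zygmund_good_models:
  assumes "measure_pmf.expectation (S n) (\<lambda>\<sigma>. real (card (good_models (V n) \<sigma> \<mu> \<epsilon>)) ^ 2) \<le> M" "M > 0"
  shows "mean_models (V n) (S n) \<mu> \<epsilon> ^ 2 \<le> 16 * M * measure_pmf.prob (S n)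
    {\<sigma>. mean_models (V n) (S n) \<mu> \<epsilon> / 2 \<le> real (card (good_models (V n) \<sigma> \<mu> \<epsilon>)) \<and>
      0 < real (card (good_models (V n) \<sigma> \<mu> \<epsilon>))}"
  unfolding mean_models_def
proof (rule second_moment_method[OF _ _ assms])
  show "real (card (good_models (V n) \<sigma> \<mu> \<epsilon>)) \<le> real (CARD('a) ^ card (V n))" for \<sigma>
    using card_good_models_le[OF finite_V] by (simp only: of_nat_le_iff)
qed simp

text \<open>Since \<open>(E |\<Omega>|)\<^sup>2\<close> is at most a constant times \<open>E (|\<Omega>|\<^sup>2)\<close>, the growth rate of the mean is
  eventually at most half of that of the second moment.\<close>

lemma upper_le_lower_annealed:
  assumes smc: "second_moment_condition V S \<mu>" and l: "lower_annealed_entropy V S \<mu> = ereal l"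
  shows "upper_annealed_entropy V S \<mu> \<le> ereal l"
proof (rule ereal_le_epsilon2)
  fix \<eta> :: real assume \<eta>: "\<eta> > 0"
  obtain \<epsilon> where \<epsilon>: "\<epsilon> > 0" and sm: "eventually (\<lambda>n. measure_pmf.expectation (S n)
      (\<lambda>\<sigma>. real (card (good_models (V n) \<sigma> \<mu> \<epsilon>)) ^ 2) \<le> exp ((2 * l + \<eta>) * N n)) sequentially"
    using second_moment_bound[OF smc l \<eta>] .
  have "eventually (\<lambda>n. 16 \<le> exp (\<eta> * N n)) sequentially"
    using \<eta> by (rule eventually_le_exp)
  with sm have "eventually (\<lambda>n. mean_models (V n) (S n) \<mu> \<epsilon> \<le> exp ((l + \<eta>) * N n)) sequentially"
  proof eventually_elim
    case (elim n)
    let ?M = "exp ((2 * l + \<eta>) * N n)"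
    have "mean_models (V n) (S n) \<mu> \<epsilon> ^ 2 \<le> 16 * ?M * measure_pmf.prob (S n)
      {\<sigma>. mean_models (V n) (S n) \<mu> \<epsilon> / 2 \<le> real (card (good_models (V n) \<sigma> \<mu> \<epsilon>)) \<and>
        0 < real (card (good_models (V n) \<sigma> \<mu> \<epsilon>))}"
      by (rule Paley_Zygmund_good_models[OF elim(1)]) simp
    also have "\<dots> \<le> 16 * ?M * 1"
      by (intro mult_left_mono measure_pmf.prob_le_1) simp
    also have "\<dots> \<le> exp (\<eta> * N n) * ?M"
      using elim(2) by simp
    also have "\<dots> = exp ((l + \<eta>) * N n) ^ 2"
      by (simp add: exp_add[symmetric] exp_of_nat_mult[symmetric] algebra_simps power2_eq_square)
    finally show ?case
      by (rule power2_le_imp_le) simp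
  qed
  then show "upper_annealed_entropy V S \<mu> \<le> ereal l + ereal \<eta>"
    using upper_annealed_entropy_leI[OF \<epsilon>] by simp
qed

text \<open>By the second moment, the number of good models is at least half of its mean, and hence the
  radius is small, with a probability that is at least \<open>e\<^bsup>-3\<eta>N\<^esup>\<close> up to a constant. If \<open>h = 0\<close>, a
  single good model makes the radius small, since \<open>e\<^bsup>h N\<^esup> = 1\<close>. The radius is a Lipschitz function
  of the homomorphism, so if its mean were not small, concentration would make that probability at
  most \<open>2 e\<^bsup>-CN(t/K)\<^sup>2\<^esup>\<close>, which is smaller once \<open>\<eta>\<close> is small enough compared with \<open>t\<close>.\<close>

lemma upper_radius_eq_0:
  assumes conc: "exponentially_concentrated V S"
    and smc: "second_moment_condition V S \<mu>" and l: "lower_annealed_entropy V S \<mu> = ereal l"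
    and h: "0 \<le> h" "h \<le> ln (real CARD('a))" "h < l \<or> h = 0"
  shows "upper_radius V S \<mu> h = 0"
proof (rule antisym)
  show "0 \<le> upper_radius V S \<mu> h"
    using radius_nonneg[OF h(2)] by (rule order_trans)
  define K where "K = switching_const TYPE('k) + 1"
  have K: "K > 0" and K': "switching_const TYPE('k) \<le> K"
    using switching_const_nonneg[where 'k = 'k] by (simp_all add: K_def)
  obtain C where C: "C > 0"
    and conc: "\<And>n f t. (\<forall>\<sigma>\<^sub>1\<in>action_homs (V n). \<forall>\<sigma>\<^sub>2\<in>action_homs (V n).
        \<bar>f \<sigma>\<^sub>1 - f \<sigma>\<^sub>2\<bar> \<le> switching_dist (V n) \<sigma>\<^sub>1 \<sigma>\<^sub>2) \<Longrightarrow> t > 0 \<Longrightarrow>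
      measure_pmf.prob (S n) {\<sigma>. \<bar>f \<sigma> - measure_pmf.expectation (S n) f\<bar> > t}
        \<le> 2 * exp (- C * N n * t ^ 2)"
    using conc unfolding exponentially_concentrated_def by blast
  have lip: "\<bar>model_radius (V n) \<mu> \<sigma>\<^sub>1 h / K - model_radius (V n) \<mu> \<sigma>\<^sub>2 h / K\<bar>
      \<le> switching_dist (V n) \<sigma>\<^sub>1 \<sigma>\<^sub>2"
    if "\<sigma>\<^sub>1 \<in> action_homs (V n)" "\<sigma>\<^sub>2 \<in> action_homs (V n)" for n \<sigma>\<^sub>1 \<sigma>\<^sub>2
  proof -
    have "\<bar>model_radius (V n) \<mu> \<sigma>\<^sub>1 h - model_radius (V n) \<mu> \<sigma>\<^sub>2 h\<bar>
        \<le> switching_const TYPE('k) * switching_dist (V n) \<sigma>\<^sub>1 \<sigma>\<^sub>2"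
      by (rule model_radius_lipschitz[OF finite_V nonempty_V config_prob h(2) that])
    also have "\<dots> \<le> K * switching_dist (V n) \<sigma>\<^sub>1 \<sigma>\<^sub>2"
      using K' by (intro mult_right_mono) (simp_all add: switching_dist_def)
    finally show ?thesis
      using K by (simp add: diff_divide_distrib[symmetric] abs_divide pos_divide_le_eq mult.commute)
  qed
  have "eventually (\<lambda>n. mean_radius h n \<le> 2 * t) sequentially" if t: "t > 0" for t
  proof -
    define D where "D = C * (t / K) ^ 2"
    have D: "D > 0"
      using C K t by (simp add: D_def)
    \<comment> \<open>\<open>D\<close> is the exponent supplied by concentration. With \<open>\<eta> \<le> D / 6\<close> the loss \<open>3 \<eta>\<close> is at most
      \<open>D / 2\<close>, and \<open>\<eta> \<le> (l - h) / 2\<close> leaves \<open>l - \<eta> > h\<close>.\<close>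
    define \<eta> where "\<eta> = (if h < l then min (D / 6) ((l - h) / 2) else D / 6)"
    have \<eta>: "\<eta> > 0" "\<eta> \<le> D / 6" "h < l \<Longrightarrow> \<eta> \<le> (l - h) / 2"
      using D by (auto simp: \<eta>_def min_def)
    obtain \<epsilon>\<^sub>0 where \<epsilon>\<^sub>0: "\<epsilon>\<^sub>0 > 0" and sm: "eventually (\<lambda>n. measure_pmf.expectation (S n)
        (\<lambda>\<sigma>. real (card (good_models (V n) \<sigma> \<mu> \<epsilon>\<^sub>0)) ^ 2) \<le> exp ((2 * l + \<eta>) * N n)) sequentially"
      using second_moment_bound[OF smc l \<eta>(1)] .
    define \<epsilon> where "\<epsilon> = min \<epsilon>\<^sub>0 t"
    have \<epsilon>: "\<epsilon> > 0" "\<epsilon> \<le> \<epsilon>\<^sub>0" "\<epsilon> \<le> t"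
      using \<epsilon>\<^sub>0 t by (auto simp: \<epsilon>_def)
    have "ereal (l - \<eta>) < lower_annealed_entropy V S \<mu>"
      using l \<eta>(1) by simp
    also have "\<dots> \<le> liminf (\<lambda>n. ereal (1 / N n) * elog (mean_models (V n) (S n) \<mu> \<epsilon>))"
      unfolding lower_annealed_entropy_alt using \<epsilon>(1) by (intro INF_lower) simp
    finally have "eventually (\<lambda>n. ereal (l - \<eta>) < ereal (1 / N n) * elog (mean_models (V n) (S n) \<mu> \<epsilon>)) sequentially"
      by (rule less_LiminfD)
    then have fm: "eventually (\<lambda>n. exp ((l - \<eta>) * N n) \<le> mean_models (V n) (S n) \<mu> \<epsilon>) sequentially"
      by (rule eventually_mono) (simp only: mean_ge_iff[symmetric] less_imp_le)
    have "0 < (if h < l then l - \<eta> - h else 1)"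
    proof (cases "h < l")
      case True
      then have "0 < l - \<eta> - h"
        using \<eta>(3)[OF True] by (simp add: field_simps)
      then show ?thesis
        by simp
    qed simp
    then have "eventually (\<lambda>n. 2 \<le> exp ((if h < l then l - \<eta> - h else 1) * N n)) sequentially"
      by (rule eventually_le_exp)
    \<comment> \<open>The two bounds on the probability of a small radius contradict each other as soon as
      \<open>e\<^bsup>D N / 2\<^esup> > 32 = 16 \<cdot> 2\<close>.\<close>
    moreover have "eventually (\<lambda>n. 33 \<le> exp (D / 2 * N n)) sequentially"
      using D by (intro eventually_le_exp) simp
    ultimately show ?thesis
      using fm sm
    proof eventually_elim
      case (elim n)
      let ?X = "\<lambda>\<sigma>. real (card (good_models (V n) \<sigma> \<mu> \<epsilon>))"
      let ?m = "mean_models (V n) (S n) \<mu> \<epsilon>" and ?M = "exp ((2 * l + \<eta>) * N n)"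
      let ?\<rho> = "\<lambda>\<sigma>. model_radius (V n) \<mu> \<sigma> h"
      let ?G = "{\<sigma>. ?m / 2 \<le> ?X \<sigma> \<and> 0 < ?X \<sigma>}"
      show ?case
      proof (rule ccontr)
        assume large: "\<not> mean_radius h n \<le> 2 * t"
        have "measure_pmf.expectation (S n) (\<lambda>\<sigma>. ?X \<sigma> ^ 2)
            \<le> measure_pmf.expectation (S n) (\<lambda>\<sigma>. real (card (good_models (V n) \<sigma> \<mu> \<epsilon>\<^sub>0)) ^ 2)"
          using card_good_models_mono[OF finite_V \<epsilon>(2)]
          by (intro integral_mono integrable_card_good_models finite_V power_mono) auto
        then have "?m ^ 2 \<le> 16 * ?M * measure_pmf.prob (S n) ?G"
          using elim(4) by (intro Paley_Zygmund_good_models) auto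
        moreover have "exp ((l - \<eta>) * N n) ^ 2 \<le> ?m ^ 2"
          using elim(3) by (rule power_mono) simp
        ultimately have "exp ((l - \<eta>) * N n) ^ 2 \<le> 16 * ?M * measure_pmf.prob (S n) ?G"
          by linarith
        also have "measure_pmf.prob (S n) ?G
            \<le> measure_pmf.prob (S n) {\<sigma>. \<bar>?\<rho> \<sigma> / K - measure_pmf.expectation (S n) (\<lambda>\<sigma>. ?\<rho> \<sigma> / K)\<bar> > t / K}"
        proof (rule measure_pmf.finite_measure_mono)
          show "?G \<subseteq> {\<sigma>. \<bar>?\<rho> \<sigma> / K - measure_pmf.expectation (S n) (\<lambda>\<sigma>. ?\<rho> \<sigma> / K)\<bar> > t / K}"
          proof
            fix \<sigma> assume \<sigma>: "\<sigma> \<in> ?G"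
            have "exp (h * N n) \<le> ?X \<sigma>"
            proof (cases "h < l")
              case True
              have "exp (h * N n) * 2 \<le> exp (h * N n) * exp ((l - \<eta> - h) * N n)"
                using elim(1) True by (intro mult_left_mono) auto
              also have "\<dots> = exp ((l - \<eta>) * N n)"
                by (simp add: exp_add[symmetric] algebra_simps)
              also have "\<dots> \<le> 2 * ?X \<sigma>"
                using elim(3) \<sigma> by simp
              finally show ?thesis
                by simp
            next
              case False
              then show ?thesis
                using h(3) \<sigma> by simp
            qed
            then have "?\<rho> \<sigma> \<le> t"
              using model_radius_le[OF finite_V nonempty_V \<epsilon>(1), of h n \<sigma> \<mu>] \<epsilon>(3) by linarith
            then have "t < \<bar>?\<rho> \<sigma> - mean_radius h n\<bar>"
              using large by linarith
            then have "t / K < \<bar>?\<rho> \<sigma> - mean_radius h n\<bar> / K"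
              using K by (rule divide_strict_right_mono)
            then show "\<sigma> \<in> {\<sigma>. \<bar>?\<rho> \<sigma> / K - measure_pmf.expectation (S n) (\<lambda>\<sigma>. ?\<rho> \<sigma> / K)\<bar> > t / K}"
              using K by (simp add: diff_divide_distrib[symmetric] abs_divide)
          qed
        qed simp
        also have "\<dots> \<le> 2 * exp (- C * N n * (t / K) ^ 2)"
          using lip K t by (intro conc) auto
        also have "\<dots> = 2 * exp (- D * N n)"
          by (simp add: D_def algebra_simps)
        finally have "exp ((l - \<eta>) * N n) ^ 2 \<le> 16 * ?M * (2 * exp (- D * N n))"
          by simp
        then have "exp ((2 * l - 2 * \<eta>) * N n) \<le> 32 * exp ((2 * l + \<eta> - D) * N n)"
          by (simp add: exp_add[symmetric] exp_of_nat_mult[symmetric] algebra_simps power2_eq_square)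
        then have "exp ((2 * l - 2 * \<eta>) * N n) * exp ((D - 2 * l - \<eta>) * N n)
            \<le> 32 * exp ((2 * l + \<eta> - D) * N n) * exp ((D - 2 * l - \<eta>) * N n)"
          by (rule mult_right_mono) simp
        then have "exp ((D - 3 * \<eta>) * N n) \<le> 32"
          by (simp add: mult.assoc exp_add[symmetric] algebra_simps)
        moreover have "exp (D / 2 * N n) \<le> exp ((D - 3 * \<eta>) * N n)"
          unfolding exp_le_cancel_iff using \<eta>(2) by (intro mult_right_mono) auto
        ultimately show False
          using elim(2) by linarith
      qed
    qed
  qed
  then have "upper_radius V S \<mu> h \<le> ereal (2 * t)" if "t > 0" for t
    unfolding upper_radius_def using that by (intro Limsup_bounded) simp
  then have "upper_radius V S \<mu> h \<le> 0 + ereal e" if "e > 0" for e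
    using that[THEN half_gt_zero] by (metis add_0 mult_2 field_sum_of_halves)
  then show "upper_radius V S \<mu> h \<le> 0"
    by (rule ereal_le_epsilon2)
qed

text \<open>The diagonal joining has at least the entropy of \<open>\<mu>\<close>, so the second-moment condition gives
  \<open>l \<le> 2 l\<close>. A finite annealed entropy can be negative in general, and no supremum over
  \<open>h \<ge> 0\<close> could equal it then.\<close>

lemma lower_annealed_entropy_nonneg:
  assumes smc: "second_moment_condition V S \<mu>" and l: "lower_annealed_entropy V S \<mu> = ereal l"
  shows "0 \<le> l"
proof -
  have "ereal l \<le> upper_annealed_entropy V S \<mu>"
    using lower_le_upper_annealed[of \<mu>] l by simp
  also have "\<dots> \<le> upper_annealed_entropy V S (diagonal_joining \<mu>)"
    by (rule upper_annealed_entropy_diagonal)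
  also have "\<dots> \<le> 2 * ereal l"
    using smc diagonal_joining_in_self_joinings[OF invariant] l by (auto simp: second_moment_condition_def)
  finally show ?thesis
    by simp
qed

lemma lower_annealed_le_h_flat:
  assumes conc: "exponentially_concentrated V S"
    and smc: "second_moment_condition V S \<mu>" and l: "lower_annealed_entropy V S \<mu> = ereal l"
  shows "ereal l \<le> h_flat V S \<mu>"
proof -
  have mem: "ereal h \<le> h_flat V S \<mu>" if "0 \<le> h" "h \<le> ln (real CARD('a))" "h < l \<or> h = 0" for h
    unfolding h_flat_def using that upper_radius_eq_0[OF conc smc l that] by (intro SUP_upper) simp
  have l0: "0 \<le> l"
    using smc l by (rule lower_annealed_entropy_nonneg)
  have lA: "l \<le> ln (real CARD('a))"
    using lower_le_upper_annealed[of \<mu>] upper_annealed_entropy_le_log l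
    by (metis ereal_less_eq(3) order_trans)
  show ?thesis
  proof (cases "l = 0")
    case True
    then show ?thesis
      using mem[of 0] lA by simp
  next
    case False
    show ?thesis
    proof (rule dense_le)
      fix y assume "y < ereal l"
      then have "max y 0 < ereal l"
        using False l0 by simp
      then obtain h where h: "max y 0 < ereal h" "h < l"
        using ereal_dense2[of "max y 0" "ereal l"] by auto
      then show "y \<le> h_flat V S \<mu>"
        using mem[of h] lA by (auto intro: order_trans less_imp_le)
    qed
  qed
qed

end

section \<open>Typical and annealed entropies coincide\<close>

theorem proposition2p6:
  fixes V :: "nat \<Rightarrow> 'v set"
    and S :: "nat \<Rightarrow> ('k::finite free_group \<Rightarrow> 'v \<Rightarrow> 'v) pmf"
    and \<mu> :: "('k free_group \<Rightarrow> 'a::finite) measure"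
  assumes "random_sofic_approximation V S"
    and "exponentially_concentrated V S"
    and "\<mu> \<in> shift_invariant_measures"
    and "second_moment_condition V S \<mu>"
  shows "h_flat V S \<mu> = lower_annealed_entropy V S \<mu> \<and>
    h_sharp V S \<mu> = upper_annealed_entropy V S \<mu>"
proof -
  interpret random_sofic_action V S \<mu>
    using assms(1,3) by unfold_locales
  let ?L = "lower_annealed_entropy V S \<mu>" and ?U = "upper_annealed_entropy V S \<mu>"
  show ?thesis
  proof (cases ?L)
    case (real l)
    have "?U \<le> ?L"
      using upper_le_lower_annealed[OF assms(4) real] real by simp
    moreover have "?L \<le> h_flat V S \<mu>"
      using lower_annealed_le_h_flat[OF assms(2,4) real] real by simp
    ultimately show ?thesis
      using h_flat_le_lower h_flat_le_h_sharp h_sharp_le_upper by (meson antisym order_trans)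
  next
    case PInf
    then have "?U = \<infinity>"
      using lower_le_upper_annealed[of \<mu>] by simp
    then show ?thesis
      using upper_annealed_entropy_le_log by simp
  next
    case MInf
    have "?U \<le> upper_annealed_entropy V S (diagonal_joining \<mu>)"
      by (rule upper_annealed_entropy_diagonal)
    also have "\<dots> \<le> 2 * ?L"
      using assms(4) diagonal_joining_in_self_joinings[OF assms(3)]
      by (auto simp: second_moment_condition_def)
    finally have "?U = -\<infinity>"
      using MInf by simp
    then show ?thesis
      using MInf h_flat_le_lower h_sharp_le_upper by simp
  qed
qed

end
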